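(* Let $\nu\in\mathbb{N}^*$, $h\in(0,1/2)$, let $\boldsymbol{B}$ be the multiparameter fractional Brownian motion of parameter $h$ on $\mathbb{R}_+^\nu$, and set $M(r)=\sup_{t\in[0,r]^\nu}|\boldsymbol{B}_t|$ for $r\in[0,1]$. Let $\widetilde{\Psi}^{(\ell)}(r)=(\log\log r^{-1})^{-h/\nu}$ and let $\widetilde{\Psi}^{(u)}$ be a function chosen as in the context. Then, almost surely, $$\liminf_{r\to0^+}\frac{M(r)}{r^{\nu h}\,\widetilde{\Psi}^{(\ell)}(r)}\geq\kappa_1^{h/\nu}\qquad\text{and}\qquad\liminf_{r\to0^+}\frac{M(r)}{r^{\nu h}\,\widetilde{\Psi}^{(u)}(r)}\leq\kappa_2^{h/\nu},$$ where $0<\kappa_1\leq\kappa_2<\infty$ are constants such that for any fixed $r\in(0,1)$ and any $\varepsilon>0$ small enough (compared to $r$), $$\exp\left\{-\kappa_2 \frac{r^{\nu^2}}{\varepsilon^{\nu/h}}\right\}\leq\mathbb{P}\left(\sup_{t\in[0,r]^\nu}|\boldsymbol{B}_t|\leq\varepsilon\right)\leq\exp\left\{-\kappa_1 \frac{r^{\nu^2}}{\varepsilon^{\nu/h}}\right\}.$$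
   Context: Process. $\boldsymbol{B}$ is the centred real Gaussian process on $\mathbb{R}_+^\nu$ (with continuous sample paths) with covariance $k^{(\nu)}(s,t)=\frac12\left(\lambda([0,s])^{2h}+\lambda([0,t])^{2h}-\lambda([0,s]\bigtriangleup[0,t])^{2h}\right)$, where $\lambda$ is Lebesgue measure, $[0,t]=\prod_i[0,t_i]$ and $\bigtriangleup$ is symmetric difference. Lévy measure. Let $H=L^2([0,1]^\nu,\lambda)$ and let $(H,E,\mu)$ be an abstract Wiener space with $E$ a separable Hilbert space and the embedding $H\subset E$ Hilbert–Schmidt; that is, $\mu$ is a centred Gaussian measure on $E$ whose Cameron–Martin space $H$ is densely embedded in $E$. Let $S\xi=\int_E x\langle\xi,x\rangle\,\mu(\mathrm{d}x)\in H$ for $\xi\in E^*$; $S(E^* )$ is dense in $H$. The function $\xi\mapsto\exp(-\frac12\|S\xi\|_H^{4h})$ is the Fourier transform of a symmetric strictly $4h$-stable probability measure on $E$; let $\Delta$ be its Lévy measure. It satisfies $\Delta(\{0\})=0$, $\int_E(1\wedge\|x\|_E^2)\Delta(\mathrm{d}x)<\infty$ and $\|S\xi\|_H^{4h}=2\int_E(1-\cos\langle\xi,x\rangle)\Delta(\mathrm{d}x)$ for $\xi\in E^*$. For $\varphi\in H$, expressions such as $e^{i\langle\mathcal{I}(\varphi),x\rangle}$ and $\cos\langle\mathcal{I}(\varphi),x\rangle$ are understood $\Delta$-a.e. by approximation: $1-e^{i\langle\mathcal{I}(\varphi),x\rangle}$ is the $L^2(\Delta)$-limit of $1-e^{i\langle\xi_n,x\rangle}$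 when $\xi_n\in E^*$, $S\xi_n\to\varphi$ in $H$. Function $\mathbf{F}$. Let $A(1)=\{\mathbf{1}_{[0,t]\bigtriangleup[0,s]}:\ s,t\in[0,1]^\nu\}\subset H$ and, for $y\geq0$, $$\mathbf{F}(y)=\sup_{\varphi\in A(1)}\int_{\|x\|_E<y}\left(1-\cos\langle\mathcal{I}(\varphi),x\rangle\right)\Delta(\mathrm{d}x).$$ $\mathbf{F}$ is continuous, increasing, and $\mathbf{F}(0)=0$; $\mathbf{F}^{-1}(z)=\inf\{y\ge 0:\mathbf{F}(y)\geq z\}$. Function $\widetilde{\Psi}^{(u)}$. Fix a small $\eta>0$ and an integer $k_0\geq2$ large enough that the following quantities are well defined for $k\ge k_0$ and $(r_k)$ is strictly decreasing. For $k\geq k_0$ set $$\epsilon_k=\mathbf{F}^{-1}\left((\log k)^{-2h/\nu-2\eta}\right),\qquad r_{k_0}=1,\qquad r_{k+1}=r_k\,\mathbf{F}(\epsilon_k)^{1/(2\nu h)}\,\epsilon_{k+1}^{2/\nu}.$$ $\widetilde{\Psi}^{(u)}$ is any increasing continuous function on $[0,1]$ with $\widetilde{\Psi}^{(u)}(0)=0$, with $\widetilde{\Psi}^{(u)}(r)\geq\widetilde{\Psi}^{(\ell)}(r)$ for all sufficiently small $r>0$, and with $\widetilde{\Psi}^{(u)}(r_k)=(\log k)^{-h/\nu}$ for all $k\geq k_0$. *)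

theory Defs
  imports "HOL-Probability.Probability"
begin

section \<open>Centred Gaussian variables and multiparameter fractional Brownian motion\<close>

text \<open>The degenerate law (a point mass at the origin) counts as Gaussian; the density
  \<^term>\<open>normal_density 0 \<sigma>\<close> describes only the case of positive variance.\<close>

definition centred_gaussian :: "'a measure \<Rightarrow> ('a \<Rightarrow> real) \<Rightarrow> bool" where
  "centred_gaussian M X \<longleftrightarrow>
     X \<in> borel_measurable M \<and>
     ((\<exists>\<sigma>>0. distributed M lborel X (normal_density 0 \<sigma>)) \<or> (AE \<omega> in M. X \<omega> = 0))"

text \<open>The order on \<^typ>\<open>real^'n\<close> is the componentwise one, so that \<^term>\<open>{0..t}\<close> is the rectangle
  \<open>[0,t]\<close> and \<^term>\<open>{0..} :: (real^'n) set\<close> is the closed positive orthant.\<close>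

definition mpfbm_cov :: "real \<Rightarrow> real^'n \<Rightarrow> real^'n \<Rightarrow> real" where
  "mpfbm_cov h s t =
     (measure lborel {0..s} powr (2 * h) + measure lborel {0..t} powr (2 * h)
       - measure lborel (sym_diff {0..s} {0..t}) powr (2 * h)) / 2"

definition mpfbm :: "'a measure \<Rightarrow> real \<Rightarrow> (real^'n \<Rightarrow> 'a \<Rightarrow> real) \<Rightarrow> bool" where
  "mpfbm M h B \<longleftrightarrow>
     prob_space M \<and>
     (\<forall>T c. finite T \<and> T \<subseteq> {0..} \<longrightarrow> centred_gaussian M (\<lambda>\<omega>. \<Sum>t\<in>T. c t * B t \<omega>)) \<and>
     (\<forall>s\<in>{0..}. \<forall>t\<in>{0..}. (LINT \<omega>|M. B s \<omega> * B t \<omega>) = mpfbm_cov h s t) \<and>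
     (\<forall>\<omega>\<in>space M. continuous_on {0..} (\<lambda>t. B t \<omega>))"

definition sup_abs :: "(real^'n \<Rightarrow> 'a \<Rightarrow> real) \<Rightarrow> real \<Rightarrow> 'a \<Rightarrow> real" where
  "sup_abs B r \<omega> = (SUP t\<in>{0..vec r}. \<bar>B t \<omega>\<bar>)"

definition small_ball_constants ::
    "'a measure \<Rightarrow> real \<Rightarrow> (real^'n \<Rightarrow> 'a \<Rightarrow> real) \<Rightarrow> real \<Rightarrow> real \<Rightarrow> bool" where
  "small_ball_constants M h B \<kappa>1 \<kappa>2 \<longleftrightarrow>
     0 < \<kappa>1 \<and> \<kappa>1 \<le> \<kappa>2 \<and>
     (\<forall>r\<in>{0<..<1}. \<forall>\<^sub>F \<epsilon> in at_right 0.
        exp (- \<kappa>2 * (r ^ (CARD('n)\<^sup>2) / \<epsilon> powr (real CARD('n) / h)))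
          \<le> measure M {\<omega> \<in> space M. sup_abs B r \<omega> \<le> \<epsilon>} \<and>
        measure M {\<omega> \<in> space M. sup_abs B r \<omega> \<le> \<epsilon>}
          \<le> exp (- \<kappa>1 * (r ^ (CARD('n)\<^sup>2) / \<epsilon> powr (real CARD('n) / h))))"


section \<open>The space \<open>L\<^sup>2([0,1]\<^sup>\<nu>)\<close>\<close>

text \<open>Elements of \<open>L\<^sup>2([0,1]\<^sup>\<nu>)\<close> are handled through representatives; two representatives
  \<open>f\<close>, \<open>g\<close> denote the same element iff \<open>l2_norm (\<lambda>u. f u - g u) = 0\<close>.\<close>

abbreviation cube_measure :: "(real^'n) measure" where
  "cube_measure \<equiv> lebesgue_on {0..vec 1}"

definition L2_cube :: "(real^'n \<Rightarrow> real) set" where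
  "L2_cube = {f \<in> borel_measurable cube_measure. integrable cube_measure (\<lambda>u. (f u)\<^sup>2)}"

definition l2_inner :: "(real^'n \<Rightarrow> real) \<Rightarrow> (real^'n \<Rightarrow> real) \<Rightarrow> real" where
  "l2_inner f g = (LINT u|cube_measure. f u * g u)"

definition l2_norm :: "(real^'n \<Rightarrow> real) \<Rightarrow> real" where
  "l2_norm f = sqrt (l2_inner f f)"

definition orthonormal_basis :: "(nat \<Rightarrow> real^'n \<Rightarrow> real) \<Rightarrow> bool" where
  "orthonormal_basis e \<longleftrightarrow>
     range e \<subseteq> L2_cube \<and>
     (\<forall>i j. l2_inner (e i) (e j) = (if i = j then 1 else 0)) \<and>
     (\<forall>f\<in>L2_cube. (\<forall>i. l2_inner f (e i) = 0) \<longrightarrow> l2_norm f = 0)"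

definition hilbert_schmidt :: "((real^'n \<Rightarrow> real) \<Rightarrow> 'e::real_inner) \<Rightarrow> bool" where
  "hilbert_schmidt J \<longleftrightarrow>
     (\<forall>f\<in>L2_cube. \<forall>g\<in>L2_cube. \<forall>a b. J (\<lambda>u. a * f u + b * g u) = a *\<^sub>R J f + b *\<^sub>R J g) \<and>
     (\<exists>C. \<forall>f\<in>L2_cube. norm (J f) \<le> C * l2_norm f) \<and>
     (\<exists>e. orthonormal_basis e \<and> summable (\<lambda>i. (norm (J (e i)))\<^sup>2))"


section \<open>Gaussian measures and abstract Wiener spaces\<close>

definition centred_gaussian_measure :: "'e::real_inner measure \<Rightarrow> bool" where
  "centred_gaussian_measure \<mu> \<longleftrightarrow>
     prob_space \<mu> \<and> sets \<mu> = sets borel \<and>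
     (\<forall>\<xi> :: 'e \<Rightarrow>\<^sub>L real. centred_gaussian \<mu> (blinfun_apply \<xi>))"

text \<open>The Cameron--Martin norm of \<open>x\<close> is the supremum of \<open>\<xi> x\<close> over all continuous functionals
  \<open>\<xi>\<close> whose norm in \<open>L\<^sup>2(\<mu>)\<close> is at most 1; the Cameron--Martin space consists of the points where
  it is finite.\<close>

definition cameron_martin_values :: "'e::real_inner measure \<Rightarrow> 'e \<Rightarrow> real set" where
  "cameron_martin_values \<mu> x =
     {blinfun_apply \<xi> x |\<xi> :: 'e \<Rightarrow>\<^sub>L real. (LINT y|\<mu>. (blinfun_apply \<xi> y)\<^sup>2) \<le> 1}"

definition cameron_martin_space :: "'e::real_inner measure \<Rightarrow> 'e set" where
  "cameron_martin_space \<mu> = {x. bdd_above (cameron_martin_values \<mu> x)}"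

definition cameron_martin_norm :: "'e::real_inner measure \<Rightarrow> 'e \<Rightarrow> real" where
  "cameron_martin_norm \<mu> x = Sup (cameron_martin_values \<mu> x)"

text \<open>\<open>J\<close> is the embedding of \<open>H = L\<^sup>2([0,1]\<^sup>\<nu>)\<close> into \<open>E\<close>. Being isometric onto the Cameron--Martin
  space, it respects almost everywhere equality and is injective modulo it.\<close>

definition abstract_wiener_space ::
    "((real^'n \<Rightarrow> real) \<Rightarrow> 'e::{real_inner, polish_space}) \<Rightarrow> 'e measure \<Rightarrow> bool" where
  "abstract_wiener_space J \<mu> \<longleftrightarrow>
     hilbert_schmidt J \<and> closure (J ` L2_cube) = UNIV \<and>
     centred_gaussian_measure \<mu> \<and>
     J ` L2_cube = cameron_martin_space \<mu> \<and>
     (\<forall>f\<in>L2_cube. cameron_martin_norm \<mu> (J f) = l2_norm f)"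

text \<open>\<open>S \<xi>\<close> belongs to \<open>H\<close>: the Bochner integral, which lies in \<open>E\<close>, is pulled back along \<open>J\<close>.\<close>

definition S_op ::
    "((real^'n \<Rightarrow> real) \<Rightarrow> 'e::{real_inner, polish_space}) \<Rightarrow> 'e measure
       \<Rightarrow> ('e \<Rightarrow>\<^sub>L real) \<Rightarrow> real^'n \<Rightarrow> real" where
  "S_op J \<mu> \<xi> = inv_into L2_cube J (LINT x|\<mu>. blinfun_apply \<xi> x *\<^sub>R x)"


section \<open>The stable law and its L\'evy measure\<close>

definition fourier :: "'e::real_inner measure \<Rightarrow> ('e \<Rightarrow>\<^sub>L real) \<Rightarrow> complex" where
  "fourier P \<xi> = (CLINT x|P. iexp (blinfun_apply \<xi> x))"

text \<open>L\'evy--Khintchine representation, with drift \<open>b\<close> and Gaussian component \<open>\<gamma>\<close>.\<close>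

definition levy_measure_of ::
    "'e::{real_inner, polish_space} measure \<Rightarrow> 'e measure \<Rightarrow> bool" where
  "levy_measure_of P \<Delta> \<longleftrightarrow>
     sets \<Delta> = sets borel \<and> emeasure \<Delta> {0} = 0 \<and> integrable \<Delta> (\<lambda>x. min 1 ((norm x)\<^sup>2)) \<and>
     (\<exists>b \<gamma>. centred_gaussian_measure \<gamma> \<and>
        (\<forall>\<xi>. fourier P \<xi> = fourier \<gamma> \<xi> *
           exp (\<i> * of_real (blinfun_apply \<xi> b) +
             (CLINT x|\<Delta>. iexp (blinfun_apply \<xi> x) - 1
                - \<i> * of_real (blinfun_apply \<xi> x * indicator (cball 0 1) x)))))"

definition wiener_stable_law ::
    "((real^'n \<Rightarrow> real) \<Rightarrow> 'e::{real_inner, polish_space}) \<Rightarrow> 'e measure \<Rightarrow> real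
       \<Rightarrow> 'e measure \<Rightarrow> bool" where
  "wiener_stable_law J \<mu> h P \<longleftrightarrow>
     prob_space P \<and> sets P = sets borel \<and>
     (\<forall>\<xi>. fourier P \<xi> = of_real (exp (- (l2_norm (S_op J \<mu> \<xi>) powr (4 * h)) / 2)))"


section \<open>The function \<open>F\<close>\<close>

text \<open>\<open>exp_I J \<mu> \<Delta> \<phi>\<close> is a version of \<open>x \<mapsto> exp (i \<langle>I(\<phi>),x\<rangle>)\<close>; it is determined up to
  \<open>\<Delta>\<close>-null sets because the image of \<^const>\<open>S_op\<close> is dense in \<open>H\<close>.\<close>

definition exp_I ::
    "((real^'n \<Rightarrow> real) \<Rightarrow> 'e::{real_inner, polish_space}) \<Rightarrow> 'e measure \<Rightarrow> 'e measure
       \<Rightarrow> (real^'n \<Rightarrow> real) \<Rightarrow> 'e \<Rightarrow> complex" where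
  "exp_I J \<mu> \<Delta> \<phi> = (SOME g. g \<in> borel_measurable \<Delta> \<and>
     (\<forall>\<xi> :: nat \<Rightarrow> 'e \<Rightarrow>\<^sub>L real.
        (\<lambda>n. l2_norm (\<lambda>u. S_op J \<mu> (\<xi> n) u - \<phi> u)) \<longlonglongrightarrow> 0 \<longrightarrow>
        (\<lambda>n. \<integral>\<^sup>+x. ennreal ((cmod ((1 - iexp (blinfun_apply (\<xi> n) x)) - (1 - g x)))\<^sup>2) \<partial>\<Delta>)
          \<longlonglongrightarrow> 0))"

definition A1 :: "(real^'n \<Rightarrow> real) set" where
  "A1 = {indicator (sym_diff {0..t} {0..s}) |s t. s \<in> {0..vec 1} \<and> t \<in> {0..vec 1}}"

definition F_fun ::
    "((real^'n \<Rightarrow> real) \<Rightarrow> 'e::{real_inner, polish_space}) \<Rightarrow> 'e measure \<Rightarrow> 'e measure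
       \<Rightarrow> real \<Rightarrow> real" where
  "F_fun J \<mu> \<Delta> y = (SUP \<phi>\<in>A1. LINT x:{x. norm x < y}|\<Delta>. 1 - Re (exp_I J \<mu> \<Delta> \<phi> x))"

definition F_inv :: "(real \<Rightarrow> real) \<Rightarrow> real \<Rightarrow> real" where
  "F_inv F z = Inf {y. 0 \<le> y \<and> z \<le> F y}"


section \<open>The rate functions\<close>

definition Psi_l :: "nat \<Rightarrow> real \<Rightarrow> real \<Rightarrow> real" where
  "Psi_l \<nu> h r = ln (ln (1 / r)) powr (- h / \<nu>)"

definition level :: "nat \<Rightarrow> real \<Rightarrow> real \<Rightarrow> nat \<Rightarrow> real" where
  "level \<nu> h \<eta> k = ln (real k) powr (- 2 * h / \<nu> - 2 * \<eta>)"

definition eps_seq :: "(real \<Rightarrow> real) \<Rightarrow> nat \<Rightarrow> real \<Rightarrow> real \<Rightarrow> nat \<Rightarrow> real" where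
  "eps_seq F \<nu> h \<eta> k = F_inv F (level \<nu> h \<eta> k)"

text \<open>The index is shifted: \<open>r_seq F \<nu> h \<eta> k0 j\<close> is the radius with index \<open>k0 + j\<close>.\<close>

primrec r_seq :: "(real \<Rightarrow> real) \<Rightarrow> nat \<Rightarrow> real \<Rightarrow> real \<Rightarrow> nat \<Rightarrow> nat \<Rightarrow> real" where
  "r_seq F \<nu> h \<eta> k0 0 = 1"
| "r_seq F \<nu> h \<eta> k0 (Suc j) =
     r_seq F \<nu> h \<eta> k0 j * F (eps_seq F \<nu> h \<eta> (k0 + j)) powr (1 / (2 * \<nu> * h))
       * eps_seq F \<nu> h \<eta> (k0 + Suc j) powr (2 / \<nu>)"

text \<open>\<^const>\<open>F_inv\<close> is meaningful at a level iff \<open>F\<close> reaches that level.\<close>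

definition admissible_start :: "(real \<Rightarrow> real) \<Rightarrow> nat \<Rightarrow> real \<Rightarrow> real \<Rightarrow> nat \<Rightarrow> bool" where
  "admissible_start F \<nu> h \<eta> k0 \<longleftrightarrow>
     2 \<le> k0 \<and> (\<forall>k\<ge>k0. \<exists>y\<ge>0. level \<nu> h \<eta> k \<le> F y) \<and>
     (\<forall>j. r_seq F \<nu> h \<eta> k0 (Suc j) < r_seq F \<nu> h \<eta> k0 j)"

definition upper_rate ::
    "(real \<Rightarrow> real) \<Rightarrow> nat \<Rightarrow> real \<Rightarrow> real \<Rightarrow> nat \<Rightarrow> (real \<Rightarrow> real) \<Rightarrow> bool" where
  "upper_rate F \<nu> h \<eta> k0 \<Psi> \<longleftrightarrow>
     mono_on {0..1} \<Psi> \<and> continuous_on {0..1} \<Psi> \<and> \<Psi> 0 = 0 \<and>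
     (\<forall>\<^sub>F r in at_right 0. Psi_l \<nu> h r \<le> \<Psi> r) \<and>
     (\<forall>j. \<Psi> (r_seq F \<nu> h \<eta> k0 j) = ln (real (k0 + j)) powr (- h / \<nu>))"

end

theory Submission
  imports Defs "HOL-Real_Asymp.Real_Asymp"
begin

text \<open>Near zero the upper rate dominates \<open>Psi_l\<close>, so both bounds follow from Chung's law of the
  iterated logarithm for \<open>Psi_l\<close> itself.

  The trapezoid equal to 1 on \<open>[-1, 1]\<close> and to 0 outside \<open>[-\<theta>, \<theta>]\<close> is the Fourier transform of
  a bounded density with respect to the Cauchy law. Hence expectations of products of trapezoids of
  jointly Gaussian variables are explicit integrals in the covariance. This shows that probabilities
  of boxes depend only on the covariance (which gives self-similarity), bounds them when the
  covariance dominates a multiple of the identity, and shows that two weakly correlated blocks are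
  nearly independent.

  Upper bound for small balls: \<open>exp (- v * dist)\<close> is, on a grid, a product of geometric kernels
  and of a Schur multiplier with unit diagonal, whence strong local nondeterminism. Lower bound:
  two independent copies of the process, quantised along dyadic increments, share a cell with
  sufficient probability, and their difference is again the process up to a factor \<open>sqrt 2\<close>.

  Lower bound of the liminf: Borel--Cantelli along a geometric sequence. Upper bound: a second moment
  argument along \<open>r k = exp (- k powr (1 + \<delta>))\<close>, with nets whose size is a small power of \<open>k\<close>, so
  that the loss from the product of trapezoids is beaten by the decay of correlations.\<close>

section \<open>Scale-invariant integrals and the Fourier representation of a trapezoid\<close>

text \<open>The constants \<kappa>1 and \<kappa>2 are known only through the small-ball estimates,
  so neither liminf bound may lose a factor. Every loss is made a factor arbitrarily close to 1 and
  removed along a sequence at the end: the ratio of consecutive radii in the lower bound; the width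
  \<theta> of the trapezoid, the growth exponent 1 + \<delta> and the chaining error in the upper
  bound. Taking \<theta> close to 1 is costly: a product of n trapezoids carries \<Lambda> ^ n, with
  \<Lambda> depending on \<theta>. Hence near independence is only claimed on nets of about k powr
  (\<delta> / 4) points, against correlations of size exp (- c * k powr \<delta>), and the
  polynomial mesh of these nets is made up for by moments of high order. The reference law must have
  tails of order 1 / u^2, like the transform of a trapezoid; it then has no first moment, which
  explains the square roots of covariances in the error terms. The small-ball estimates may lose
  constants, so \<theta> = 2 and factors 2 and 4 are good enough there.\<close>

lemma set_integrable_powr_from_0:
  fixes a :: real
  assumes "a > -1"
  shows "set_integrable lborel {0<..1} (\<lambda>x. x powr a)"
proof -
  have "(\<lambda>x. x powr a) integrable_on {0<..1}"
    using integrable_on_powr_from_0'[of a 1] assms by simp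
  then have "(\<lambda>x. x powr a) absolutely_integrable_on {0<..1}"
    by (intro nonnegative_absolutely_integrable_1) auto
  then show ?thesis
    unfolding set_integrable_def by (subst (asm) integrable_completion) auto
qed

lemma set_integrable_powr_to_inf:
  fixes a :: real
  assumes "a < -1"
  shows "set_integrable lborel {1<..} (\<lambda>x. x powr a)"
proof -
  have "(\<lambda>x. x powr a) integrable_on {1..}"
    using has_integral_powr_to_inf[OF assms, of 1] unfolding integrable_on_def by auto
  then have "(\<lambda>x. x powr a) absolutely_integrable_on {1..}"
    by (intro nonnegative_absolutely_integrable_1) auto
  then have "set_integrable lborel {1..} (\<lambda>x. x powr a)"
    unfolding set_integrable_def by (subst (asm) integrable_completion) auto
  then show ?thesis
    by (rule set_integrable_subset) auto
qed

text \<open>The measure v powr (- \<alpha> - 1) dv picks up the factor x powr \<alpha> under the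
  substitution of v * x for v. Integrability at 0 comes from p > \<alpha>, at infinity from \<alpha>
  > 0; positivity of f on (0, 1) gives C > 0. Applied to 1 - exp (- v) and to 1 - cos v.\<close>

lemma scale_invariant_integral:
  fixes f :: "real \<Rightarrow> real" and \<alpha> p K :: real
  assumes [measurable]: "f \<in> borel_measurable borel"
    and f0: "\<And>v. v > 0 \<Longrightarrow> 0 \<le> f v" and f2: "\<And>v. v > 0 \<Longrightarrow> f v \<le> K"
    and fp: "\<And>v. v > 0 \<Longrightarrow> f v \<le> K * v powr p"
    and pos: "\<And>v. 0 < v \<Longrightarrow> v < 1 \<Longrightarrow> 0 < f v"
    and \<alpha>: "0 < \<alpha>" "\<alpha> < p"
  obtains C where "C > 0"
    "\<And>x. x > 0 \<Longrightarrow> has_bochner_integral lborel (\<lambda>v. indicator {0<..} v * (f (v * x) * v powr (-\<alpha>-1))) (C * x powr \<alpha>)"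
proof -
  define g where "g v = indicator {0<..} v * (f v * v powr (-\<alpha>-1))" for v :: real
  have [measurable]: "g \<in> borel_measurable borel" unfolding g_def by measurable
  have dom: "integrable lborel (\<lambda>v. indicator {0<..1} v * (K * v powr (p-\<alpha>-1)) + indicator {1<..} v * (K * v powr (-\<alpha>-1)))"
  proof (rule Bochner_Integration.integrable_add)
    show "integrable lborel (\<lambda>v. indicator {0<..1} v * (K * v powr (p-\<alpha>-1)))"
      using set_integrable_mult_right[OF set_integrable_powr_from_0[of "p-\<alpha>-1"], of K] \<alpha>
      by (simp add: set_integrable_def)
    show "integrable lborel (\<lambda>v. indicator {1<..} v * (K * v powr (-\<alpha>-1)))"
      using set_integrable_mult_right[OF set_integrable_powr_to_inf[of "-\<alpha>-1"], of K] \<alpha>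
      by (simp add: set_integrable_def)
  qed
  have gint: "integrable lborel g"
  proof (rule Bochner_Integration.integrable_bound[OF dom])
    show "AE v in lborel. norm (g v) \<le> norm (indicator {0<..1} v * (K * v powr (p-\<alpha>-1)) + indicator {1<..} v * (K * v powr (-\<alpha>-1)))"
    proof (rule AE_I2)
      fix v :: real
      consider "v \<le> 0" | "0 < v" "v \<le> 1" | "1 < v" by linarith
      then show "norm (g v) \<le> norm (indicator {0<..1} v * (K * v powr (p-\<alpha>-1)) + indicator {1<..} v * (K * v powr (-\<alpha>-1)))"
      proof cases
        case 1
        then show ?thesis by (simp add: g_def)
      next
        case 2
        have "f v * v powr (-\<alpha>-1) \<le> K * v powr p * v powr (-\<alpha>-1)"
          using fp[of v] 2 by (intro mult_right_mono) auto
        also have "\<dots> = K * v powr (p-\<alpha>-1)" by (simp add: powr_add[symmetric] mult.assoc algebra_simps)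
        finally show ?thesis using 2 f0[of v] by (simp add: g_def)
      next
        case 3
        have "f v * v powr (-\<alpha>-1) \<le> K * v powr (-\<alpha>-1)"
          using f2[of v] 3 by (intro mult_right_mono) auto
        then show ?thesis using 3 f0[of v] by (simp add: g_def)
      qed
    qed
  qed simp
  define C where "C = integral\<^sup>L lborel g"
  have "C > 0"
  proof -
    have "C \<ge> 0" unfolding C_def by (intro integral_nonneg_AE AE_I2) (auto simp: g_def f0 indicator_def)
    moreover have "C \<noteq> 0"
    proof
      assume "C = 0"
      then have "AE v in lborel. g v = 0"
        unfolding C_def by (subst (asm) integral_nonneg_eq_0_iff_AE[OF gint])
          (auto simp: g_def f0 indicator_def)
      then have "AE v in lborel. v \<notin> {0<..<1::real}"
      proof eventually_elim
        case (elim v)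
        then show ?case using pos[of v] by (auto simp: g_def)
      qed
      then have "emeasure lborel {0<..<1::real} = 0"
        by (subst (asm) AE_iff_measurable[where N="{0<..<1::real}"]) auto
      then show False by simp
    qed
    ultimately show ?thesis by simp
  qed
  moreover have "has_bochner_integral lborel (\<lambda>v. indicator {0<..} v * (f (v * x) * v powr (-\<alpha>-1))) (C * x powr \<alpha>)" if x: "x > 0" for x
  proof -
    have eq: "indicator {0<..} v * (f (v * x) * v powr (-\<alpha>-1)) = x powr (\<alpha>+1) * g (0 + x * v)" for v
    proof (cases "v > 0")
      case True
      have "x powr (\<alpha>+1) * (x * v) powr (-\<alpha>-1) = v powr (-\<alpha>-1)"
      proof -
        have "x powr (\<alpha>+1) * (x * v) powr (-\<alpha>-1) = (x powr (\<alpha>+1) * x powr (-\<alpha>-1)) * v powr (-\<alpha>-1)"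
          using x True by (simp add: powr_mult)
        also have "x powr (\<alpha>+1) * x powr (-\<alpha>-1) = 1" using x by (simp add: powr_add[symmetric])
        finally show ?thesis by simp
      qed
      then show ?thesis using True x by (simp add: g_def mult.commute mult.left_commute)
    next
      case False
      then show ?thesis using x by (simp add: g_def zero_less_mult_iff)
    qed
    have i1: "integrable lborel (\<lambda>v. g (0 + x * v))"
      by (rule lborel_integrable_real_affine[OF gint]) (use x in simp)
    have i2: "C = x * (\<integral>v. g (0 + x * v) \<partial>lborel)"
      unfolding C_def using lborel_integral_real_affine[of x g 0] x by simp
    have "has_bochner_integral lborel (\<lambda>v. x powr (\<alpha>+1) * g (0 + x * v)) (x powr (\<alpha>+1) * (C / x))"
      using has_bochner_integral_integrable[OF i1] i2 x
      by (intro has_bochner_integral_mult_right) auto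
    moreover have "x powr (\<alpha>+1) * (C / x) = C * x powr \<alpha>"
      using x by (simp add: powr_add)
    ultimately show ?thesis by (simp only: eq)
  qed
  ultimately show ?thesis using that by blast
qed

text \<open>Reduces quadratic forms in the kernel d powr (2 * h) to quadratic forms in exp (- v *
  d), integrated over v.\<close>

lemma powr_Laplace_representation:
  fixes \<beta> :: real
  assumes "0 < \<beta>" "\<beta> < 1"
  obtains C where "C > 0"
    "\<And>x. x \<ge> 0 \<Longrightarrow> has_bochner_integral lborel
        (\<lambda>v. indicator {0<..} v * ((1 - exp (- (v * x))) * v powr (-\<beta>-1))) (C * x powr \<beta>)"
proof -
  obtain C :: real where C: "C > 0"
    "\<And>x. x > 0 \<Longrightarrow> has_bochner_integral lborel (\<lambda>v. indicator {0<..} v * ((1 - exp (- (v * x))) * v powr (-\<beta>-1))) (C * x powr \<beta>)"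
  proof (rule scale_invariant_integral[of "\<lambda>v. 1 - exp (- v)" 1 1 \<beta>])
    show "1 - exp (- v) \<le> 1 * v powr 1" if "v > 0" for v :: real
      using exp_ge_add_one_self[of "-v"] that by (simp add: powr_one)
  qed (use assms in auto)
  have "has_bochner_integral lborel
        (\<lambda>v. indicator {0<..} v * ((1 - exp (- (v * x))) * v powr (-\<beta>-1))) (C * x powr \<beta>)" if "x \<ge> 0" for x :: real
    using C(2)[of x] that assms by (cases "x = 0") auto
  with C(1) show ?thesis using that by blast
qed

text \<open>The exponent 1 is admissible because 1 - cos v is O(v^2) at the origin. A trapezoid is a
  combination of four functions |x - c|, so this determines its Fourier transform.\<close>

lemma abs_cos_representation:
  obtains C :: real where "C > 0"
    "\<And>x. has_bochner_integral lborel (\<lambda>u. (1 - cos (u * x)) / u\<^sup>2) (C * \<bar>x\<bar>)"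
proof -
  obtain C :: real where C: "C > 0"
    "\<And>x. x > 0 \<Longrightarrow> has_bochner_integral lborel (\<lambda>v. indicator {0<..} v * ((1 - cos (v * x)) * v powr (-1-1))) (C * x powr 1 :: real)"
  proof (rule scale_invariant_integral[of "\<lambda>v. 1 - cos v" 2 2 1])
    show "1 - cos v \<le> 2 * v powr 2" if "v > 0" for v :: real
    proof -
      have "1 - cos v = 2 * (sin (v/2))\<^sup>2" using cos_double_sin[of "v/2"] by simp
      also have "(sin (v/2))\<^sup>2 \<le> (v/2)\<^sup>2"
        using abs_sin_x_le_abs_x[of "v/2"] by (simp only: abs_le_square_iff)
      finally have "1 - cos v \<le> 2 * (v/2)\<^sup>2" by simp
      moreover have "(v/2)\<^sup>2 = v\<^sup>2 / 4" by (simp add: power_divide)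
      moreover have "v powr 2 = v\<^sup>2" using that by simp
      ultimately show ?thesis using zero_le_power2[of v] by linarith
    qed
    show "1 - cos v \<le> 2" for v :: real using cos_ge_minus_one[of v] by simp
    show "0 < 1 - cos v" if "0 < v" "v < 1" for v :: real
      using cos_monotone_0_pi[of 0 v] that pi_gt3 by simp
    fix C :: real
    assume "0 < C" and "\<And>x. 0 < x \<Longrightarrow> has_bochner_integral lborel
      (\<lambda>v. indicator {0<..} v * ((1 - cos (v * x)) * v powr (-1-1))) (C * x powr 1)"
    then show thesis by (rule that)
  qed auto
  have "has_bochner_integral lborel (\<lambda>u. (1 - cos (u * x)) / u\<^sup>2) (2 * (C * \<bar>x\<bar>))" for x :: real
  proof (cases "x = 0")
    case False
    \<comment> \<open>The integrand is even in u and in x, so the half line with |x| for x carries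
      half of the integral.\<close>
    have "has_bochner_integral lborel (\<lambda>u. indicator {0..} u *\<^sub>R ((1 - cos (u * \<bar>x\<bar>)) / u\<^sup>2)) (C * \<bar>x\<bar>)"
    proof (rule has_bochner_integral_cong[THEN iffD1, OF refl _ _ C(2)])
      fix v :: real
      show "indicator {0<..} v * ((1 - cos (v * \<bar>x\<bar>)) * v powr (-1-1)) = indicator {0..} v *\<^sub>R ((1 - cos (v * \<bar>x\<bar>)) / v\<^sup>2)"
        by (cases "v > 0") (auto simp: indicator_def powr_minus powr_numeral field_simps)
    qed (use False in auto)
    then have "has_bochner_integral lborel (\<lambda>u. (1 - cos (u * \<bar>x\<bar>)) / u\<^sup>2) (2 *\<^sub>R (C * \<bar>x\<bar>))"
      by (rule has_bochner_integral_even_function) simp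
    moreover have "cos (u * \<bar>x\<bar>) = cos (u * x)" for u by (cases "x \<ge> 0") auto
    ultimately show ?thesis by simp
  qed (simp add: has_bochner_integral_zero)
  then show ?thesis using that[of "2 * C"] C(1) by (simp add: mult.assoc)
qed

section \<open>The Cauchy law as reference measure\<close>

definition cauchy_mass :: real where
  "cauchy_mass = (\<integral>u. 1 / (1 + u\<^sup>2) \<partial>lborel)"

text \<open>The weight 1 / (1 + u^2) decays like the Fourier transform of a trapezoid, which
  therefore has a bounded density against it, while the moment of order 1/2 stays finite. The
  normalising constant \<open>cauchy_mass\<close> equals pi.\<close>

definition cauchy_law :: "real measure" where
  "cauchy_law = density lborel (\<lambda>u. ennreal (1 / (1 + u\<^sup>2) / cauchy_mass))"

lemma integrable_powr_div_1_plus_square: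
  fixes p :: real
  assumes "0 \<le> p" "p < 1"
  shows "integrable lborel (\<lambda>u. \<bar>u\<bar> powr p / (1 + u\<^sup>2))"
proof -
  have "integrable lborel (\<lambda>u. indicator {0<..1} u * 1 + indicator {1<..} u * u powr (p - 2))"
  proof (rule Bochner_Integration.integrable_add)
    show "integrable lborel (\<lambda>v::real. indicator {0<..1} v * 1 :: real)"
      using set_integrable_powr_from_0[of "0"] 
      by (simp add: set_integrable_def)
    show "integrable lborel (\<lambda>v. indicator {1<..} v * v powr (p-2))"
      using set_integrable_powr_to_inf[of "p-2"] assms
      by (simp add: set_integrable_def)
  qed
  then have "integrable lborel (\<lambda>u. indicator {0..} u * (\<bar>u\<bar> powr p / (1 + u\<^sup>2)))"
  proof (rule Bochner_Integration.integrable_bound)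
    show "AE u in lborel. norm (indicator {0..} u * (\<bar>u\<bar> powr p / (1 + u\<^sup>2)))
        \<le> norm (indicator {0<..1} u * 1 + indicator {1<..} u * u powr (p - 2) :: real)"
      using AE_lborel_singleton[of "0::real"]
    proof eventually_elim
      fix u :: real assume "u \<noteq> 0"
      then consider "u < 0" | "0 < u" "u \<le> 1" | "1 < u" by linarith
      then show "norm (indicator {0..} u * (\<bar>u\<bar> powr p / (1 + u\<^sup>2)))
        \<le> norm (indicator {0<..1} u * 1 + indicator {1<..} u * u powr (p - 2) :: real)"
      proof cases
        case 1
        then show ?thesis by simp
      next
        case 2
        have "u powr p \<le> 1" using 2 assms by (simp add: powr_le1)
        also have "1 \<le> 1 + u\<^sup>2" by simp
        finally have "u powr p / (1 + u\<^sup>2) \<le> 1" by (subst divide_le_eq_1_pos) (auto intro: add_pos_nonneg)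
        then show ?thesis using 2 by simp
      next
        case 3
        have "u powr p / (1 + u\<^sup>2) \<le> u powr p / u\<^sup>2" using 3
          by (intro divide_left_mono) (auto intro!: mult_pos_pos add_pos_nonneg)
        also have "\<dots> = u powr (p-2)" using 3 by (simp add: powr_diff powr_numeral)
        finally show ?thesis using 3 by simp
      qed
    qed
  qed simp
  then have "has_bochner_integral lborel (\<lambda>u. indicator {0..} u *\<^sub>R (\<bar>u\<bar> powr p / (1 + u\<^sup>2)))
     (\<integral>u. indicator {0..} u * (\<bar>u\<bar> powr p / (1 + u\<^sup>2)) \<partial>lborel)"
    by (simp add: has_bochner_integral_integrable)
  then have "has_bochner_integral lborel (\<lambda>u. \<bar>u\<bar> powr p / (1 + u\<^sup>2))
     (2 *\<^sub>R (\<integral>u. indicator {0..} u * (\<bar>u\<bar> powr p / (1 + u\<^sup>2)) \<partial>lborel))"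
    by (rule has_bochner_integral_even_function) simp
  then show ?thesis by (simp add: has_bochner_integral_iff)
qed

lemma integrable_1_div_1_plus_square: "integrable lborel (\<lambda>u::real. 1 / (1 + u\<^sup>2))"
proof -
  \<comment> \<open>\<open>0 powr 0\<close> is 0, so the two integrands differ at the
    origin.\<close>
  have "AE x::real in lborel. \<bar>x\<bar> powr 0 / (1 + x\<^sup>2) = 1 / (1 + x\<^sup>2)"
    by (rule AE_mp[OF AE_lborel_singleton[of 0]]) auto
  then show ?thesis
    using integrable_powr_div_1_plus_square[of 0]
      integrable_cong_AE[of "\<lambda>x::real. \<bar>x\<bar> powr 0 / (1 + x\<^sup>2)" lborel "\<lambda>x. 1 / (1 + x\<^sup>2)"]
    by simp
qed

lemma cauchy_mass_pos: "0 < cauchy_mass"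
proof -
  have "0 \<le> cauchy_mass" unfolding cauchy_mass_def by (intro integral_nonneg_AE) auto
  moreover have "cauchy_mass \<noteq> 0"
  proof
    assume "cauchy_mass = 0"
    then have "AE u in lborel. 1 / (1 + u\<^sup>2) = (0::real)"
      unfolding cauchy_mass_def
      using integral_nonneg_eq_0_iff_AE[OF integrable_1_div_1_plus_square] by simp
    then have "AE u in lborel. u \<notin> (UNIV::real set)"
      by eventually_elim (simp add: add_nonneg_eq_0_iff)
    then show False by (subst (asm) AE_iff_measurable[where N="UNIV"]) auto
  qed
  ultimately show ?thesis by simp
qed

lemma sets_cauchy_law [measurable_cong, simp]: "sets cauchy_law = sets borel"
  by (simp add: cauchy_law_def)

lemma space_cauchy_law [simp]: "space cauchy_law = UNIV"
  by (simp add: cauchy_law_def)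

lemma prob_space_cauchy_law: "prob_space cauchy_law"
proof
  have "emeasure cauchy_law (space cauchy_law) = (\<integral>\<^sup>+u. ennreal (1 / (1 + u\<^sup>2) / cauchy_mass) \<partial>lborel)"
    unfolding cauchy_law_def by (subst emeasure_density) auto
  also have "\<dots> = ennreal (\<integral>u. 1 / (1 + u\<^sup>2) / cauchy_mass \<partial>lborel)"
    using integrable_1_div_1_plus_square cauchy_mass_pos
    by (intro nn_integral_eq_integral integrable_divide_zero) auto
  also have "(\<integral>u. 1 / (1 + u\<^sup>2) / cauchy_mass \<partial>lborel) = cauchy_mass / cauchy_mass"
    unfolding integral_divide_zero by (simp only: cauchy_mass_def)
  also have "\<dots> = 1" using cauchy_mass_pos by simp
  finally show "emeasure cauchy_law (space cauchy_law) = 1" by simp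
qed

lemma integrable_cauchy_law_sqrt: "integrable cauchy_law (\<lambda>u. sqrt \<bar>u\<bar>)"
proof -
  have "integrable lborel (\<lambda>u. sqrt \<bar>u\<bar> / (1 + u\<^sup>2) / cauchy_mass)"
    using integrable_powr_div_1_plus_square[of "1/2"]
    by (intro integrable_divide_zero) (simp add: powr_half_sqrt)
  then show ?thesis
    unfolding cauchy_law_def using cauchy_mass_pos by (subst integrable_density) auto
qed

text \<open>Written through its four kinks, because absolute values are what
  \<open>abs_cos_representation\<close> transforms.\<close>

definition trapezoid :: "real \<Rightarrow> real \<Rightarrow> real" where
  "trapezoid \<theta> x = (\<bar>x + \<theta>\<bar> + \<bar>x - \<theta>\<bar> - \<bar>x + 1\<bar> - \<bar>x - 1\<bar>) / (2 * (\<theta> - 1))"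

lemma trapezoid_eq_1: "1 < \<theta> \<Longrightarrow> \<bar>x\<bar> \<le> 1 \<Longrightarrow> trapezoid \<theta> x = 1"
proof -
  assume a: "1 < \<theta>" "\<bar>x\<bar> \<le> 1"
  then have "\<bar>x + \<theta>\<bar> = x + \<theta>" "\<bar>x - \<theta>\<bar> = \<theta> - x" "\<bar>x + 1\<bar> = x + 1" "\<bar>x - 1\<bar> = 1 - x" by auto
  then have "\<bar>x + \<theta>\<bar> + \<bar>x - \<theta>\<bar> - \<bar>x + 1\<bar> - \<bar>x - 1\<bar> = 2 * (\<theta> - 1)" by simp
  then show ?thesis using a by (simp add: trapezoid_def)
qed

lemma trapezoid_eq_0: "1 < \<theta> \<Longrightarrow> \<theta> \<le> \<bar>x\<bar> \<Longrightarrow> trapezoid \<theta> x = 0"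
proof -
  assume a: "1 < \<theta>" "\<theta> \<le> \<bar>x\<bar>"
  then have "\<bar>x + \<theta>\<bar> + \<bar>x - \<theta>\<bar> - \<bar>x + 1\<bar> - \<bar>x - 1\<bar> = 0" by linarith
  then show ?thesis by (simp add: trapezoid_def)
qed

lemma trapezoid_nonneg: "1 < \<theta> \<Longrightarrow> 0 \<le> trapezoid \<theta> x"
proof -
  assume a: "1 < \<theta>"
  then have "\<bar>x + \<theta>\<bar> + \<bar>x - \<theta>\<bar> - \<bar>x + 1\<bar> - \<bar>x - 1\<bar> \<ge> 0" by linarith
  then show ?thesis using a by (simp add: trapezoid_def)
qed

lemma trapezoid_le_1: "1 < \<theta> \<Longrightarrow> trapezoid \<theta> x \<le> 1"
proof -
  assume a: "1 < \<theta>"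
  have "\<bar>x + \<theta>\<bar> \<le> \<bar>x + 1\<bar> + (\<theta> - 1)" "\<bar>x - \<theta>\<bar> \<le> \<bar>x - 1\<bar> + (\<theta> - 1)" using a by linarith+
  then have "\<bar>x + \<theta>\<bar> + \<bar>x - \<theta>\<bar> - \<bar>x + 1\<bar> - \<bar>x - 1\<bar> \<le> 2 * (\<theta> - 1)" by simp
  then show ?thesis using a by (simp add: trapezoid_def)
qed

lemma borel_measurable_trapezoid [measurable]: "trapezoid \<theta> \<in> borel_measurable borel"
  unfolding trapezoid_def by measurable

text \<open>The four cosine representations add up to a density \<rho> that is bounded near 0 and
  O(1 / u^2) at infinity; dividing by the Cauchy density leaves a bounded function s. The trapezoid
  is even, so s is real.\<close>

lemma trapezoid_Fourier:
  assumes \<theta>: "1 < \<theta>"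
  obtains s :: "real \<Rightarrow> real" and \<Lambda> :: real where
    "s \<in> borel_measurable borel" "1 \<le> \<Lambda>" "\<And>u. \<bar>s u\<bar> \<le> \<Lambda>"
    "\<And>x. complex_of_real (trapezoid \<theta> x) = (CLINT u|cauchy_law. complex_of_real (s u) * iexp (u * x))"
proof -
  obtain C :: real where C: "C > 0"
    "\<And>x. has_bochner_integral lborel (\<lambda>u. (1 - cos (u * x)) / u\<^sup>2) (C * \<bar>x\<bar>)"
    using abs_cos_representation by blast
  have W: "cauchy_mass > 0" by (rule cauchy_mass_pos)
  \<comment> \<open>Obtained from cos (u * (x + c)) + cos (u * (x - c)) = 2 cos (u * x) cos (u * c)
    with c = \<theta> and c = 1.\<close>
  define \<rho> where "\<rho> u = (cos u - cos (u * \<theta>)) / (C * (\<theta> - 1) * u\<^sup>2)" for u :: real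
  \<comment> \<open>Of the factor 1 + u^2, the summand u^2 is paired with the bound 2 for the
    difference of cosines, the summand 1 with (1 + \<theta>^2) * u^2 / 2.\<close>
  define K where "K = \<bar>1 / (C * (\<theta> - 1))\<bar> * (\<theta>\<^sup>2 + 4)"
  define s where "s u = \<rho> u * (1 + u\<^sup>2) * cauchy_mass" for u
  have [measurable]: "\<rho> \<in> borel_measurable borel" "s \<in> borel_measurable borel"
    unfolding \<rho>_def s_def by measurable
  have bcos: "\<bar>1 - cos y\<bar> \<le> y\<^sup>2 / 2" for y :: real
  proof -
    have "1 - cos y = 2 * (sin (y/2))\<^sup>2" using cos_double_sin[of "y/2"] by simp
    moreover have "(sin (y/2))\<^sup>2 \<le> (y/2)\<^sup>2"
      using abs_sin_x_le_abs_x[of "y/2"] by (simp only: abs_le_square_iff)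
    ultimately show ?thesis by (simp add: power2_eq_square)
  qed
  have \<rho>: "\<bar>\<rho> u\<bar> * (1 + u\<^sup>2) \<le> K" for u
  proof (cases "u = 0")
    case False
    have 1: "\<bar>cos u - cos (u * \<theta>)\<bar> \<le> 2"
      using abs_cos_le_one[of u] abs_cos_le_one[of "u * \<theta>"] by linarith
    have "\<bar>cos u - cos (u * \<theta>)\<bar> \<le> \<bar>1 - cos u\<bar> + \<bar>1 - cos (u * \<theta>)\<bar>" by linarith
    also have "\<dots> \<le> u\<^sup>2/2 + (u * \<theta>)\<^sup>2/2" by (intro add_mono bcos)
    finally have 2: "\<bar>cos u - cos (u * \<theta>)\<bar> \<le> u\<^sup>2/2 + (u * \<theta>)\<^sup>2/2" .
    have "\<bar>cos u - cos (u * \<theta>)\<bar> * (1 + u\<^sup>2) \<le> u\<^sup>2/2 + (u * \<theta>)\<^sup>2/2 + 2 * u\<^sup>2"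
      using 2 mult_right_mono[OF 1, of "u\<^sup>2"] by (simp add: distrib_left)
    also have "\<dots> \<le> (\<theta>\<^sup>2 + 4) * u\<^sup>2"
    proof -
      have "(u * \<theta>)\<^sup>2 = \<theta>\<^sup>2 * u\<^sup>2" "0 \<le> \<theta>\<^sup>2 * u\<^sup>2" "0 \<le> u\<^sup>2" by (auto simp: power_mult_distrib)
      then show ?thesis unfolding distrib_right by linarith
    qed
    finally have "\<bar>cos u - cos (u * \<theta>)\<bar> * (1 + u\<^sup>2) / u\<^sup>2 \<le> \<theta>\<^sup>2 + 4"
      using False by (simp add: divide_le_eq)
    then have "\<bar>1 / (C * (\<theta> - 1))\<bar> * (\<bar>cos u - cos (u * \<theta>)\<bar> * (1 + u\<^sup>2) / u\<^sup>2) \<le> K"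
      unfolding K_def by (intro mult_left_mono) auto
    then show ?thesis
      by (simp add: \<rho>_def abs_mult mult.assoc)
  next
    case True
    then show ?thesis by (simp add: \<rho>_def K_def)
  qed
  have sb: "\<bar>s u\<bar> \<le> K * cauchy_mass" for u
  proof -
    have "\<bar>s u\<bar> = \<bar>\<rho> u\<bar> * (1 + u\<^sup>2) * cauchy_mass" using W by (simp add: s_def abs_mult)
    also have "\<dots> \<le> K * cauchy_mass" using \<rho>[of u] W by (intro mult_right_mono) auto
    finally show ?thesis .
  qed
  have real_rep: "has_bochner_integral lborel (\<lambda>u. \<rho> u * cos (u * x)) (trapezoid \<theta> x)" for x
  proof -
    have "has_bochner_integral lborel (\<lambda>u. (1 / (2 * C * (\<theta>-1))) *
        ((1 - cos (u * (x + \<theta>))) / u\<^sup>2 + (1 - cos (u * (x - \<theta>))) / u\<^sup>2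
          - (1 - cos (u * (x + 1))) / u\<^sup>2 - (1 - cos (u * (x - 1))) / u\<^sup>2))
        ((1 / (2 * C * (\<theta>-1))) * (C * \<bar>x + \<theta>\<bar> + C * \<bar>x - \<theta>\<bar> - C * \<bar>x + 1\<bar> - C * \<bar>x - 1\<bar>))"
      by (intro has_bochner_integral_mult_right has_bochner_integral_diff has_bochner_integral_add C(2))
    also have "(1 / (2 * C * (\<theta>-1))) * (C * \<bar>x + \<theta>\<bar> + C * \<bar>x - \<theta>\<bar> - C * \<bar>x + 1\<bar> - C * \<bar>x - 1\<bar>) = trapezoid \<theta> x"
      using C(1) \<theta> by (simp add: trapezoid_def field_simps)
    also have "(\<lambda>u. (1 / (2 * C * (\<theta>-1))) *
        ((1 - cos (u * (x + \<theta>))) / u\<^sup>2 + (1 - cos (u * (x - \<theta>))) / u\<^sup>2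
          - (1 - cos (u * (x + 1))) / u\<^sup>2 - (1 - cos (u * (x - 1))) / u\<^sup>2)) = (\<lambda>u. \<rho> u * cos (u * x))"
    proof
      fix u :: real
      have e1: "cos (u * (x + a)) + cos (u * (x - a)) = 2 * (cos (u * x) * cos (u * a))" for a
        by (simp add: distrib_left right_diff_distrib cos_add cos_diff)
      have "(1 - cos (u * (x + \<theta>))) / u\<^sup>2 + (1 - cos (u * (x - \<theta>))) / u\<^sup>2
          - (1 - cos (u * (x + 1))) / u\<^sup>2 - (1 - cos (u * (x - 1))) / u\<^sup>2
          = ((cos (u * (x + 1)) + cos (u * (x - 1))) - (cos (u * (x + \<theta>)) + cos (u * (x - \<theta>)))) / u\<^sup>2"
        by (simp add: diff_divide_distrib add_divide_distrib)
      also have "\<dots> = 2 * ((cos u - cos (u * \<theta>)) * (cos (u * x) / u\<^sup>2))"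
        by (simp only: e1) (simp add: algebra_simps diff_divide_distrib)
      finally have E: "(1 - cos (u * (x + \<theta>))) / u\<^sup>2 + (1 - cos (u * (x - \<theta>))) / u\<^sup>2
          - (1 - cos (u * (x + 1))) / u\<^sup>2 - (1 - cos (u * (x - 1))) / u\<^sup>2
        = 2 * ((cos u - cos (u * \<theta>)) * (cos (u * x) / u\<^sup>2))" .
      have gen: "1 / (2 * D) * (2 * (p * (q / w))) = p / (D * w) * q" for D p q w :: real
        by simp
      show "(1 / (2 * C * (\<theta>-1))) *
        ((1 - cos (u * (x + \<theta>))) / u\<^sup>2 + (1 - cos (u * (x - \<theta>))) / u\<^sup>2
          - (1 - cos (u * (x + 1))) / u\<^sup>2 - (1 - cos (u * (x - 1))) / u\<^sup>2) = \<rho> u * cos (u * x)"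
        unfolding \<rho>_def E using gen[of "C * (\<theta> - 1)"] by (simp only: mult.assoc)
    qed
    finally show ?thesis .
  qed
  interpret prob_space cauchy_law by (rule prob_space_cauchy_law)
  have sint: "integrable cauchy_law (\<lambda>u. complex_of_real (s u) * iexp (u * x))" for x
  proof (rule integrable_const_bound[where B="K * cauchy_mass"])
    show "AE u in cauchy_law. norm (complex_of_real (s u) * iexp (u * x)) \<le> K * cauchy_mass"
      using sb by (auto simp: norm_mult)
  qed simp
  have dens: "1 / (1 + u\<^sup>2) / cauchy_mass * s u = \<rho> u" for u
    using W by (simp add: s_def add_nonneg_eq_0_iff)
  have rep: "complex_of_real (trapezoid \<theta> x) = (CLINT u|cauchy_law. complex_of_real (s u) * iexp (u * x))" for x
  proof (rule complex_eqI)
    have "Re (CLINT u|cauchy_law. complex_of_real (s u) * iexp (u * x)) = (LINT u|cauchy_law. s u * cos (u * x))"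
      using integral_Re[OF sint, symmetric] by (simp add: Re_exp)
    also have "\<dots> = (LINT u|lborel. (1 / (1 + u\<^sup>2) / cauchy_mass) *\<^sub>R (s u * cos (u * x)))"
      unfolding cauchy_law_def using W by (intro integral_density) auto
    also have "(\<lambda>u. (1 / (1 + u\<^sup>2) / cauchy_mass) *\<^sub>R (s u * cos (u * x))) = (\<lambda>u. \<rho> u * cos (u * x))"
      by (rule ext) (metis dens mult.assoc real_scaleR_def)
    also have "(LINT u|lborel. \<rho> u * cos (u * x)) = trapezoid \<theta> x"
      using real_rep[of x] by (simp add: has_bochner_integral_iff)
    finally show "Re (complex_of_real (trapezoid \<theta> x)) = Re (CLINT u|cauchy_law. complex_of_real (s u) * iexp (u * x))"
      by simp
    have "Im (CLINT u|cauchy_law. complex_of_real (s u) * iexp (u * x)) = (LINT u|cauchy_law. s u * sin (u * x))"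
      using integral_Im[OF sint, symmetric] by (simp add: Im_exp)
    also have "\<dots> = (LINT u|lborel. (1 / (1 + u\<^sup>2) / cauchy_mass) *\<^sub>R (s u * sin (u * x)))"
      unfolding cauchy_law_def using W by (intro integral_density) auto
    also have "(\<lambda>u. (1 / (1 + u\<^sup>2) / cauchy_mass) *\<^sub>R (s u * sin (u * x))) = (\<lambda>u. \<rho> u * sin (u * x))"
      by (rule ext) (metis dens mult.assoc real_scaleR_def)
    \<comment> \<open>\<rho> is even and the sine is odd, so reflection changes the sign.\<close>
    also have "(LINT u|lborel. \<rho> u * sin (u * x)) = 0"
    proof -
      have "(LINT u|lborel. \<rho> u * sin (u * x)) = (LINT u|lborel. \<rho> (0 + (-1) * u) * sin ((0 + (-1) * u) * x))"
        using lborel_integral_real_affine[of "-1" "\<lambda>u. \<rho> u * sin (u * x)" 0] by simp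
      also have "\<dots> = - (LINT u|lborel. \<rho> u * sin (u * x))"
        by (simp add: \<rho>_def)
      finally show ?thesis by simp
    qed
    finally show "Im (complex_of_real (trapezoid \<theta> x)) = Im (CLINT u|cauchy_law. complex_of_real (s u) * iexp (u * x))"
      by simp
  qed
  \<comment> \<open>The maximum with 1 makes ln \<Lambda> nonnegative: powers of \<Lambda> do not
    decrease with the number of factors.\<close>
  show ?thesis
  proof (rule that[of s "max 1 (K * cauchy_mass)"])
    show "\<bar>s u\<bar> \<le> max 1 (K * cauchy_mass)" for u using sb[of u] by simp
  qed (use rep in auto)
qed

text \<open>The integrand concentrates at u = 0, a null set. This limit beats the constant \<Lambda>
  in the upper bound for small balls.\<close>

lemma cauchy_law_exp_tendsto_0:
  "((\<lambda>A. LINT u|cauchy_law. exp (- (A * u\<^sup>2))) \<longlongrightarrow> 0) at_top"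
proof -
  interpret prob_space cauchy_law by (rule prob_space_cauchy_law)
  have "((\<lambda>A. LINT u|cauchy_law. exp (- (A * u\<^sup>2))) \<longlongrightarrow> (LINT u|cauchy_law. 0)) at_top"
  proof (rule integral_dominated_convergence_at_top[where w="\<lambda>_. 1"])
    have "AE u in cauchy_law. u \<noteq> 0"
      unfolding cauchy_law_def by (subst AE_density) (use AE_lborel_singleton[of "0::real"] in auto)
    then show "AE u in cauchy_law. ((\<lambda>A. exp (- (A * u\<^sup>2))) \<longlongrightarrow> 0) at_top"
    proof eventually_elim
      case (elim u)
      then have "u\<^sup>2 > 0" by simp
      then show ?case by real_asymp
    qed
    show "\<forall>\<^sub>F A in at_top. AE u in cauchy_law. norm (exp (- (A * u\<^sup>2))) \<le> 1"
      using eventually_ge_at_top[of 0] by eventually_elim auto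
  qed auto
  then show ?thesis by simp
qed

section \<open>Gaussian families\<close>

text \<open>All formulas use the variance instead of \<sigma>, so that the point mass at 0 obeys
  them too.\<close>

lemma centred_gaussian_moments:
  assumes "prob_space M" "centred_gaussian M X"
  shows "integrable M (\<lambda>\<omega>. X \<omega> ^ k)"
    and "(LINT \<omega>|M. X \<omega> ^ (2 * q)) = fact (2 * q) / (2 ^ q * fact q) * (LINT \<omega>|M. (X \<omega>)\<^sup>2) ^ q"
    and "(CLINT \<omega>|M. iexp (X \<omega>)) = complex_of_real (exp (- (LINT \<omega>|M. (X \<omega>)\<^sup>2) / 2))"
proof -
  interpret prob_space M by fact
  have [measurable]: "X \<in> borel_measurable M" using assms by (simp add: centred_gaussian_def)
  have "integrable M (\<lambda>\<omega>. X \<omega> ^ k) \<and>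
    (LINT \<omega>|M. X \<omega> ^ (2 * q)) = fact (2 * q) / (2 ^ q * fact q) * (LINT \<omega>|M. (X \<omega>)\<^sup>2) ^ q \<and>
    (CLINT \<omega>|M. iexp (X \<omega>)) = complex_of_real (exp (- (LINT \<omega>|M. (X \<omega>)\<^sup>2) / 2))"
  proof (cases "AE \<omega> in M. X \<omega> = 0")
    case False
    then obtain \<sigma> where \<sigma>: "0 < \<sigma>" and D: "distributed M lborel X (normal_density 0 \<sigma>)"
      using assms(2) unfolding centred_gaussian_def by blast
    have int: "integrable M (\<lambda>\<omega>. X \<omega> ^ k)"
      using distributed_integrable[OF D, of "\<lambda>x. x ^ k"] integrable_normal_moment[OF \<sigma>, of 0 k] by simp
    have mom: "(LINT \<omega>|M. X \<omega> ^ (2 * q)) = fact (2 * q) / ((2 / \<sigma>\<^sup>2)^q * fact q)" for q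
      using distributed_integral[OF D, of "\<lambda>x. x ^ (2 * q)"] integral_normal_moment_even[OF \<sigma>, of 0 q] by simp
    have var: "(LINT \<omega>|M. (X \<omega>)\<^sup>2) = \<sigma>\<^sup>2"
      using mom[of 1] by (simp add: power2_eq_square)
    have D': "distributed M lborel (\<lambda>\<omega>. X \<omega> / \<sigma>) std_normal_density"
      using normal_standard_normal_convert[OF \<sigma>, of X 0] D by simp
    have "(CLINT \<omega>|M. iexp (X \<omega>)) = (CLINT \<omega>|M. iexp (\<sigma> * (X \<omega> / \<sigma>)))" using \<sigma> by simp
    also have "\<dots> = (CLINT x|distr M lborel (\<lambda>\<omega>. X \<omega> / \<sigma>). iexp (\<sigma> * x))"
      by (subst integral_distr) auto
    also have "\<dots> = char std_normal_distribution \<sigma>"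
      unfolding distributed_distr_eq_density[OF D'] char_def ..
    also have "\<dots> = complex_of_real (exp (- (LINT \<omega>|M. (X \<omega>)\<^sup>2) / 2))"
      by (simp add: char_std_normal_distribution var)
    finally have char: "(CLINT \<omega>|M. iexp (X \<omega>)) = complex_of_real (exp (- (LINT \<omega>|M. (X \<omega>)\<^sup>2) / 2))" .
    have "(LINT \<omega>|M. X \<omega> ^ (2 * q)) = fact (2 * q) / (2 ^ q * fact q) * (LINT \<omega>|M. (X \<omega>)\<^sup>2) ^ q"
      using \<sigma> by (simp add: mom[of q] var power_divide)
    with int char show ?thesis by blast
  next
    case 0: True
    have int: "integrable M (\<lambda>\<omega>. X \<omega> ^ k)"
    proof (rule integrable_cong_AE_imp[of _ "\<lambda>\<omega>. 0 ^ k"])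
      show "AE \<omega> in M. 0 ^ k = X \<omega> ^ k" using 0 by eventually_elim simp
    qed auto
    have "(LINT \<omega>|M. X \<omega> ^ m) = (LINT \<omega>|M. 0 ^ m)" for m
      by (rule integral_cong_AE) (use 0 in \<open>auto elim!: eventually_mono\<close>)
    then have m: "(LINT \<omega>|M. X \<omega> ^ m) = 0 ^ m" for m by (simp add: prob_space)
    have "(CLINT \<omega>|M. iexp (X \<omega>)) = (CLINT \<omega>|M. 1)"
      by (rule integral_cong_AE) (use 0 in \<open>auto elim!: eventually_mono\<close>)
    then show ?thesis using int m[of "2 * q"] m[of 2] by (cases q) (auto simp: prob_space)
  qed
  then show "integrable M (\<lambda>\<omega>. X \<omega> ^ k)"
    "(LINT \<omega>|M. X \<omega> ^ (2 * q)) = fact (2 * q) / (2 ^ q * fact q) * (LINT \<omega>|M. (X \<omega>)\<^sup>2) ^ q"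
    "(CLINT \<omega>|M. iexp (X \<omega>)) = complex_of_real (exp (- (LINT \<omega>|M. (X \<omega>)\<^sup>2) / 2))"
    by auto
qed

definition quad_form :: "'i set \<Rightarrow> ('i \<Rightarrow> 'i \<Rightarrow> real) \<Rightarrow> ('i \<Rightarrow> real) \<Rightarrow> real" where
  "quad_form I c u = (\<Sum>i\<in>I. \<Sum>j\<in>I. u i * u j * c i j)"

text \<open>The joint characteristic function serves as the definition: it passes to product spaces
  by Fubini and is exactly what the Fourier formula for products of trapezoids consumes.\<close>

definition gaussian_family :: "'a measure \<Rightarrow> 'i set \<Rightarrow> ('i \<Rightarrow> 'a \<Rightarrow> real) \<Rightarrow> ('i \<Rightarrow> 'i \<Rightarrow> real) \<Rightarrow> bool" where
  "gaussian_family M I X c \<longleftrightarrow> prob_space M \<and> finite I \<and> (\<forall>i\<in>I. X i \<in> borel_measurable M) \<and>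
     (\<forall>u. (CLINT \<omega>|M. iexp (\<Sum>i\<in>I. u i * X i \<omega>)) = complex_of_real (exp (- quad_form I c u / 2)))"

lemma gaussian_familyI:
  assumes "prob_space M" "finite I"
    and G: "\<And>u. centred_gaussian M (\<lambda>\<omega>. \<Sum>i\<in>I. u i * X i \<omega>)"
    and c: "\<And>i j. i \<in> I \<Longrightarrow> j \<in> I \<Longrightarrow> c i j = (LINT \<omega>|M. X i \<omega> * X j \<omega>)"
  shows "gaussian_family M I X c"
    and "\<And>u. (LINT \<omega>|M. (\<Sum>i\<in>I. u i * X i \<omega>)\<^sup>2) = quad_form I c u"
proof -
  interpret prob_space M by fact
  have X: "centred_gaussian M (X i)" if "i \<in> I" for i
  proof -
    have "(\<Sum>j\<in>I. (if j = i then 1 else 0) * X j \<omega>) = X i \<omega>" for \<omega>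
      using that \<open>finite I\<close> by (subst sum.remove[of _ i]) auto
    then show ?thesis using G[of "\<lambda>j. if j = i then 1 else 0"] by simp
  qed
  have [measurable]: "i \<in> I \<Longrightarrow> X i \<in> borel_measurable M" for i
    using X by (simp add: centred_gaussian_def)
  have int: "integrable M (\<lambda>\<omega>. X i \<omega> * X j \<omega>)" if "i \<in> I" "j \<in> I" for i j
  proof (rule Bochner_Integration.integrable_bound)
    show "integrable M (\<lambda>\<omega>. (X i \<omega>)\<^sup>2 + (X j \<omega>)\<^sup>2)"
      using centred_gaussian_moments(1)[OF \<open>prob_space M\<close> X] that by auto
    show "AE \<omega> in M. norm (X i \<omega> * X j \<omega>) \<le> norm ((X i \<omega>)\<^sup>2 + (X j \<omega>)\<^sup>2)"
    proof (rule AE_I2)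
      fix \<omega>
      have "0 \<le> (\<bar>X i \<omega>\<bar> - \<bar>X j \<omega>\<bar>)\<^sup>2" by simp
      then have "2 * (\<bar>X i \<omega>\<bar> * \<bar>X j \<omega>\<bar>) \<le> (X i \<omega>)\<^sup>2 + (X j \<omega>)\<^sup>2"
        by (simp add: power2_diff)
      moreover have "0 \<le> \<bar>X i \<omega>\<bar> * \<bar>X j \<omega>\<bar>" by simp
      ultimately show "norm (X i \<omega> * X j \<omega>) \<le> norm ((X i \<omega>)\<^sup>2 + (X j \<omega>)\<^sup>2)"
        unfolding real_norm_def abs_mult by linarith
    qed
  qed (use that in measurable)
  show var: "(LINT \<omega>|M. (\<Sum>i\<in>I. u i * X i \<omega>)\<^sup>2) = quad_form I c u" for u
  proof -
    have "(\<Sum>i\<in>I. u i * X i \<omega>)\<^sup>2 = (\<Sum>i\<in>I. \<Sum>j\<in>I. (u i * u j) * (X i \<omega> * X j \<omega>))" for \<omega>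
      by (simp add: power2_eq_square sum_product algebra_simps)
    then have "(LINT \<omega>|M. (\<Sum>i\<in>I. u i * X i \<omega>)\<^sup>2) = (LINT \<omega>|M. (\<Sum>i\<in>I. \<Sum>j\<in>I. (u i * u j) * (X i \<omega> * X j \<omega>)))"
      by simp
    also have "\<dots> = (\<Sum>i\<in>I. \<Sum>j\<in>I. (u i * u j) * (LINT \<omega>|M. X i \<omega> * X j \<omega>))"
      using int by (subst Bochner_Integration.integral_sum) (auto intro!: sum.cong)
    also have "\<dots> = quad_form I c u" unfolding quad_form_def by (intro sum.cong) (auto simp: c)
    finally show ?thesis .
  qed
  show "gaussian_family M I X c"
    unfolding gaussian_family_def
    using assms(1,2) centred_gaussian_moments(3)[OF assms(1) G] by (simp add: var)
qed

text \<open>Otherwise the characteristic function would exceed 1 in modulus.\<close>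

lemma quad_form_nonneg:
  assumes "gaussian_family M I X c"
  shows "0 \<le> quad_form I c u"
proof -
  interpret prob_space M using assms by (simp add: gaussian_family_def)
  have [measurable]: "i \<in> I \<Longrightarrow> X i \<in> borel_measurable M" for i using assms by (simp add: gaussian_family_def)
  have "norm (CLINT \<omega>|M. iexp (\<Sum>i\<in>I. u i * X i \<omega>)) \<le> (LINT \<omega>|M. norm (iexp (\<Sum>i\<in>I. u i * X i \<omega>)))"
    by (rule integral_norm_bound)
  also have "\<dots> = 1" by (simp add: prob_space del: of_real_sum of_real_mult)
  finally have "exp (- quad_form I c u / 2) \<le> 1"
    using assms by (simp add: gaussian_family_def)
  then show ?thesis by simp
qed

lemma gaussian_family_scale:
  assumes "gaussian_family M I X c"
  shows "gaussian_family M I (\<lambda>i \<omega>. b i * X i \<omega>) (\<lambda>i j. b i * b j * c i j)"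
proof -
  have char: "(CLINT \<omega>|M. iexp (\<Sum>i\<in>I. u i * (b i * X i \<omega>))) = complex_of_real (exp (- quad_form I c (\<lambda>i. u i * b i) / 2))" for u
  proof -
    have "(CLINT \<omega>|M. iexp (\<Sum>i\<in>I. v i * X i \<omega>)) = complex_of_real (exp (- quad_form I c v / 2))" for v
      using assms by (simp add: gaussian_family_def)
    from this[of "\<lambda>i. u i * b i"] show ?thesis by (simp only: mult.assoc)
  qed
  show ?thesis using assms
    unfolding gaussian_family_def char
    by (auto simp: quad_form_def algebra_simps)
qed

section \<open>Expectations of products of trapezoids\<close>

lemma product_sigma_finite_cauchy: "product_sigma_finite (\<lambda>_. cauchy_law)"
  using prob_space_cauchy_law by (auto simp: product_sigma_finite_def prob_space_imp_sigma_finite)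

lemma prob_space_PiM_cauchy: "prob_space (Pi\<^sub>M I (\<lambda>_. cauchy_law))"
  by (rule prob_space_PiM) (rule prob_space_cauchy_law)

text \<open>One pair (s, \<Lambda>) for a given \<theta>; \<Lambda> depends neither on the number of
  variables nor on their law.\<close>

locale trapezoid_representation =
  fixes \<theta> :: real and s :: "real \<Rightarrow> real" and \<Lambda> :: real
  assumes \<theta>: "1 < \<theta>"
    and s_measurable [measurable]: "s \<in> borel_measurable borel"
    and \<Lambda>: "1 \<le> \<Lambda>" and s_bound: "\<And>u. \<bar>s u\<bar> \<le> \<Lambda>"
    and s_Fourier: "\<And>x. complex_of_real (trapezoid \<theta> x) = (CLINT u|cauchy_law. complex_of_real (s u) * iexp (u * x))"
begin

lemma integrable_s_iexp: "integrable cauchy_law (\<lambda>v. complex_of_real (s v) * iexp (v * x))"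
proof -
  interpret C: prob_space cauchy_law by (rule prob_space_cauchy_law)
  show ?thesis
    by (rule C.integrable_const_bound[where B=\<Lambda>]) (auto simp: norm_mult s_bound)
qed

text \<open>Insert the Fourier integral of each factor and exchange the integrations, the integrand
  being bounded by \<Lambda> ^ card I on a probability space. The inner expectation is then the
  joint characteristic function.\<close>

lemma expectation_prod_trapezoid:
  assumes GF: "gaussian_family M I X c"
  shows "(LINT \<omega>|M. (\<Prod>i\<in>I. trapezoid \<theta> (X i \<omega>)))
      = (LINT u|Pi\<^sub>M I (\<lambda>_. cauchy_law). (\<Prod>i\<in>I. s (u i)) * exp (- quad_form I c u / 2))"
proof -
  interpret prob_space M using GF by (simp add: gaussian_family_def)
  have [simp]: "finite I" using GF by (simp add: gaussian_family_def)
  have [measurable]: "i \<in> I \<Longrightarrow> X i \<in> borel_measurable M" for i using GF by (simp add: gaussian_family_def)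
  let ?P = "Pi\<^sub>M I (\<lambda>_. cauchy_law)"
  interpret product_sigma_finite "\<lambda>_. cauchy_law" by (rule product_sigma_finite_cauchy)
  interpret P: prob_space ?P by (rule prob_space_PiM_cauchy)
  interpret C: prob_space cauchy_law by (rule prob_space_cauchy_law)
  interpret MP: pair_prob_space M ?P ..
  have comp [measurable]: "i \<in> I \<Longrightarrow> (\<lambda>u. u i) \<in> borel_measurable ?P" for i
    using measurable_component_singleton[of i I "\<lambda>_. cauchy_law"]
    by (simp cong: measurable_cong_sets)
  let ?f = "\<lambda>\<omega> u. (\<Prod>i\<in>I. complex_of_real (s (u i))) * iexp (\<Sum>i\<in>I. u i * X i \<omega>)"
  have bnd: "norm (?f \<omega> u) \<le> \<Lambda> ^ card I" for \<omega> u
  proof -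
    have "norm (?f \<omega> u) = (\<Prod>i\<in>I. \<bar>s (u i)\<bar>)"
      by (simp add: norm_mult prod_norm[symmetric] del: of_real_sum of_real_mult)
    also have "\<dots> \<le> (\<Prod>i\<in>I. \<Lambda>)" by (intro prod_mono) (auto simp: s_bound)
    finally show ?thesis by simp
  qed
  have int: "integrable (M \<Otimes>\<^sub>M ?P) (\<lambda>(\<omega>, u). ?f \<omega> u)"
    by (rule MP.integrable_const_bound[where B="\<Lambda> ^ card I"]) (use bnd in auto)
  have "complex_of_real (LINT \<omega>|M. (\<Prod>i\<in>I. trapezoid \<theta> (X i \<omega>)))
     = (CLINT \<omega>|M. (\<Prod>i\<in>I. complex_of_real (trapezoid \<theta> (X i \<omega>))))"
    by (simp flip: of_real_prod add: integral_complex_of_real)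
  also have "\<dots> = (CLINT \<omega>|M. (CLINT u|?P. ?f \<omega> u))"
  proof (rule Bochner_Integration.integral_cong[OF refl])
    fix \<omega>
    have "(\<Prod>i\<in>I. complex_of_real (trapezoid \<theta> (X i \<omega>)))
       = (\<Prod>i\<in>I. CLINT v|cauchy_law. complex_of_real (s v) * iexp (v * X i \<omega>))"
      by (simp only: s_Fourier)
    also have "\<dots> = (CLINT u|?P. (\<Prod>i\<in>I. complex_of_real (s (u i)) * iexp (u i * X i \<omega>)))"
    by (rule product_integral_prod[symmetric]) (simp_all only: integrable_s_iexp \<open>finite I\<close>)
    also have "\<dots> = (CLINT u|?P. ?f \<omega> u)"
      by (simp add: prod.distrib exp_sum sum_distrib_left)
    finally show "(\<Prod>i\<in>I. complex_of_real (trapezoid \<theta> (X i \<omega>))) = (CLINT u|?P. ?f \<omega> u)" .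
  qed
  also have "\<dots> = (CLINT u|?P. (CLINT \<omega>|M. ?f \<omega> u))"
    using MP.Fubini_integral[OF int] by simp
  also have "\<dots> = (CLINT u|?P. complex_of_real ((\<Prod>i\<in>I. s (u i)) * exp (- quad_form I c u / 2)))"
  proof (rule Bochner_Integration.integral_cong[OF refl])
    fix u
    have "(CLINT \<omega>|M. ?f \<omega> u) = (\<Prod>i\<in>I. complex_of_real (s (u i))) * (CLINT \<omega>|M. iexp (\<Sum>i\<in>I. u i * X i \<omega>))"
      by (rule integral_mult_right_zero)
    also have "(CLINT \<omega>|M. iexp (\<Sum>i\<in>I. u i * X i \<omega>)) = complex_of_real (exp (- quad_form I c u / 2))"
      using GF by (simp add: gaussian_family_def)
    finally show "(CLINT \<omega>|M. ?f \<omega> u) = complex_of_real ((\<Prod>i\<in>I. s (u i)) * exp (- quad_form I c u / 2))"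
      by simp
  qed
  also have "\<dots> = complex_of_real (LINT u|?P. (\<Prod>i\<in>I. s (u i)) * exp (- quad_form I c u / 2))"
    by (rule integral_complex_of_real)
  finally show ?thesis by (simp only: of_real_eq_iff)
qed

lemma measurable_quad_form [measurable]:
  "quad_form I c \<in> borel_measurable (Pi\<^sub>M I (\<lambda>_. cauchy_law))"
proof -
  have [measurable]: "i \<in> I \<Longrightarrow> (\<lambda>u. u i) \<in> borel_measurable (Pi\<^sub>M I (\<lambda>_. cauchy_law))" for i
    using measurable_component_singleton[of i I "\<lambda>_. cauchy_law"]
    by (simp cong: measurable_cong_sets)
  show ?thesis unfolding quad_form_def by measurable
qed

lemma measurable_prod_s [measurable]:
  "(\<lambda>u. \<Prod>i\<in>I. s (u i)) \<in> borel_measurable (Pi\<^sub>M I (\<lambda>_. cauchy_law))"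
proof -
  have [measurable]: "i \<in> I \<Longrightarrow> (\<lambda>u. u i) \<in> borel_measurable (Pi\<^sub>M I (\<lambda>_. cauchy_law))" for i
    using measurable_component_singleton[of i I "\<lambda>_. cauchy_law"]
    by (simp cong: measurable_cong_sets)
  show ?thesis by measurable
qed

lemma prod_s_bound: "\<bar>\<Prod>i\<in>I. s (u i)\<bar> \<le> \<Lambda> ^ card I"
proof -
  have "\<bar>\<Prod>i\<in>I. s (u i)\<bar> = (\<Prod>i\<in>I. \<bar>s (u i)\<bar>)" by (simp add: abs_prod)
  also have "\<dots> \<le> (\<Prod>i\<in>I. \<Lambda>)" by (intro prod_mono) (auto simp: s_bound)
  finally show ?thesis by simp
qed

text \<open>Once the quadratic form is replaced by A times the sum of squares, the Fourier integral
  factorises over the coordinates. Each variable then costs the same factor, which is small for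
  large A.\<close>

lemma box_probability_le:
  assumes GF: "gaussian_family M I X c"
    and True: "0 \<le> A" and Q: "\<And>u. A * (\<Sum>i\<in>I. (u i)\<^sup>2) \<le> quad_form I c u"
  shows "measure M {\<omega>\<in>space M. \<forall>i\<in>I. \<bar>X i \<omega>\<bar> \<le> 1}
    \<le> (\<Lambda> * (LINT u|cauchy_law. exp (- (A / 2 * u\<^sup>2)))) ^ card I"
proof -
  interpret prob_space M using GF by (simp add: gaussian_family_def)
  have [simp]: "finite I" using GF by (simp add: gaussian_family_def)
  have [measurable]: "i \<in> I \<Longrightarrow> X i \<in> borel_measurable M" for i using GF by (simp add: gaussian_family_def)
  let ?P = "Pi\<^sub>M I (\<lambda>_. cauchy_law)"
  interpret product_sigma_finite "\<lambda>_. cauchy_law" by (rule product_sigma_finite_cauchy)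
  interpret P: prob_space ?P by (rule prob_space_PiM_cauchy)
  interpret C: prob_space cauchy_law by (rule prob_space_cauchy_law)
  have int_exp: "integrable cauchy_law (\<lambda>v. \<Lambda> * exp (- (A / 2 * v\<^sup>2)))"
  proof (rule C.integrable_const_bound[where B=\<Lambda>])
    show "AE v in cauchy_law. norm (\<Lambda> * exp (- (A / 2 * v\<^sup>2))) \<le> \<Lambda>"
      using \<Lambda> True by (auto simp: abs_mult)
    show "(\<lambda>v. \<Lambda> * exp (- (A / 2 * v\<^sup>2))) \<in> borel_measurable cauchy_law" by measurable
  qed
  have comp [measurable]: "i \<in> I \<Longrightarrow> (\<lambda>u. u i) \<in> borel_measurable ?P" for i
    using measurable_component_singleton[of i I "\<lambda>_. cauchy_law"]
    by (simp cong: measurable_cong_sets)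
  have [measurable]: "{\<omega>\<in>space M. \<forall>i\<in>I. \<bar>X i \<omega>\<bar> \<le> 1} \<in> sets M" by measurable
  have tr: "0 \<le> (\<Prod>i\<in>I. trapezoid \<theta> (X i \<omega>))" "(\<Prod>i\<in>I. trapezoid \<theta> (X i \<omega>)) \<le> 1" for \<omega>
    by (auto intro!: prod_nonneg prod_le_1 trapezoid_nonneg trapezoid_le_1 \<theta>)
  have "measure M {\<omega>\<in>space M. \<forall>i\<in>I. \<bar>X i \<omega>\<bar> \<le> 1} = (LINT \<omega>|M. indicator {\<omega>\<in>space M. \<forall>i\<in>I. \<bar>X i \<omega>\<bar> \<le> 1} \<omega>)"
    by simp
  also have "\<dots> \<le> (LINT \<omega>|M. (\<Prod>i\<in>I. trapezoid \<theta> (X i \<omega>)))"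
  proof (rule integral_mono)
    show "integrable M (\<lambda>\<omega>. \<Prod>i\<in>I. trapezoid \<theta> (X i \<omega>))"
      by (rule integrable_const_bound[where B=1]) (use tr in auto)
    fix \<omega> show "indicator {\<omega>\<in>space M. \<forall>i\<in>I. \<bar>X i \<omega>\<bar> \<le> 1} \<omega> \<le> (\<Prod>i\<in>I. trapezoid \<theta> (X i \<omega>))"
      using tr by (auto simp: indicator_def trapezoid_eq_1 \<theta>)
    show "integrable M (indicator {\<omega>\<in>space M. \<forall>i\<in>I. \<bar>X i \<omega>\<bar> \<le> 1} :: _ \<Rightarrow> real)"
      by (rule integrable_const_bound[where B=1]) (auto simp: indicator_def)
  qed
  also have "\<dots> = (LINT u|?P. (\<Prod>i\<in>I. s (u i)) * exp (- quad_form I c u / 2))"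
    by (rule expectation_prod_trapezoid[OF GF])
  also have "\<dots> \<le> (LINT u|?P. (\<Prod>i\<in>I. \<Lambda> * exp (- (A / 2 * (u i)\<^sup>2))))"
  proof (rule integral_mono)
    have q0: "0 \<le> quad_form I c u" for u by (rule quad_form_nonneg[OF GF])
    show "integrable ?P (\<lambda>u. (\<Prod>i\<in>I. s (u i)) * exp (- quad_form I c u / 2))"
    proof (rule P.integrable_const_bound[where B="\<Lambda> ^ card I"])
      show "AE u in ?P. norm ((\<Prod>i\<in>I. s (u i)) * exp (- quad_form I c u / 2)) \<le> \<Lambda> ^ card I"
      proof (rule AE_I2)
        fix u
        have "\<bar>\<Prod>i\<in>I. s (u i)\<bar> * exp (- quad_form I c u / 2) \<le> \<Lambda> ^ card I * 1"
          using q0[of u] \<Lambda> by (intro mult_mono prod_s_bound) auto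
        then show "norm ((\<Prod>i\<in>I. s (u i)) * exp (- quad_form I c u / 2)) \<le> \<Lambda> ^ card I"
          by (simp add: abs_mult)
      qed
    qed measurable
    show "integrable ?P (\<lambda>u. \<Prod>i\<in>I. \<Lambda> * exp (- (A / 2 * (u i)\<^sup>2)))"
    proof (rule product_integrable_prod)
      fix i show "integrable cauchy_law (\<lambda>v. \<Lambda> * exp (- (A / 2 * v\<^sup>2)))"
        by (rule int_exp)
    qed simp
    fix u
    have "(\<Prod>i\<in>I. s (u i)) * exp (- quad_form I c u / 2) \<le> \<Lambda> ^ card I * exp (- (A / 2 * (\<Sum>i\<in>I. (u i)\<^sup>2)))"
      using Q[of u] prod_s_bound[where I=I and u=u] \<Lambda> by (intro mult_mono) auto
    also have "\<dots> = (\<Prod>i\<in>I. \<Lambda> * exp (- (A / 2 * (u i)\<^sup>2)))"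
      by (simp add: prod.distrib exp_sum[symmetric] sum_distrib_left sum_negf)
    finally show "(\<Prod>i\<in>I. s (u i)) * exp (- quad_form I c u / 2) \<le> (\<Prod>i\<in>I. \<Lambda> * exp (- (A / 2 * (u i)\<^sup>2)))" .
  qed
  also have "\<dots> = (\<Prod>i\<in>I. (LINT v|cauchy_law. \<Lambda> * exp (- (A / 2 * v\<^sup>2))))"
  proof (rule product_integral_prod)
    fix i show "integrable cauchy_law (\<lambda>v. \<Lambda> * exp (- (A / 2 * v\<^sup>2)))"
      by (rule int_exp)
  qed simp
  finally show ?thesis by simp
qed

text \<open>The map a -> exp (- a / 2) is Hoelder continuous of order 1/2 on a \<ge> 0, so the two
  Fourier integrands differ by square roots of |u i * u j * (c i j - c' i j)|. Off the diagonal
  these are integrable under the Cauchy laws.\<close>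

lemma expectation_prod_trapezoid_diff:
  assumes X: "gaussian_family M I X c" and Y: "gaussian_family N I Y c'"
    and diag: "\<And>i. i \<in> I \<Longrightarrow> c i i = c' i i"
  shows "\<bar>(LINT \<omega>|M. (\<Prod>i\<in>I. trapezoid \<theta> (X i \<omega>))) - (LINT \<omega>|N. (\<Prod>i\<in>I. trapezoid \<theta> (Y i \<omega>)))\<bar>
    \<le> \<Lambda> ^ card I * ((LINT u|cauchy_law. sqrt \<bar>u\<bar>)\<^sup>2 * (\<Sum>i\<in>I. \<Sum>j\<in>I. sqrt \<bar>c i j - c' i j\<bar>))"
proof -
  have [simp]: "finite I" using X by (simp add: gaussian_family_def)
  let ?P = "Pi\<^sub>M I (\<lambda>_. cauchy_law)"
  let ?S = "LINT u|cauchy_law. sqrt \<bar>u\<bar>"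
  interpret product_sigma_finite "\<lambda>_. cauchy_law" by (rule product_sigma_finite_cauchy)
  interpret P: prob_space ?P by (rule prob_space_PiM_cauchy)
  interpret C: prob_space cauchy_law by (rule prob_space_cauchy_law)
  let ?F = "\<lambda>c u. (\<Prod>i\<in>I. s (u i)) * exp (- quad_form I c u / 2)"
  have int: "integrable ?P (?F c)" if q0: "\<And>u. 0 \<le> quad_form I c u" for c
  proof (rule P.integrable_const_bound[where B="\<Lambda> ^ card I"])
    show "AE u in ?P. norm (?F c u) \<le> \<Lambda> ^ card I"
    proof (rule AE_I2)
      fix u
      have "\<bar>\<Prod>i\<in>I. s (u i)\<bar> * exp (- quad_form I c u / 2) \<le> \<Lambda> ^ card I * 1"
        using q0[of u] \<Lambda> by (intro mult_mono prod_s_bound) auto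
      then show "norm (?F c u) \<le> \<Lambda> ^ card I" by (simp add: abs_mult)
    qed
  qed measurable
  note qX = quad_form_nonneg[OF X] and qY = quad_form_nonneg[OF Y]
  let ?G = "\<lambda>i j u. sqrt \<bar>c i j - c' i j\<bar> * (sqrt \<bar>u i\<bar> * sqrt \<bar>u j\<bar>)"
  \<comment> \<open>Square roots of distinct coordinates factorise. For i = j the integrand would be
    |u i|, which is not integrable; there the coefficient vanishes by \<open>diag\<close>.\<close>
  have pp: "integrable ?P (\<lambda>u. sqrt \<bar>u i\<bar> * sqrt \<bar>u j\<bar>) \<and> (LINT u|?P. sqrt \<bar>u i\<bar> * sqrt \<bar>u j\<bar>) = ?S\<^sup>2"
    if ij: "i \<in> I" "j \<in> I" "i \<noteq> j" for i j
  proof -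
    let ?f = "\<lambda>k v::real. if k = i \<or> k = j then sqrt \<bar>v\<bar> else 1"
    have fi: "integrable cauchy_law (?f k)" for k
      using integrable_cauchy_law_sqrt by (cases "k = i \<or> k = j") auto
    have eq: "(\<Prod>k\<in>I. ?f k (u k)) = sqrt \<bar>u i\<bar> * sqrt \<bar>u j\<bar>" for u
    proof -
      have "(\<Prod>k\<in>I. ?f k (u k)) = (\<Prod>k\<in>{i,j}. ?f k (u k))"
        by (rule prod.mono_neutral_right) (use ij in auto)
      then show ?thesis using ij by simp
    qed
    have eq2: "(\<Prod>k\<in>I. integral\<^sup>L cauchy_law (?f k)) = ?S\<^sup>2"
    proof -
      have "(\<Prod>k\<in>I. integral\<^sup>L cauchy_law (?f k)) = (\<Prod>k\<in>{i,j}. integral\<^sup>L cauchy_law (?f k))"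
        by (rule prod.mono_neutral_right) (use ij C.prob_space in auto)
      then show ?thesis using ij by (simp add: power2_eq_square)
    qed
    show ?thesis
      using product_integrable_prod[of I ?f] product_integral_prod[of I ?f] fi unfolding eq eq2 by simp
  qed
  have G: "integrable ?P (?G i j) \<and> (LINT u|?P. ?G i j u) = sqrt \<bar>c i j - c' i j\<bar> * ?S\<^sup>2" if ij: "i \<in> I" "j \<in> I" for i j
  proof (cases "i = j")
    case True
    then show ?thesis using diag[OF ij(1)] by simp
  next
    case False
    then show ?thesis using pp[OF ij False] by simp
  qed
  have "\<bar>(LINT \<omega>|M. (\<Prod>i\<in>I. trapezoid \<theta> (X i \<omega>))) - (LINT \<omega>|N. (\<Prod>i\<in>I. trapezoid \<theta> (Y i \<omega>)))\<bar>
     = \<bar>LINT u|?P. ?F c u - ?F c' u\<bar>"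
    using int[OF qX] int[OF qY]
    by (simp add: expectation_prod_trapezoid[OF X] expectation_prod_trapezoid[OF Y])
  also have "\<dots> \<le> (LINT u|?P. \<bar>?F c u - ?F c' u\<bar>)"
    by (rule integral_abs_bound)
  also have "\<dots> \<le> (LINT u|?P. \<Lambda> ^ card I * (\<Sum>i\<in>I. \<Sum>j\<in>I. ?G i j u))"
  proof (rule integral_mono)
    show "integrable ?P (\<lambda>u. \<bar>?F c u - ?F c' u\<bar>)" using int[OF qX] int[OF qY] by auto
    show "integrable ?P (\<lambda>u. \<Lambda> ^ card I * (\<Sum>i\<in>I. \<Sum>j\<in>I. ?G i j u))" using G by auto
    fix u
    \<comment> \<open>With d = |a - b| the difference is at most 1 - exp (- d / 2), hence at most
      both d / 2 and 1, hence at most sqrt d.\<close>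
    have e: "\<bar>exp (- a / 2) - exp (- b / 2)\<bar> \<le> sqrt \<bar>a - b\<bar>" if "0 \<le> a" "0 \<le> b" for a b :: real
    proof -
      have *: "\<bar>exp (- a / 2) - exp (- b / 2)\<bar> \<le> sqrt \<bar>a - b\<bar>" if "0 \<le> a" "a \<le> b" for a b :: real
      proof -
        have "exp (- a / 2) - exp (- b / 2) = exp (- a / 2) * (1 - exp (- ((b - a) / 2)))"
          by (simp add: right_diff_distrib exp_add[symmetric] diff_divide_distrib)
        also have "\<dots> \<le> 1 * (1 - exp (- ((b - a) / 2)))"
          using that by (intro mult_right_mono) auto
        finally have 1: "exp (- a / 2) - exp (- b / 2) \<le> 1 - exp (- ((b - a) / 2))" by simp
        have "1 - exp (- ((b - a) / 2)) \<le> sqrt (b - a)"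
        proof (cases "b - a \<le> 1")
          case True
          have "1 - exp (- ((b - a) / 2)) \<le> (b - a) / 2" using exp_ge_add_one_self[of "- ((b - a) / 2)"] by linarith
          also have "\<dots> \<le> b - a" using that by simp
          also have "\<dots> = sqrt (b - a) * sqrt (b - a)" using that by simp
          also have "\<dots> \<le> sqrt (b - a) * 1" using True that by (intro mult_left_mono) auto
          finally show ?thesis by simp
        next
          case False
          then have "1 \<le> sqrt (b - a)" by simp
          then show ?thesis by (smt (verit) exp_gt_zero)
        qed
        then show ?thesis using 1 that by (simp add: abs_if)
      qed
      show ?thesis
        using *[of a b] *[of b a] that by (cases "a \<le> b") (auto simp: abs_minus_commute)
    qed
    have sq: "sqrt \<bar>\<Sum>k\<in>K. f k\<bar> \<le> (\<Sum>k\<in>K. sqrt \<bar>f k\<bar>)" if "finite K" for f :: "'i \<Rightarrow> real" and K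
      using that
    proof induction
      case (insert k K)
      have "sqrt \<bar>f k + sum f K\<bar> \<le> sqrt (\<bar>f k\<bar> + \<bar>sum f K\<bar>)" by (simp add: abs_triangle_ineq)
      also have "\<dots> \<le> sqrt \<bar>f k\<bar> + sqrt \<bar>sum f K\<bar>" by (rule sqrt_add_le_add_sqrt) auto
      finally show ?case using insert by simp
    qed simp
    have "\<bar>?F c u - ?F c' u\<bar> = \<bar>\<Prod>i\<in>I. s (u i)\<bar> * \<bar>exp (- quad_form I c u / 2) - exp (- quad_form I c' u / 2)\<bar>"
      by (simp add: abs_mult[symmetric] right_diff_distrib)
    also have "\<dots> \<le> \<Lambda> ^ card I * sqrt \<bar>quad_form I c u - quad_form I c' u\<bar>"
      using \<Lambda> by (intro mult_mono prod_s_bound e qX qY) auto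
    also have "quad_form I c u - quad_form I c' u = (\<Sum>i\<in>I. \<Sum>j\<in>I. u i * u j * (c i j - c' i j))"
      by (simp add: quad_form_def sum_subtractf[symmetric] right_diff_distrib)
    also have "sqrt \<bar>\<Sum>i\<in>I. \<Sum>j\<in>I. u i * u j * (c i j - c' i j)\<bar> \<le> (\<Sum>i\<in>I. \<Sum>j\<in>I. ?G i j u)"
    proof -
      have "sqrt \<bar>\<Sum>i\<in>I. \<Sum>j\<in>I. u i * u j * (c i j - c' i j)\<bar> \<le> (\<Sum>i\<in>I. sqrt \<bar>\<Sum>j\<in>I. u i * u j * (c i j - c' i j)\<bar>)"
        by (rule sq) simp
      also have "\<dots> \<le> (\<Sum>i\<in>I. \<Sum>j\<in>I. sqrt \<bar>u i * u j * (c i j - c' i j)\<bar>)"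
        by (intro sum_mono sq) simp
      also have "\<dots> = (\<Sum>i\<in>I. \<Sum>j\<in>I. ?G i j u)"
        by (simp add: abs_mult real_sqrt_mult mult_ac)
      finally show ?thesis .
    qed
    finally show "\<bar>?F c u - ?F c' u\<bar> \<le> \<Lambda> ^ card I * (\<Sum>i\<in>I. \<Sum>j\<in>I. ?G i j u)"
      using \<Lambda> by simp
  qed
  also have "\<dots> = \<Lambda> ^ card I * (\<Sum>i\<in>I. \<Sum>j\<in>I. sqrt \<bar>c i j - c' i j\<bar> * ?S\<^sup>2)"
  proof -
    have "(LINT u|?P. \<Lambda> ^ card I * (\<Sum>i\<in>I. \<Sum>j\<in>I. ?G i j u)) = \<Lambda> ^ card I * (\<Sum>i\<in>I. \<Sum>j\<in>I. (LINT u|?P. ?G i j u))"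
      using G by (subst integral_mult_right_zero, subst Bochner_Integration.integral_sum)
        (auto intro!: sum.cong Bochner_Integration.integral_sum)
    also have "(\<Sum>i\<in>I. \<Sum>j\<in>I. (LINT u|?P. ?G i j u)) = (\<Sum>i\<in>I. \<Sum>j\<in>I. sqrt \<bar>c i j - c' i j\<bar> * ?S\<^sup>2)"
      by (intro sum.cong refl conjunct2[OF G])
    finally show ?thesis .
  qed
  also have "(\<Sum>i\<in>I. \<Sum>j\<in>I. sqrt \<bar>c i j - c' i j\<bar> * ?S\<^sup>2) = ?S\<^sup>2 * (\<Sum>i\<in>I. \<Sum>j\<in>I. sqrt \<bar>c i j - c' i j\<bar>)"
    by (simp add: sum_distrib_left mult_ac)
  finally show ?thesis .
qed

end

lemma trapezoid_representation_exists:
  assumes "1 < \<theta>"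
  obtains s \<Lambda> where "trapezoid_representation \<theta> s \<Lambda>"
proof -
  obtain s \<Lambda> where "s \<in> borel_measurable borel" "1 \<le> \<Lambda>" "\<And>u. \<bar>s u\<bar> \<le> \<Lambda>"
    "\<And>x. complex_of_real (trapezoid \<theta> x) = (CLINT u|cauchy_law. complex_of_real (s u) * iexp (u * x))"
    using trapezoid_Fourier[OF assms] by blast
  then have "trapezoid_representation \<theta> s \<Lambda>" using assms by (simp add: trapezoid_representation_def)
  then show ?thesis using that by blast
qed

lemma expectation_prod_trapezoid_eq:
  assumes "gaussian_family M I X c" "gaussian_family N I Y c" "1 < \<theta>"
  shows "(LINT \<omega>|M. (\<Prod>i\<in>I. trapezoid \<theta> (X i \<omega>))) = (LINT \<omega>|N. (\<Prod>i\<in>I. trapezoid \<theta> (Y i \<omega>)))"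
proof -
  obtain s \<Lambda> where "trapezoid_representation \<theta> s \<Lambda>" using trapezoid_representation_exists[OF assms(3)] .
  then interpret trapezoid_representation \<theta> s \<Lambda> .
  show ?thesis using assms(1,2) by (simp add: expectation_prod_trapezoid)
qed

text \<open>As \<theta> decreases to 1 the trapezoid tends to the indicator of the closed interval
  [-1, 1], endpoints included, so box probabilities are recovered exactly.\<close>

lemma box_probability_tendsto:
  assumes "prob_space M" "finite I" and [measurable]: "\<And>i. i \<in> I \<Longrightarrow> X i \<in> borel_measurable M"
  shows "(\<lambda>n. LINT \<omega>|M. (\<Prod>i\<in>I. trapezoid (1 + 1 / real (Suc n)) (X i \<omega>)))
     \<longlonglongrightarrow> measure M {\<omega>\<in>space M. \<forall>i\<in>I. \<bar>X i \<omega>\<bar> \<le> 1}"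
proof -
  interpret prob_space M by fact
  let ?A = "{\<omega>\<in>space M. \<forall>i\<in>I. \<bar>X i \<omega>\<bar> \<le> 1}"
  have [measurable]: "?A \<in> sets M" using \<open>finite I\<close> by measurable
  have "(\<lambda>n. LINT \<omega>|M. (\<Prod>i\<in>I. trapezoid (1 + 1 / real (Suc n)) (X i \<omega>))) \<longlonglongrightarrow> (LINT \<omega>|M. indicator ?A \<omega>)"
  proof (rule integral_dominated_convergence[where w="\<lambda>_. 1"])
    show "AE \<omega> in M. (\<lambda>n. \<Prod>i\<in>I. trapezoid (1 + 1 / real (Suc n)) (X i \<omega>)) \<longlonglongrightarrow> indicator ?A \<omega>"
    proof (rule AE_I2)
      fix \<omega> assume \<omega>: "\<omega> \<in> space M"
      show "(\<lambda>n. \<Prod>i\<in>I. trapezoid (1 + 1 / real (Suc n)) (X i \<omega>)) \<longlonglongrightarrow> indicator ?A \<omega>"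
      proof (cases "\<omega> \<in> ?A")
        case True
        then show ?thesis by (simp add: trapezoid_eq_1)
      next
        case False
        then obtain i where i: "i \<in> I" "1 < \<bar>X i \<omega>\<bar>" using \<omega> by force
        have "\<forall>\<^sub>F n in sequentially. 1 + 1 / real (Suc n) < \<bar>X i \<omega>\<bar>"
        proof -
          have "(\<lambda>n. 1 + 1 / real (Suc n)) \<longlonglongrightarrow> 1" by real_asymp
          then show ?thesis using i(2) by (rule order_tendstoD)
        qed
        then have "\<forall>\<^sub>F n in sequentially. (\<Prod>i\<in>I. trapezoid (1 + 1 / real (Suc n)) (X i \<omega>)) = indicator ?A \<omega>"
        proof eventually_elim
          case (elim n)
          then have "trapezoid (1 + 1 / real (Suc n)) (X i \<omega>) = 0" by (intro trapezoid_eq_0) auto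
          then have "(\<Prod>i\<in>I. trapezoid (1 + 1 / real (Suc n)) (X i \<omega>)) = 0"
            using i(1) \<open>finite I\<close> by (intro prod_zero) auto
          then show ?case using False by (simp add: indicator_def)
        qed
        then show ?thesis by (rule tendsto_eventually)
      qed
    qed
    show "AE \<omega> in M. norm (\<Prod>i\<in>I. trapezoid (1 + 1 / real (Suc n)) (X i \<omega>)) \<le> 1" for n
    proof (rule AE_I2)
      fix \<omega>
      have "0 \<le> (\<Prod>i\<in>I. trapezoid (1 + 1 / real (Suc n)) (X i \<omega>))" "(\<Prod>i\<in>I. trapezoid (1 + 1 / real (Suc n)) (X i \<omega>)) \<le> 1"
        by (auto intro!: prod_nonneg prod_le_1 trapezoid_nonneg trapezoid_le_1)
      then show "norm (\<Prod>i\<in>I. trapezoid (1 + 1 / real (Suc n)) (X i \<omega>)) \<le> 1" by simp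
    qed
  qed auto
  then show ?thesis by simp
qed

text \<open>Both probabilities are limits of the same sequence of Fourier integrals.\<close>

lemma box_probability_eq:
  assumes X: "gaussian_family M I X c" and Y: "gaussian_family N I Y c"
  shows "measure M {\<omega>\<in>space M. \<forall>i\<in>I. \<bar>X i \<omega>\<bar> \<le> 1} = measure N {\<omega>\<in>space N. \<forall>i\<in>I. \<bar>Y i \<omega>\<bar> \<le> 1}"
proof (rule LIMSEQ_unique)
  show "(\<lambda>n. LINT \<omega>|M. (\<Prod>i\<in>I. trapezoid (1 + 1 / real (Suc n)) (X i \<omega>)))
     \<longlonglongrightarrow> measure M {\<omega>\<in>space M. \<forall>i\<in>I. \<bar>X i \<omega>\<bar> \<le> 1}"
    using X by (intro box_probability_tendsto) (auto simp: gaussian_family_def)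
  have "(\<lambda>n. LINT \<omega>|N. (\<Prod>i\<in>I. trapezoid (1 + 1 / real (Suc n)) (Y i \<omega>)))
     \<longlonglongrightarrow> measure N {\<omega>\<in>space N. \<forall>i\<in>I. \<bar>Y i \<omega>\<bar> \<le> 1}"
    using Y by (intro box_probability_tendsto) (auto simp: gaussian_family_def)
  then show "(\<lambda>n. LINT \<omega>|M. (\<Prod>i\<in>I. trapezoid (1 + 1 / real (Suc n)) (X i \<omega>)))
     \<longlonglongrightarrow> measure N {\<omega>\<in>space N. \<forall>i\<in>I. \<bar>Y i \<omega>\<bar> \<le> 1}"
    by (simp add: expectation_prod_trapezoid_eq[OF X Y])
qed

lemma box_probability_eq_scaled:
  assumes X: "gaussian_family M I X c" and Y: "gaussian_family N I Y c"
    and a: "\<And>i. i \<in> I \<Longrightarrow> 0 < a i"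
  shows "measure M {\<omega>\<in>space M. \<forall>i\<in>I. \<bar>X i \<omega>\<bar> \<le> a i} = measure N {\<omega>\<in>space N. \<forall>i\<in>I. \<bar>Y i \<omega>\<bar> \<le> a i}"
proof -
  have "(\<bar>1 / a i * x\<bar> \<le> 1) = (\<bar>x\<bar> \<le> a i)" if "i \<in> I" for i x
    using a[OF that] by (simp add: divide_le_eq)
  then show ?thesis
    using box_probability_eq[OF gaussian_family_scale[OF X, of "\<lambda>i. 1 / a i"] gaussian_family_scale[OF Y, of "\<lambda>i. 1 / a i"]]
    by simp
qed

section \<open>Independent copies and coding\<close>

lemma integral_pair_mult:
  fixes f :: "'a \<Rightarrow> 'c::{real_normed_field, banach, second_countable_topology}"
  assumes "prob_space M" "prob_space N" and [measurable]: "f \<in> borel_measurable M" "g \<in> borel_measurable N"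
    and fb: "\<And>x. norm (f x) \<le> 1" and gb: "\<And>y. norm (g y) \<le> 1"
  shows "(\<integral>p. f (fst p) * g (snd p) \<partial>(M \<Otimes>\<^sub>M N)) = (\<integral>x. f x \<partial>M) * (\<integral>y. g y \<partial>N)"
proof -
  interpret M: prob_space M by fact
  interpret N: prob_space N by fact
  interpret MN: pair_prob_space M N ..
  have int: "integrable (M \<Otimes>\<^sub>M N) (\<lambda>p. f (fst p) * g (snd p))"
  proof (rule MN.integrable_const_bound[where B=1])
    show "AE p in M \<Otimes>\<^sub>M N. norm (f (fst p) * g (snd p)) \<le> 1"
      using mult_mono[OF fb gb] by (auto simp: norm_mult)
  qed measurable
  have "(\<integral>p. f (fst p) * g (snd p) \<partial>(M \<Otimes>\<^sub>M N)) = (\<integral>x. (\<integral>y. f x * g y \<partial>N) \<partial>M)"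
    using MN.integral_fst'[OF int] by simp
  then show ?thesis by simp
qed

text \<open>The two copies receive the vectors u / sqrt 2 and - u / sqrt 2, each with half of the
  quadratic form. Closeness of two independent copies thus becomes smallness of a single
  one.\<close>

lemma gaussian_family_pair_diff:
  assumes GF: "gaussian_family M I X c"
  shows "gaussian_family (M \<Otimes>\<^sub>M M) I (\<lambda>i p. (X i (fst p) - X i (snd p)) / sqrt 2) c"
proof -
  interpret M: prob_space M using GF by (simp add: gaussian_family_def)
  interpret MM: pair_prob_space M M ..
  have [measurable]: "i \<in> I \<Longrightarrow> X i \<in> borel_measurable M" for i using GF by (simp add: gaussian_family_def)
  have char: "(CLINT \<omega>|M. iexp (\<Sum>i\<in>I. v i * X i \<omega>)) = complex_of_real (exp (- quad_form I c v / 2))" for v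
    using GF by (simp add: gaussian_family_def)
  have "(CLINT p|(M \<Otimes>\<^sub>M M). iexp (\<Sum>i\<in>I. u i * ((X i (fst p) - X i (snd p)) / sqrt 2)))
      = complex_of_real (exp (- quad_form I c u / 2))" for u
  proof -
    let ?v = "\<lambda>i. u i / sqrt 2" and ?w = "\<lambda>i. - (u i / sqrt 2)"
    have split: "iexp (\<Sum>i\<in>I. u i * ((X i (fst p) - X i (snd p)) / sqrt 2))
        = iexp (\<Sum>i\<in>I. ?v i * X i (fst p)) * iexp (\<Sum>i\<in>I. ?w i * X i (snd p))" for p
    proof -
      have "(\<Sum>i\<in>I. u i * ((X i (fst p) - X i (snd p)) / sqrt 2))
          = (\<Sum>i\<in>I. ?v i * X i (fst p)) + (\<Sum>i\<in>I. ?w i * X i (snd p))"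
        by (simp add: sum.distrib[symmetric] diff_divide_distrib right_diff_distrib)
      then show ?thesis by (simp add: exp_add[symmetric] distrib_left)
    qed
    have "(CLINT p|(M \<Otimes>\<^sub>M M). iexp (\<Sum>i\<in>I. u i * ((X i (fst p) - X i (snd p)) / sqrt 2)))
        = (CLINT \<omega>|M. iexp (\<Sum>i\<in>I. ?v i * X i \<omega>)) * (CLINT \<omega>|M. iexp (\<Sum>i\<in>I. ?w i * X i \<omega>))"
      unfolding split
      by (rule integral_pair_mult[OF M.prob_space_axioms M.prob_space_axioms])
        (simp_all del: of_real_sum of_real_mult)
    also have "\<dots> = complex_of_real (exp (- quad_form I c ?v / 2) * exp (- quad_form I c ?w / 2))"
      unfolding char by simp
    also have "exp (- quad_form I c ?v / 2) * exp (- quad_form I c ?w / 2) = exp (- quad_form I c u / 2)"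
    proof -
      have "quad_form I c ?v = quad_form I c u / 2" "quad_form I c ?w = quad_form I c u / 2"
        by (simp_all add: quad_form_def sum_divide_distrib)
      then show ?thesis by (simp add: exp_add[symmetric])
    qed
    finally show ?thesis .
  qed
  then show ?thesis using GF MM.prob_space_axioms by (auto simp: gaussian_family_def)
qed

lemma gaussian_family_pair_independent:
  assumes X: "gaussian_family M I X c" and Y: "gaussian_family N K Y d"
  shows "gaussian_family (M \<Otimes>\<^sub>M N) (I <+> K)
    (\<lambda>z p. case z of Inl i \<Rightarrow> X i (fst p) | Inr k \<Rightarrow> Y k (snd p))
    (\<lambda>z z'. case (z, z') of (Inl i, Inl j) \<Rightarrow> c i j | (Inr k, Inr l) \<Rightarrow> d k l | _ \<Rightarrow> 0)"
    (is "gaussian_family _ _ ?Z ?e")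
proof -
  interpret M: prob_space M using X by (simp add: gaussian_family_def)
  interpret N: prob_space N using Y by (simp add: gaussian_family_def)
  interpret MN: pair_prob_space M N ..
  have [simp]: "finite I" "finite K" using X Y by (auto simp: gaussian_family_def)
  have [measurable]: "i \<in> I \<Longrightarrow> X i \<in> borel_measurable M" for i using X by (simp add: gaussian_family_def)
  have [measurable]: "k \<in> K \<Longrightarrow> Y k \<in> borel_measurable N" for k using Y by (simp add: gaussian_family_def)
  have "(CLINT p|(M \<Otimes>\<^sub>M N). iexp (\<Sum>z\<in>I <+> K. u z * ?Z z p)) = complex_of_real (exp (- quad_form (I <+> K) ?e u / 2))" for u
  proof -
    have "(CLINT p|(M \<Otimes>\<^sub>M N). iexp (\<Sum>z\<in>I <+> K. u z * ?Z z p))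
       = (CLINT p|(M \<Otimes>\<^sub>M N). iexp (\<Sum>i\<in>I. u (Inl i) * X i (fst p)) * iexp (\<Sum>k\<in>K. u (Inr k) * Y k (snd p)))"
      by (simp add: sum.Plus exp_add[symmetric] distrib_left del: of_real_mult)
    also have "\<dots> = (CLINT \<omega>|M. iexp (\<Sum>i\<in>I. u (Inl i) * X i \<omega>)) * (CLINT \<omega>|N. iexp (\<Sum>k\<in>K. u (Inr k) * Y k \<omega>))"
      by (rule integral_pair_mult[OF M.prob_space_axioms N.prob_space_axioms])
        (simp_all del: of_real_sum of_real_mult)
    also have "\<dots> = complex_of_real (exp (- quad_form I c (\<lambda>i. u (Inl i)) / 2) * exp (- quad_form K d (\<lambda>k. u (Inr k)) / 2))"
      using X Y by (simp add: gaussian_family_def)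
    also have "exp (- quad_form I c (\<lambda>i. u (Inl i)) / 2) * exp (- quad_form K d (\<lambda>k. u (Inr k)) / 2)
        = exp (- quad_form (I <+> K) ?e u / 2)"
      by (simp add: quad_form_def sum.Plus exp_add[symmetric] add_divide_distrib)
    finally show ?thesis .
  qed
  moreover have "?Z z \<in> borel_measurable (M \<Otimes>\<^sub>M N)" if "z \<in> I <+> K" for z
    using that by (cases z) auto
  ultimately show ?thesis using MN.prob_space_axioms by (auto simp: gaussian_family_def)
qed

text \<open>Compare with the family on \<open>M \<Otimes>\<^sub>M M\<close> whose two blocks are
  independent: the covariances agree inside the blocks and differ in 2 * card I * card K entries of
  size at most \<epsilon>.\<close>

lemma (in trapezoid_representation) quasi_independence:
  assumes Z: "gaussian_family M (I <+> K) Z c"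
    and Z1: "gaussian_family M I (\<lambda>i. Z (Inl i)) (\<lambda>i j. c (Inl i) (Inl j))"
    and Z2: "gaussian_family M K (\<lambda>k. Z (Inr k)) (\<lambda>k l. c (Inr k) (Inr l))"
    and small: "\<And>i k. i \<in> I \<Longrightarrow> k \<in> K \<Longrightarrow> \<bar>c (Inl i) (Inr k)\<bar> \<le> \<epsilon> \<and> \<bar>c (Inr k) (Inl i)\<bar> \<le> \<epsilon>"
  shows "\<bar>(LINT \<omega>|M. (\<Prod>i\<in>I. trapezoid \<theta> (Z (Inl i) \<omega>)) * (\<Prod>k\<in>K. trapezoid \<theta> (Z (Inr k) \<omega>)))
      - (LINT \<omega>|M. (\<Prod>i\<in>I. trapezoid \<theta> (Z (Inl i) \<omega>))) * (LINT \<omega>|M. (\<Prod>k\<in>K. trapezoid \<theta> (Z (Inr k) \<omega>)))\<bar>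
    \<le> \<Lambda> ^ (card I + card K) * ((LINT u|cauchy_law. sqrt \<bar>u\<bar>)\<^sup>2 * (2 * real (card I) * real (card K) * sqrt \<epsilon>))"
proof -
  interpret M: prob_space M using Z by (simp add: gaussian_family_def)
  have [simp]: "finite I" "finite K" using Z1 Z2 by (auto simp: gaussian_family_def)
  have [measurable]: "i \<in> I \<Longrightarrow> Z (Inl i) \<in> borel_measurable M" for i using Z1 by (simp add: gaussian_family_def)
  have [measurable]: "k \<in> K \<Longrightarrow> Z (Inr k) \<in> borel_measurable M" for k using Z2 by (simp add: gaussian_family_def)
  let ?e = "\<lambda>z z'. case (z, z') of (Inl i, Inl j) \<Rightarrow> c (Inl i) (Inl j) | (Inr k, Inr l) \<Rightarrow> c (Inr k) (Inr l) | _ \<Rightarrow> 0"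
  let ?Y = "\<lambda>z p. case z of Inl i \<Rightarrow> Z (Inl i) (fst p) | Inr k \<Rightarrow> Z (Inr k) (snd p)"
  have Y: "gaussian_family (M \<Otimes>\<^sub>M M) (I <+> K) ?Y ?e"
    by (rule gaussian_family_pair_independent[OF Z1 Z2])
  have prodZ: "(\<Prod>z\<in>I <+> K. trapezoid \<theta> (Z z \<omega>)) = (\<Prod>i\<in>I. trapezoid \<theta> (Z (Inl i) \<omega>)) * (\<Prod>k\<in>K. trapezoid \<theta> (Z (Inr k) \<omega>))" for \<omega>
    by (simp add: prod.Plus)
  have prodY: "(LINT p|(M \<Otimes>\<^sub>M M). (\<Prod>z\<in>I <+> K. trapezoid \<theta> (?Y z p)))
     = (LINT \<omega>|M. (\<Prod>i\<in>I. trapezoid \<theta> (Z (Inl i) \<omega>))) * (LINT \<omega>|M. (\<Prod>k\<in>K. trapezoid \<theta> (Z (Inr k) \<omega>)))"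
  proof -
    have b: "norm (\<Prod>i\<in>A. trapezoid \<theta> (f i)) \<le> 1" for A :: "'x set" and f
    proof -
      have "0 \<le> (\<Prod>i\<in>A. trapezoid \<theta> (f i))" "(\<Prod>i\<in>A. trapezoid \<theta> (f i)) \<le> 1"
        by (auto intro!: prod_nonneg prod_le_1 trapezoid_nonneg trapezoid_le_1 \<theta>)
      then show ?thesis by simp
    qed
    have "(LINT p|(M \<Otimes>\<^sub>M M). (\<Prod>z\<in>I <+> K. trapezoid \<theta> (?Y z p)))
       = (LINT p|(M \<Otimes>\<^sub>M M). (\<Prod>i\<in>I. trapezoid \<theta> (Z (Inl i) (fst p))) * (\<Prod>k\<in>K. trapezoid \<theta> (Z (Inr k) (snd p))))"
      by (simp add: prod.Plus)
    also have "\<dots> = (LINT \<omega>|M. (\<Prod>i\<in>I. trapezoid \<theta> (Z (Inl i) \<omega>))) * (LINT \<omega>|M. (\<Prod>k\<in>K. trapezoid \<theta> (Z (Inr k) \<omega>)))"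
      by (rule integral_pair_mult[OF M.prob_space_axioms M.prob_space_axioms]) (auto intro: b[simplified])
    finally show ?thesis .
  qed
  have "(\<Sum>z\<in>I <+> K. \<Sum>z'\<in>I <+> K. sqrt \<bar>c z z' - ?e z z'\<bar>)
      = (\<Sum>i\<in>I. \<Sum>k\<in>K. sqrt \<bar>c (Inl i) (Inr k)\<bar>) + (\<Sum>k\<in>K. \<Sum>i\<in>I. sqrt \<bar>c (Inr k) (Inl i)\<bar>)"
    by (simp add: sum.Plus)
  also have "\<dots> \<le> (\<Sum>i\<in>I. \<Sum>k\<in>K. sqrt \<epsilon>) + (\<Sum>k\<in>K. \<Sum>i\<in>I. sqrt \<epsilon>)"
    using small by (intro add_mono sum_mono) auto
  also have "\<dots> = 2 * real (card I) * real (card K) * sqrt \<epsilon>" by simp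
  finally have s: "(\<Sum>z\<in>I <+> K. \<Sum>z'\<in>I <+> K. sqrt \<bar>c z z' - ?e z z'\<bar>) \<le> 2 * real (card I) * real (card K) * sqrt \<epsilon>" .
  have "\<bar>(LINT \<omega>|M. (\<Prod>z\<in>I <+> K. trapezoid \<theta> (Z z \<omega>))) - (LINT p|(M \<Otimes>\<^sub>M M). (\<Prod>z\<in>I <+> K. trapezoid \<theta> (?Y z p)))\<bar>
    \<le> \<Lambda> ^ card (I <+> K) * ((LINT u|cauchy_law. sqrt \<bar>u\<bar>)\<^sup>2 * (\<Sum>z\<in>I <+> K. \<Sum>z'\<in>I <+> K. sqrt \<bar>c z z' - ?e z z'\<bar>))"
    by (rule expectation_prod_trapezoid_diff[OF Z Y]) (auto split: sum.splits)
  also have "\<dots> \<le> \<Lambda> ^ (card I + card K) * ((LINT u|cauchy_law. sqrt \<bar>u\<bar>)\<^sup>2 * (2 * real (card I) * real (card K) * sqrt \<epsilon>))"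
    using \<Lambda> s by (intro mult_mono mult_left_mono) (auto simp: card_Plus intro!: mult_nonneg_nonneg sum_nonneg)
  finally show ?thesis by (simp only: prodZ prodY)
qed

text \<open>The weights (1 - \<theta>) / (1 + \<theta>) * \<theta> ^ |k| form a probability
  distribution on the integers; in the coding argument this is the Kraft inequality for one
  coordinate.\<close>

lemma sum_geometric_symmetric_le:
  fixes \<theta> :: real
  assumes "0 < \<theta>" "\<theta> < 1"
  shows "(\<Sum>k\<in>{- int K..int K}. (1 - \<theta>) / (1 + \<theta>) * \<theta> ^ nat \<bar>k\<bar>) \<le> 1"
proof -
  have "(\<Sum>k\<in>{- int K..int K}. \<theta> ^ nat \<bar>k\<bar>) * (1 - \<theta>) = 1 + \<theta> - 2 * \<theta> ^ Suc K"
  proof (induction K)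
    case (Suc K)
    have "{- int (Suc K)..int (Suc K)} = insert (int (Suc K)) (insert (- int (Suc K)) {- int K..int K})" by auto
    then have "(\<Sum>k\<in>{- int (Suc K)..int (Suc K)}. \<theta> ^ nat \<bar>k\<bar>)
        = \<theta> ^ Suc K + (\<theta> ^ Suc K + (\<Sum>k\<in>{- int K..int K}. \<theta> ^ nat \<bar>k\<bar>))"
      by (simp add: nat_add_distrib)
    then have "(\<Sum>k\<in>{- int (Suc K)..int (Suc K)}. \<theta> ^ nat \<bar>k\<bar>) * (1 - \<theta>)
        = 2 * \<theta> ^ Suc K * (1 - \<theta>) + (\<Sum>k\<in>{- int K..int K}. \<theta> ^ nat \<bar>k\<bar>) * (1 - \<theta>)"
      by (simp only: distrib_right)
    also have "\<dots> = 1 + \<theta> - 2 * \<theta> ^ Suc (Suc K)"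
      unfolding Suc.IH by (simp add: algebra_simps)
    finally show ?case .
  qed simp
  then have "(\<Sum>k\<in>{- int K..int K}. \<theta> ^ nat \<bar>k\<bar>) * (1 - \<theta>) \<le> 1 + \<theta>" using assms by simp
  then have "(\<Sum>k\<in>{- int K..int K}. \<theta> ^ nat \<bar>k\<bar>) * (1 - \<theta>) / (1 + \<theta>) \<le> 1"
    using assms by (simp add: divide_le_eq)
  moreover have "(\<Sum>k\<in>{- int K..int K}. (1 - \<theta>) / (1 + \<theta>) * \<theta> ^ nat \<bar>k\<bar>)
      = (1 - \<theta>) / (1 + \<theta>) * (\<Sum>k\<in>{- int K..int K}. \<theta> ^ nat \<bar>k\<bar>)"
    by (rule sum_distrib_left[symmetric])
  ultimately show ?thesis by (simp add: mult.commute)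
qed

text \<open>Quantise \<open>Y t\<close> to multiples of \<open>a t\<close>. A prefix-free code with geometric weights has expected
  length at most \<open>L\<close>, so by Markov and Kraft at least half of the mass sits on at most \<open>exp (2 * L)\<close>
  cells; by Cauchy--Schwarz two independent copies share a cell with probability at least
  \<open>exp (- 2 * L) / 4\<close>.\<close>

lemma collision_probability_ge:
  fixes Y :: "'t \<Rightarrow> 'a \<Rightarrow> real" and a \<theta> :: "'t \<Rightarrow> real"
  assumes "prob_space M" and fin: "finite T"
    and Y [measurable]: "\<And>t. t \<in> T \<Longrightarrow> Y t \<in> borel_measurable M"
    and a: "\<And>t. t \<in> T \<Longrightarrow> 0 < a t"
    and \<theta>: "\<And>t. t \<in> T \<Longrightarrow> 0 < \<theta> t \<and> \<theta> t < 1"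
    and int: "\<And>t. t \<in> T \<Longrightarrow> integrable M (\<lambda>\<omega>. real_of_int \<bar>round (Y t \<omega> / a t)\<bar>)"
    and L: "(\<Sum>t\<in>T. ln ((1 + \<theta> t) / (1 - \<theta> t)) + ln (1 / \<theta> t) * (LINT \<omega>|M. real_of_int \<bar>round (Y t \<omega> / a t)\<bar>)) \<le> L"
    and L0: "0 < L"
  shows "exp (- 2 * L) / 4
    \<le> measure (M \<Otimes>\<^sub>M M) {p\<in>space (M \<Otimes>\<^sub>M M). \<forall>t\<in>T. \<bar>Y t (fst p) - Y t (snd p)\<bar> \<le> a t}"
proof -
  interpret M: prob_space M by fact
  interpret MM: pair_prob_space M M ..
  define k where "k t \<omega> = round (Y t \<omega> / a t)" for t \<omega>
  have k_meas [measurable]: "t \<in> T \<Longrightarrow> k t \<in> measurable M (count_space UNIV)" for t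
    unfolding k_def round_def by measurable
  \<comment> \<open>The restriction to T makes a code word an element of \<open>PiE T\<close>, so
    that cells can be counted.\<close>
  define code where "code \<omega> = restrict (\<lambda>t. k t \<omega>) T" for \<omega>
  \<comment> \<open>Minus the logarithm of the product of the geometric weights of the cell.\<close>
  define len where "len m = (\<Sum>t\<in>T. ln ((1 + \<theta> t) / (1 - \<theta> t)) + ln (1 / \<theta> t) * real_of_int \<bar>m t\<bar>)" for m :: "'t \<Rightarrow> int"
  have len_code: "len (code \<omega>) = (\<Sum>t\<in>T. ln ((1 + \<theta> t) / (1 - \<theta> t)) + ln (1 / \<theta> t) * real_of_int \<bar>k t \<omega>\<bar>)" for \<omega>
    unfolding len_def code_def by (intro sum.cong) auto
  have len_nonneg: "0 \<le> len m" for m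
    unfolding len_def
  proof (intro sum_nonneg add_nonneg_nonneg mult_nonneg_nonneg ln_ge_zero)
    fix t assume t: "t \<in> T"
    show "1 \<le> (1 + \<theta> t) / (1 - \<theta> t)" using \<theta>[OF t] by simp
    show "1 \<le> 1 / \<theta> t" using \<theta>[OF t] by simp
  qed auto
  have len_int: "integrable M (\<lambda>\<omega>. len (code \<omega>))"
    unfolding len_code using int by (auto simp: k_def)
  have len_E: "(LINT \<omega>|M. len (code \<omega>)) \<le> L"
    unfolding len_code using int L by (subst Bochner_Integration.integral_sum) (auto simp: k_def M.prob_space)
  define G where "G = {m \<in> PiE T (\<lambda>_. UNIV). len m < 2 * L}"
  \<comment> \<open>Stated for finite subsets, since the finiteness of G is itself a consequence of
    this uniform bound.\<close>
  have cardG: "real (card F) \<le> exp (2 * L)" if F: "F \<subseteq> G" "finite F" for F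
  proof -
    define K where "K = nat (Max (insert 0 ((\<lambda>(m, t). \<bar>m t\<bar>) ` (F \<times> T))))"
    have K: "\<bar>m t\<bar> \<le> int K" if "m \<in> F" "t \<in> T" for m t
    proof -
      have "\<bar>m t\<bar> \<le> Max (insert 0 ((\<lambda>(m, t). \<bar>m t\<bar>) ` (F \<times> T)))"
        by (rule Max_ge) (use that F fin in auto)
      then show ?thesis unfolding K_def by linarith
    qed
    let ?q = "\<lambda>t j. (1 - \<theta> t) / (1 + \<theta> t) * \<theta> t ^ nat \<bar>j::int\<bar>"
    have q_len: "exp (- len m) = (\<Prod>t\<in>T. ?q t (m t))" for m
    proof -
      have "exp (- len m) = (\<Prod>t\<in>T. exp (- (ln ((1 + \<theta> t) / (1 - \<theta> t)) + ln (1 / \<theta> t) * real_of_int \<bar>m t\<bar>)))"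
        unfolding len_def by (simp add: sum_negf[symmetric] exp_sum fin del: minus_add_distrib)
      also have "\<dots> = (\<Prod>t\<in>T. ?q t (m t))"
      proof (rule prod.cong[OF refl])
        fix t assume t: "t \<in> T"
        have "exp (- (ln ((1 + \<theta> t) / (1 - \<theta> t)) + ln (1 / \<theta> t) * real_of_int \<bar>m t\<bar>))
           = exp (ln ((1 - \<theta> t) / (1 + \<theta> t))) * exp (real (nat \<bar>m t\<bar>) * ln (\<theta> t))"
          using \<theta>[OF t] by (simp add: ln_div exp_add[symmetric] mult.commute)
        also have "\<dots> = ?q t (m t)" using \<theta>[OF t] by (simp only: exp_of_nat_mult) simp
        finally show "exp (- (ln ((1 + \<theta> t) / (1 - \<theta> t)) + ln (1 / \<theta> t) * real_of_int \<bar>m t\<bar>)) = ?q t (m t)" .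
      qed
      finally show ?thesis .
    qed
    have "real (card F) * exp (- (2 * L)) = (\<Sum>m\<in>F. exp (- (2 * L)))" by simp
    also have "\<dots> \<le> (\<Sum>m\<in>F. exp (- len m))"
      using F by (intro sum_mono) (auto simp: G_def)
    also have "\<dots> = (\<Sum>m\<in>F. \<Prod>t\<in>T. ?q t (m t))" by (simp only: q_len)
    also have "\<dots> \<le> (\<Sum>m\<in>PiE T (\<lambda>_. {- int K..int K}). \<Prod>t\<in>T. ?q t (m t))"
    proof (rule sum_mono2)
      show "finite (PiE T (\<lambda>_. {- int K..int K}))" using fin by (intro finite_PiE) auto
      show "F \<subseteq> PiE T (\<lambda>_. {- int K..int K})"
      proof
        fix m assume m: "m \<in> F"
        then have "m \<in> PiE T (\<lambda>_. UNIV)" using F by (auto simp: G_def)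
        moreover have "m t \<in> {- int K..int K}" if "t \<in> T" for t using K[OF m that] by auto
        ultimately show "m \<in> PiE T (\<lambda>_. {- int K..int K})" by (auto simp: PiE_def)
      qed
      fix m show "0 \<le> (\<Prod>t\<in>T. ?q t (m t))" using \<theta> by (intro prod_nonneg) (auto simp: less_imp_le)
    qed
    also have "\<dots> = (\<Prod>t\<in>T. \<Sum>j\<in>{- int K..int K}. ?q t j)"
      by (rule prod_sum_PiE[symmetric]) (use fin in auto)
    also have "\<dots> \<le> 1"
      using \<theta> by (intro prod_le_1 conjI sum_nonneg sum_geometric_symmetric_le) (auto simp: less_imp_le)
    finally show ?thesis by (simp add: exp_minus field_simps)
  qed
  have "card F \<le> nat \<lceil>exp (2 * L)\<rceil>" if "F \<subseteq> G" "finite F" for F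
    using cardG[OF that] by linarith
  then have finG: "finite G" using finite_if_finite_subsets_card_bdd by blast
  define A where "A m = {\<omega>\<in>space M. \<forall>t\<in>T. k t \<omega> = m t}" for m
  have A_meas [measurable]: "A m \<in> sets M" for m
    unfolding A_def using fin by measurable
  have A_eq: "A m = {\<omega>\<in>space M. code \<omega> = m}" if "m \<in> G" for m
    using that unfolding A_def code_def G_def by (auto simp: PiE_def extensional_def restrict_def fun_eq_iff)
  have disj: "disjoint_family_on A G" "disjoint_family_on (\<lambda>m. A m \<times> A m) G"
    unfolding disjoint_family_on_def by (auto simp: A_eq)
  have half: "1 / 2 \<le> (\<Sum>m\<in>G. measure M (A m))"
  proof -
    have [measurable]: "(\<lambda>\<omega>. len (code \<omega>)) \<in> borel_measurable M" using len_int by auto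
    have "measure M {\<omega>\<in>space M. 2 * L \<le> len (code \<omega>)} \<le> (LINT \<omega>|M. len (code \<omega>)) / (2 * L)"
      by (rule integral_Markov_inequality_measure[where A="{}"]) (use len_int len_nonneg L0 in auto)
    also have "\<dots> \<le> L / (2 * L)" using len_E L0 by (intro divide_right_mono) auto
    also have "\<dots> = 1 / 2" using L0 by simp
    finally have "measure M {\<omega>\<in>space M. 2 * L \<le> len (code \<omega>)} \<le> 1 / 2" .
    moreover have "measure M {\<omega>\<in>space M. 2 * L \<le> len (code \<omega>)} = 1 - measure M {\<omega>\<in>space M. \<not> 2 * L \<le> len (code \<omega>)}"
      by (subst M.prob_neg) auto
    ultimately have "1 / 2 \<le> measure M {\<omega>\<in>space M. \<not> 2 * L \<le> len (code \<omega>)}" by linarith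
    also have "{\<omega>\<in>space M. \<not> 2 * L \<le> len (code \<omega>)} = (\<Union>m\<in>G. A m)"
    proof -
      have "(\<Union>m\<in>G. A m) = (\<Union>m\<in>G. {\<omega>\<in>space M. code \<omega> = m})" using A_eq by auto
      also have "\<dots> = {\<omega>\<in>space M. \<not> 2 * L \<le> len (code \<omega>)}"
        unfolding G_def by (auto simp: code_def)
      finally show ?thesis by simp
    qed
    also have "measure M (\<Union>m\<in>G. A m) = (\<Sum>m\<in>G. measure M (A m))"
      by (rule M.finite_measure_finite_Union) (use finG disj in auto)
    finally show ?thesis .
  qed
  have "1 / 4 = (1 / 2 :: real)\<^sup>2" by (simp add: power2_eq_square)
  also have "\<dots> \<le> (\<Sum>m\<in>G. measure M (A m))\<^sup>2" using half by (intro power_mono) auto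
  also have "\<dots> \<le> (\<Sum>m\<in>G. (measure M (A m))\<^sup>2) * real (card G)"
    by (rule sum_squared_le_sum_of_squares)
  also have "\<dots> \<le> (\<Sum>m\<in>G. (measure M (A m))\<^sup>2) * exp (2 * L)"
    using cardG[OF subset_refl finG] by (intro mult_left_mono) (auto intro: sum_nonneg)
  finally have "exp (- 2 * L) / 4 \<le> (\<Sum>m\<in>G. (measure M (A m))\<^sup>2)"
    by (simp add: exp_minus field_simps)
  also have "\<dots> = (\<Sum>m\<in>G. measure (M \<Otimes>\<^sub>M M) (A m \<times> A m))"
    by (simp add: measure_def M.emeasure_pair_measure_Times enn2real_mult power2_eq_square)
  also have "\<dots> = measure (M \<Otimes>\<^sub>M M) (\<Union>m\<in>G. A m \<times> A m)"
    by (rule MM.finite_measure_finite_Union[symmetric]) (use finG disj in auto)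
  also have "\<dots> \<le> measure (M \<Otimes>\<^sub>M M) {p\<in>space (M \<Otimes>\<^sub>M M). \<forall>t\<in>T. \<bar>Y t (fst p) - Y t (snd p)\<bar> \<le> a t}"
  proof (rule MM.finite_measure_mono)
    show "{p\<in>space (M \<Otimes>\<^sub>M M). \<forall>t\<in>T. \<bar>Y t (fst p) - Y t (snd p)\<bar> \<le> a t} \<in> sets (M \<Otimes>\<^sub>M M)"
      using fin by measurable
    \<comment> \<open>In units of \<open>a t\<close>, two numbers with the same rounding are at
      distance at most 1/2 + 1/2.\<close>
    have "\<bar>y - y'\<bar> \<le> a t" if t: "t \<in> T" and e: "round (y / a t) = round (y' / a t)" for t y y'
    proof -
      have "\<bar>y / a t - y' / a t\<bar> \<le> 1"
        using of_int_round_abs_le[of "y / a t"] of_int_round_abs_le[of "y' / a t"] e by linarith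
      then have "\<bar>(y - y') / a t\<bar> \<le> 1" by (simp add: diff_divide_distrib)
      then show ?thesis using a[OF t] by (simp add: divide_le_eq)
    qed
    then show "(\<Union>m\<in>G. A m \<times> A m) \<subseteq> {p\<in>space (M \<Otimes>\<^sub>M M). \<forall>t\<in>T. \<bar>Y t (fst p) - Y t (snd p)\<bar> \<le> a t}"
      unfolding A_def k_def by (auto simp: space_pair_measure)
  qed
  finally show ?thesis .
qed

section \<open>Schur multipliers\<close>

definition psd :: "'i set \<Rightarrow> ('i \<Rightarrow> 'i \<Rightarrow> real) \<Rightarrow> bool" where
  "psd I A \<longleftrightarrow> (\<forall>u. 0 \<le> quad_form I A u)"

text \<open>Multipliers rather than positive semidefinite kernels: closure under products is then
  just composition, and applying a multiplier to the kernel constantly 1 shows that it is positive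
  semidefinite itself.\<close>

definition schur_multiplier :: "'i set \<Rightarrow> ('i \<Rightarrow> 'i \<Rightarrow> real) \<Rightarrow> bool" where
  "schur_multiplier I K \<longleftrightarrow> (\<forall>A. psd I A \<longrightarrow> psd I (\<lambda>i j. K i j * A i j))"

lemma schur_multiplier_rank_one: "schur_multiplier I (\<lambda>i j. f i * f j)"
proof -
  have "quad_form I (\<lambda>i j. f i * f j * A i j) u = quad_form I A (\<lambda>i. u i * f i)" for A u
    unfolding quad_form_def by (intro sum.cong) auto
  then show ?thesis by (simp add: schur_multiplier_def psd_def)
qed

lemma schur_multiplier_add:
  assumes "schur_multiplier I K" "schur_multiplier I K'"
  shows "schur_multiplier I (\<lambda>i j. K i j + K' i j)"
proof -
  have "quad_form I (\<lambda>i j. (K i j + K' i j) * A i j) u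
      = quad_form I (\<lambda>i j. K i j * A i j) u + quad_form I (\<lambda>i j. K' i j * A i j) u" for A u
    unfolding quad_form_def sum.distrib[symmetric] by (intro sum.cong) (auto simp: algebra_simps)
  then show ?thesis using assms by (simp add: schur_multiplier_def psd_def)
qed

lemma schur_multiplier_cmult:
  assumes "schur_multiplier I K" "0 \<le> c"
  shows "schur_multiplier I (\<lambda>i j. c * K i j)"
proof -
  have "quad_form I (\<lambda>i j. c * K i j * A i j) u = c * quad_form I (\<lambda>i j. K i j * A i j) u" for A u
    unfolding quad_form_def sum_distrib_left by (intro sum.cong) (auto simp: algebra_simps)
  then show ?thesis using assms by (simp add: schur_multiplier_def psd_def)
qed

lemma schur_multiplier_mult:
  assumes "schur_multiplier I K" "schur_multiplier I K'"
  shows "schur_multiplier I (\<lambda>i j. K i j * K' i j)"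
  using assms by (simp add: schur_multiplier_def mult.assoc)

lemma schur_multiplier_const: "0 \<le> c \<Longrightarrow> schur_multiplier I (\<lambda>i j. c)"
  using schur_multiplier_cmult[OF schur_multiplier_rank_one[of I "\<lambda>_. 1"]] by simp

lemma schur_multiplier_sum:
  assumes "\<And>x. x \<in> S \<Longrightarrow> schur_multiplier I (K x)"
  shows "schur_multiplier I (\<lambda>i j. \<Sum>x\<in>S. K x i j)"
  using assms
proof (induction S rule: infinite_finite_induct)
  case (insert x S)
  then show ?case by (simp add: schur_multiplier_add)
qed (simp_all add: schur_multiplier_const)

lemma schur_multiplier_prod:
  assumes "\<And>x. x \<in> S \<Longrightarrow> schur_multiplier I (K x)"
  shows "schur_multiplier I (\<lambda>i j. \<Prod>x\<in>S. K x i j)"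
  using assms
proof (induction S rule: infinite_finite_induct)
  case (insert x S)
  then show ?case by (simp add: schur_multiplier_mult)
qed (simp_all add: schur_multiplier_const)

lemma schur_multiplier_power:
  "schur_multiplier I K \<Longrightarrow> schur_multiplier I (\<lambda>i j. K i j ^ n)"
  by (induction n) (simp_all add: schur_multiplier_const schur_multiplier_mult)

lemma schur_multiplier_limit:
  assumes K: "\<And>n. schur_multiplier I (K n)" and lim: "\<And>i j. (\<lambda>n. K n i j) \<longlonglongrightarrow> L i j"
  shows "schur_multiplier I L"
  unfolding schur_multiplier_def psd_def
proof (intro allI impI)
  fix A u assume A: "\<forall>u. 0 \<le> quad_form I A u"
  have "(\<lambda>n. quad_form I (\<lambda>i j. K n i j * A i j) u) \<longlonglongrightarrow> quad_form I (\<lambda>i j. L i j * A i j) u"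
    unfolding quad_form_def by (intro tendsto_intros lim)
  moreover have "0 \<le> quad_form I (\<lambda>i j. K n i j * A i j) u" for n
    using K[of n] A by (simp add: schur_multiplier_def psd_def)
  ultimately show "0 \<le> quad_form I (\<lambda>i j. L i j * A i j) u"
    by (intro LIMSEQ_le_const) auto
qed

text \<open>A limit of polynomials in K with nonnegative coefficients.\<close>

lemma schur_multiplier_exp:
  assumes "schur_multiplier I K"
  shows "schur_multiplier I (\<lambda>i j. exp (K i j))"
proof (rule schur_multiplier_limit)
  show "schur_multiplier I (\<lambda>i j. \<Sum>k<n. (1 / fact k) * K i j ^ k)" for n
    by (intro schur_multiplier_sum schur_multiplier_cmult schur_multiplier_power assms) simp
  show "(\<lambda>n. \<Sum>k<n. (1 / fact k) * K i j ^ k) \<longlonglongrightarrow> exp (K i j)" for i j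
    using exp_converges[of "K i j"] by (simp add: sums_def divide_inverse mult.commute)
qed

lemma quad_form_schur_multiplier_nonneg:
  assumes "schur_multiplier I K"
  shows "0 \<le> quad_form I K u"
proof -
  have "quad_form I (\<lambda>_ _. 1) w = (\<Sum>i\<in>I. w i)\<^sup>2" for w
    by (simp add: quad_form_def power2_eq_square sum_product)
  then have "psd I (\<lambda>_ _. 1)" by (simp add: psd_def)
  then show ?thesis using assms unfolding schur_multiplier_def psd_def by fastforce
qed

text \<open>A Gram kernel: min (f i) (f j) counts the common elements of {1..f i} and {1..f
  j}.\<close>

lemma schur_multiplier_min:
  fixes f :: "'i \<Rightarrow> nat"
  assumes "\<And>i. f i \<le> N"
  shows "schur_multiplier I (\<lambda>i j. real (min (f i) (f j)))"
proof -
  have "real (min (f i) (f j)) = (\<Sum>k\<in>{1..N}. (if k \<le> f i then 1 else 0) * (if k \<le> f j then 1 else 0))" for i j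
  proof -
    have "(\<Sum>k\<in>{1..N}. (if k \<le> f i then 1 else 0) * (if k \<le> f j then 1 else 0 :: real))
        = (\<Sum>k\<in>{1..min (f i) (f j)}. 1)"
      using assms[of i] by (intro sum.mono_neutral_cong_right) auto
    then show ?thesis by simp
  qed
  then show ?thesis by (simp add: schur_multiplier_sum schur_multiplier_rank_one del: mult_zero_left mult_zero_right)
qed

lemma schur_multiplier_eq:
  fixes f :: "'i \<Rightarrow> nat"
  assumes "\<And>i. f i \<le> N"
  shows "schur_multiplier I (\<lambda>i j. if f i = f j then 1 else 0)"
proof -
  have "(if f i = f j then 1 else 0) = (\<Sum>k\<in>{0..N}. (if k = f i then 1 else 0) * (if k = f j then 1 else 0 :: real))" for i j
  proof -
    have "(\<Sum>k\<in>{0..N}. (if k = f i then 1 else 0) * (if k = f j then 1 else 0 :: real))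
        = (\<Sum>k\<in>{f i}. (if k = f j then 1 else 0))"
      using assms[of i] by (intro sum.mono_neutral_cong_right) auto
    then show ?thesis by simp
  qed
  then show ?thesis by (simp add: schur_multiplier_sum schur_multiplier_rank_one del: mult_zero_left mult_zero_right)
qed

text \<open>With \<open>F k i = \<rho> ^ (f i - k)\<close> for \<open>k \<le> f i\<close>, the kernel \<open>\<rho> ^ \<bar>f i - f j\<bar>\<close> is
  \<open>F 0 F 0 + (1 - \<rho>\<^sup>2) \<Sum>k\<ge>1. F k F k\<close> and the indicator of \<open>f i = k\<close> is \<open>F k - \<rho> F (k + 1)\<close>;
  the difference below is therefore a nonnegative combination of squares of \<open>F k\<close> and
  \<open>F k + \<rho> F (k + 1)\<close>.\<close>

lemma schur_multiplier_geometric_minus_diagonal: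
  fixes f :: "'i \<Rightarrow> nat"
  assumes f: "\<And>i. f i \<le> N" and \<rho>: "0 < \<rho>" "\<rho> < 1"
  shows "schur_multiplier I (\<lambda>i j. \<rho> ^ ((f i - f j) + (f j - f i)) - (1 - \<rho>\<^sup>2) / 4 * (if f i = f j then 1 else 0))"
proof -
  define F where "F k i = (if k \<le> f i then \<rho> ^ (f i - k) else 0)" for k i
  \<comment> \<open>With this value the leftover coefficients are (1 + \<rho>^2) / 2 and (1 -
    \<rho>^2)^2 / 2, both nonnegative.\<close>
  define c where "c = (1 - \<rho>\<^sup>2) / 4"
  have \<rho>2: "0 < \<rho>\<^sup>2" "\<rho>\<^sup>2 < 1" using \<rho> by (auto simp: power_less_one_iff)
  have c: "0 \<le> c" "0 \<le> 1 - 2 * c" "0 \<le> 1 - \<rho>\<^sup>2 - c * (2 + 2 * \<rho>\<^sup>2)"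
  proof -
    show "0 \<le> c" using \<rho>2 by (simp add: c_def)
    have half: "1 - 2 * c = (1 + \<rho>\<^sup>2) / 2" by (simp add: c_def field_simps)
    show "0 \<le> 1 - 2 * c" unfolding half by simp
    have sq: "1 - \<rho>\<^sup>2 - c * (2 + 2 * \<rho>\<^sup>2) = (1 - \<rho>\<^sup>2) * (1 - \<rho>\<^sup>2) / 2"
      by (simp add: c_def field_simps)
    show "0 \<le> 1 - \<rho>\<^sup>2 - c * (2 + 2 * \<rho>\<^sup>2)" unfolding sq by simp
  qed
  have geo0: "\<rho> ^ ((p - q) + (q - p)) = \<rho> ^ p * \<rho> ^ q + (1 - \<rho>\<^sup>2) * (\<Sum>k\<in>{1..N}. (if k \<le> p then \<rho> ^ (p - k) else 0) * (if k \<le> q then \<rho> ^ (q - k) else 0))"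
    if "p \<le> q" "q \<le> N" for p q
  proof -
    obtain d where q: "q = p + d" using \<open>p \<le> q\<close> le_Suc_ex by blast
    have "(\<Sum>k\<in>{1..N}. (if k \<le> p then \<rho> ^ (p - k) else 0) * (if k \<le> q then \<rho> ^ (q - k) else 0))
        = (\<Sum>k\<in>{1..p}. \<rho> ^ d * (\<rho>\<^sup>2) ^ (p - k))"
    proof (rule sum.mono_neutral_cong_right)
      fix k assume k: "k \<in> {1..p}"
      then obtain e where e: "p = k + e" using le_Suc_ex by fastforce
      show "(if k \<le> p then \<rho> ^ (p - k) else 0) * (if k \<le> q then \<rho> ^ (q - k) else 0) = \<rho> ^ d * (\<rho>\<^sup>2) ^ (p - k)"
        using q by (simp add: e power_add power2_eq_square power_mult_distrib)
    qed (use that in auto)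
    also have "\<dots> = \<rho> ^ d * (\<Sum>k<p. (\<rho>\<^sup>2) ^ (p - Suc k))"
      unfolding sum_distrib_left[symmetric]
      by (rule arg_cong[where f="\<lambda>x. \<rho> ^ d * x"], rule sum.reindex_bij_witness[of _ Suc "\<lambda>k. k - 1"]) auto
    also have "(\<Sum>k<p. (\<rho>\<^sup>2) ^ (p - Suc k)) = (\<Sum>k<p. (\<rho>\<^sup>2) ^ k)" by (rule sum.nat_diff_reindex)
    finally have "(1 - \<rho>\<^sup>2) * (\<Sum>k\<in>{1..N}. (if k \<le> p then \<rho> ^ (p - k) else 0) * (if k \<le> q then \<rho> ^ (q - k) else 0))
        = \<rho> ^ d * (1 - (\<rho>\<^sup>2) ^ p)"
      using one_diff_power_eq[of "\<rho>\<^sup>2" p] by simp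
    moreover have "\<rho> ^ p * \<rho> ^ q = \<rho> ^ d * (\<rho>\<^sup>2) ^ p"
      using q by (simp add: power_add power2_eq_square power_mult_distrib)
    ultimately show ?thesis using q by (simp add: algebra_simps)
  qed
  have geo: "\<rho> ^ ((f i - f j) + (f j - f i)) = F 0 i * F 0 j + (1 - \<rho>\<^sup>2) * (\<Sum>k\<in>{1..N}. F k i * F k j)" for i j
  proof (cases "f i \<le> f j")
    case True
    then show ?thesis using geo0[OF True f] by (simp add: F_def)
  next
    case False
    then show ?thesis using geo0[of "f j" "f i"] f by (simp add: F_def mult.commute add.commute)
  qed
  have ind: "F k i - \<rho> * F (Suc k) i = (if f i = k then 1 else 0)" for k i
  proof (cases "k < f i")
    case True
    then have "f i - k = Suc (f i - Suc k)" by simp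
    then show ?thesis using True by (simp add: F_def)
  qed (auto simp: F_def)
  have eq: "(if f i = f j then 1 else 0) = (\<Sum>k\<in>{0..N}. (F k i - \<rho> * F (Suc k) i) * (F k j - \<rho> * F (Suc k) j))" for i j
  proof -
    have "(\<Sum>k\<in>{0..N}. (F k i - \<rho> * F (Suc k) i) * (F k j - \<rho> * F (Suc k) j))
        = (\<Sum>k\<in>{0..N}. (if f i = k then 1 else 0) * (if f j = k then 1 else 0))"
      by (simp only: ind)
    also have "\<dots> = (\<Sum>k\<in>{f i}. (if f j = k then 1 else 0))"
      using f[of i] by (intro sum.mono_neutral_cong_right) auto
    finally show ?thesis by auto
  qed
  \<comment> \<open>The index \<open>Suc N\<close> contributes nothing because f is bounded by
    N.\<close>
  have shift: "(\<Sum>k\<in>{0..N}. F (Suc k) i * F (Suc k) j) = (\<Sum>k\<in>{1..N}. F k i * F k j)" for i j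
  proof -
    have "(\<Sum>k\<in>{0..N}. F (Suc k) i * F (Suc k) j) = (\<Sum>k\<in>{1..Suc N}. F k i * F k j)"
      by (rule sum.reindex_bij_witness[of _ "\<lambda>k. k - 1" Suc]) auto
    also have "\<dots> = (\<Sum>k\<in>{1..N}. F k i * F k j)"
      using f[of i] by (simp add: F_def)
    finally show ?thesis .
  qed
  \<comment> \<open>Parallelogram identity: for p = F k and q = \<rho> * F (k + 1), the product of
    the differences p - q and p' - q' plus that of the sums is 2 * p * p' + 2 * q * q'.\<close>
  have eq2: "(if f i = f j then 1 else 0) = 2 * (F 0 i * F 0 j) + (2 + 2 * \<rho>\<^sup>2) * (\<Sum>k\<in>{1..N}. F k i * F k j)
      - (\<Sum>k\<in>{0..N}. (F k i + \<rho> * F (Suc k) i) * (F k j + \<rho> * F (Suc k) j))" for i j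
  proof -
    have "(if f i = f j then 1 else 0) + (\<Sum>k\<in>{0..N}. (F k i + \<rho> * F (Suc k) i) * (F k j + \<rho> * F (Suc k) j))
       = (\<Sum>k\<in>{0..N}. 2 * (F k i * F k j) + 2 * \<rho>\<^sup>2 * (F (Suc k) i * F (Suc k) j))"
      unfolding eq sum.distrib[symmetric] by (intro sum.cong) (auto simp: algebra_simps power2_eq_square)
    also have "\<dots> = 2 * (\<Sum>k\<in>{0..N}. F k i * F k j) + 2 * \<rho>\<^sup>2 * (\<Sum>k\<in>{1..N}. F k i * F k j)"
      by (simp only: sum.distrib sum_distrib_left[symmetric] shift)
    also have "(\<Sum>k\<in>{0..N}. F k i * F k j) = F 0 i * F 0 j + (\<Sum>k\<in>{1..N}. F k i * F k j)"
      by (simp add: sum.atLeast_Suc_atMost)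
    finally show ?thesis by (simp add: algebra_simps)
  qed
  have K: "\<rho> ^ ((f i - f j) + (f j - f i)) - c * (if f i = f j then 1 else 0)
      = (1 - 2 * c) * (F 0 i * F 0 j) + (1 - \<rho>\<^sup>2 - c * (2 + 2 * \<rho>\<^sup>2)) * (\<Sum>k\<in>{1..N}. F k i * F k j)
        + c * (\<Sum>k\<in>{0..N}. (F k i + \<rho> * F (Suc k) i) * (F k j + \<rho> * F (Suc k) j))" for i j
    unfolding geo eq2 by (simp add: algebra_simps)
  show ?thesis
    unfolding c_def[symmetric] K
    by (intro schur_multiplier_add schur_multiplier_cmult schur_multiplier_sum schur_multiplier_rank_one c)
qed

text \<open>Telescoping: K * K' - E * E' = (K - E) * K' + E * (K' - E').\<close>

lemma schur_multiplier_prod_minus_prod: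
  assumes "finite S" and K: "\<And>x. x \<in> S \<Longrightarrow> schur_multiplier I (K x)"
    and E: "\<And>x. x \<in> S \<Longrightarrow> schur_multiplier I (E x)"
    and KE: "\<And>x. x \<in> S \<Longrightarrow> schur_multiplier I (\<lambda>i j. K x i j - E x i j)"
  shows "schur_multiplier I (\<lambda>i j. (\<Prod>x\<in>S. K x i j) - (\<Prod>x\<in>S. E x i j))"
  using assms
proof (induction S rule: finite_induct)
  case (insert x S)
  have eq: "(\<Prod>y\<in>insert x S. K y i j) - (\<Prod>y\<in>insert x S. E y i j)
      = (K x i j - E x i j) * (\<Prod>y\<in>S. K y i j) + E x i j * ((\<Prod>y\<in>S. K y i j) - (\<Prod>y\<in>S. E y i j))" for i j
    using insert.hyps by (simp add: algebra_simps)
  show ?case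
    unfolding eq using insert
    by (intro schur_multiplier_add schur_multiplier_mult schur_multiplier_prod) auto
qed (simp add: schur_multiplier_const)

text \<open>The index 0 stands for the origin, the base point of the process. All other points have
  coordinates at least a, away from the hyperplanes on which the rectangles degenerate.\<close>

definition grid_coord :: "real \<Rightarrow> real \<Rightarrow> ('n \<Rightarrow> nat) \<Rightarrow> 'n \<Rightarrow> real" where
  "grid_coord a r m i = (if m = (\<lambda>_. 0) then 0 else a + r * real (m i))"

text \<open>The measure of the symmetric difference of the two rectangles; the product of minima is
  the measure of their intersection.\<close>

definition grid_dist :: "real \<Rightarrow> real \<Rightarrow> ('n::finite \<Rightarrow> nat) \<Rightarrow> ('n \<Rightarrow> nat) \<Rightarrow> real" where
  "grid_dist a r m m' = (\<Prod>i\<in>UNIV. grid_coord a r m i) + (\<Prod>i\<in>UNIV. grid_coord a r m' i)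
     - 2 * (\<Prod>i\<in>UNIV. min (grid_coord a r m i) (grid_coord a r m' i))"

text \<open>Expand the product over i of a + r * min (m i) (m' i). Its linear part, combined with
  the diagonal terms, gives r * a ^ (CARD('n) - 1) times the sum of |m i - m' i|, whence the
  geometric kernels in \<rho>. The other terms have nonnegative coefficients, so their exponential
  is a multiplier, and the geometric kernels dominate a multiple of the identity.\<close>

lemma exp_grid_dist_lower_bound:
  fixes I :: "('n::finite \<Rightarrow> nat) set"
  assumes bdd: "\<And>m i. m \<in> I \<Longrightarrow> m i \<le> N" and pos: "0 < a" "0 < r" "0 < v"
  defines "\<rho> \<equiv> exp (- (v * (r * a ^ (CARD('n) - 1))))"
  assumes "finite I"
  shows "((1 - \<rho>\<^sup>2) / 4) ^ CARD('n) * (\<Sum>m\<in>I. (w m)\<^sup>2) \<le> quad_form I (\<lambda>m m'. exp (- (v * grid_dist a r m m'))) w"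
proof -
  define A where "A = r * a ^ (CARD('n) - 1)"
  have \<rho>: "0 < \<rho>" "\<rho> < 1" using pos by (auto simp: \<rho>_def)
  \<comment> \<open>The multiplier lemmas want the bound N at every index, not only on I; hence the
    cut-off.\<close>
  define t where "t m i = (if m \<in> I then m i else 0)" for m :: "'n \<Rightarrow> nat" and i
  have tN: "t m i \<le> N" for m i using bdd by (auto simp: t_def)
  \<comment> \<open>The constant term of the expansion disappears when one of the two points is the
    origin.\<close>
  define nz where "nz m = (if m = (\<lambda>_. 0) then 0 else 1 :: real)" for m :: "'n \<Rightarrow> nat"
  define R where "R m m' = a ^ CARD('n) * (nz m * nz m')
     + (\<Sum>S\<in>{S. 2 \<le> card S}. a ^ card (UNIV - S) * (\<Prod>i\<in>S. r * real (min (t m i) (t m' i))))" for m m'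
  have G: "(\<Prod>i\<in>UNIV. min (grid_coord a r m i) (grid_coord a r m' i)) = A * (\<Sum>i\<in>UNIV. real (min (m i) (m' i))) + R m m'"
    if m: "m \<in> I" "m' \<in> I" for m m'
  proof -
    have Pow: "Pow (UNIV::'n set) = insert {} ((\<lambda>i. {i}) ` UNIV \<union> {S. 2 \<le> card S})"
    proof -
      have "S = {} \<or> (\<exists>i. S = {i}) \<or> 2 \<le> card S" for S :: "'n set"
      proof (cases "card S \<le> 1")
        case True
        then have "card S = 0 \<or> card S = 1" by linarith
        then show ?thesis by (auto simp: card_1_singleton_iff)
      qed simp
      then show ?thesis by auto
    qed
    let ?f = "\<lambda>S. a ^ card (UNIV - S) * (\<Prod>i\<in>S. r * real (min (m i) (m' i)))"
    have sum_eq: "(\<Sum>S\<in>Pow (UNIV::'n set). ?f S) = a ^ CARD('n) + A * (\<Sum>i\<in>UNIV. real (min (m i) (m' i)))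
        + (\<Sum>S\<in>{S. 2 \<le> card S}. ?f S)"
    proof -
      have "(\<Sum>S\<in>Pow (UNIV::'n set). ?f S) = ?f {} + (\<Sum>S\<in>(\<lambda>i. {i}) ` UNIV \<union> {S. 2 \<le> card S}. ?f S)"
        unfolding Pow by (rule sum.insert) auto
      also have "(\<Sum>S\<in>(\<lambda>i. {i}) ` UNIV \<union> {S. 2 \<le> card S}. ?f S)
          = (\<Sum>S\<in>(\<lambda>i. {i}) ` UNIV. ?f S) + (\<Sum>S\<in>{S. 2 \<le> card S}. ?f S)"
        by (rule sum.union_disjoint) auto
      also have "(\<Sum>S\<in>(\<lambda>i. {i}) ` UNIV. ?f S) = (\<Sum>i\<in>UNIV. ?f {i})"
        by (subst sum.reindex) (auto simp: inj_on_def)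
      also have "\<dots> = A * (\<Sum>i\<in>UNIV. real (min (m i) (m' i)))"
        by (simp add: A_def sum_distrib_left card_Diff_singleton mult_ac)
      finally show ?thesis by simp
    qed
    have teq: "t m = m" "t m' = m'" using m by (auto simp: t_def)
    show ?thesis
    proof (cases "m = (\<lambda>_. 0) \<or> m' = (\<lambda>_. 0)")
      case True
      have 0: "min (m i) (m' i) = 0" for i using True by auto
      have "(\<Prod>i\<in>UNIV. min (grid_coord a r m i) (grid_coord a r m' i)) = 0"
        using True pos by (intro prod_zero) (auto simp: grid_coord_def)
      moreover have "R m m' = 0"
      proof -
        have "a ^ card (UNIV - S) * (\<Prod>i\<in>S. r * real (min (m i) (m' i))) = 0" if "2 \<le> card S" for S :: "'n set"
        proof -
          have "S \<noteq> {}" using that by auto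
          then have "(\<Prod>i\<in>S. r * real (min (m i) (m' i))) = 0" by (auto simp: 0 intro!: prod_zero)
          then show ?thesis by simp
        qed
        then have "(\<Sum>S\<in>{S. 2 \<le> card S}. a ^ card (UNIV - S) * (\<Prod>i\<in>S. r * real (min (m i) (m' i)))) = 0"
          by (intro sum.neutral) auto
        then show ?thesis using True unfolding R_def nz_def teq by auto
      qed
      ultimately show ?thesis by (simp add: 0)
    next
      case False
      have "(\<Prod>i\<in>UNIV. min (grid_coord a r m i) (grid_coord a r m' i)) = (\<Prod>i\<in>UNIV. r * real (min (m i) (m' i)) + a)"
        using False pos by (intro prod.cong) (auto simp: grid_coord_def min_def)
      also have "\<dots> = (\<Sum>S\<in>Pow UNIV. (\<Prod>i\<in>S. r * real (min (m i) (m' i))) * (\<Prod>i\<in>UNIV - S. a))"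
        by (rule prod_add) simp
      also have "\<dots> = (\<Sum>S\<in>Pow (UNIV::'n set). ?f S)" by (intro sum.cong) (auto simp: mult.commute)
      also have "\<dots> = A * (\<Sum>i\<in>UNIV. real (min (m i) (m' i))) + R m m'"
        unfolding sum_eq using False by (simp add: R_def nz_def teq)
      finally show ?thesis .
    qed
  qed
  have R: "schur_multiplier I R"
    unfolding R_def
    by (intro schur_multiplier_add schur_multiplier_cmult schur_multiplier_rank_one schur_multiplier_sum
        schur_multiplier_prod schur_multiplier_min[where N=N] tN) (use pos in auto)
  let ?e = "\<lambda>m m' i. (t m i - t m' i) + (t m' i - t m i)"
  define K1 where "K1 m m' = (\<Prod>i\<in>UNIV. \<rho> ^ ?e m m' i)" for m m'
  \<comment> \<open>The exponential of 2 * v * R, normalised by rank-one factors to have diagonal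
    1.\<close>
  define K2 where "K2 m m' = exp (- (v * R m m)) * exp (- (v * R m' m')) * exp (2 * v * R m m')" for m m'
  have kernel: "exp (- (v * grid_dist a r m m')) = K1 m m' * K2 m m'" if m: "m \<in> I" "m' \<in> I" for m m'
  proof -
    have teq: "t m = m" "t m' = m'" using m by (auto simp: t_def)
    have P: "(\<Prod>i\<in>UNIV. grid_coord a r m i) = A * (\<Sum>i\<in>UNIV. real (m i)) + R m m" if "m \<in> I" for m
      using G[OF that that] by simp
    have e: "real (?e m m' i) = real (m i) + real (m' i) - 2 * real (min (m i) (m' i))" for i
      by (simp add: teq min_def of_nat_diff)
    have "v * grid_dist a r m m' = v * A * (\<Sum>i\<in>UNIV. real (?e m m' i)) + v * R m m + v * R m' m' - 2 * v * R m m'"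
      unfolding grid_dist_def G[OF m] P[OF m(1)] P[OF m(2)] e
      by (simp add: sum.distrib sum_subtractf sum_distrib_left[symmetric] algebra_simps)
    moreover have "K1 m m' = exp (- (v * A * (\<Sum>i\<in>UNIV. real (?e m m' i))))"
    proof -
      have "K1 m m' = (\<Prod>i\<in>UNIV. exp (- (v * A * real (?e m m' i))))"
        unfolding K1_def \<rho>_def A_def[symmetric]
        by (intro prod.cong refl) (simp only: exp_of_nat_mult[symmetric], simp only: mult_minus_right mult_minus_left mult_ac)
      also have "\<dots> = exp (\<Sum>i\<in>UNIV. - (v * A * real (?e m m' i)))" by (rule exp_sum[symmetric]) simp
      finally show ?thesis by (simp only: sum_negf sum_distrib_left[symmetric])
    qed
    ultimately show ?thesis by (simp add: K2_def exp_add[symmetric])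
  qed
  have K2: "schur_multiplier I K2"
    unfolding K2_def using pos
    by (intro schur_multiplier_mult schur_multiplier_rank_one schur_multiplier_exp schur_multiplier_cmult R) auto
  have K2_diag: "K2 m m = 1" for m by (simp add: K2_def exp_add[symmetric])
  have K1: "schur_multiplier I (\<lambda>m m'. K1 m m' - (\<Prod>i\<in>UNIV. (1 - \<rho>\<^sup>2) / 4 * (if t m i = t m' i then 1 else 0)))"
    unfolding K1_def
  proof (rule schur_multiplier_prod_minus_prod)
    fix i :: 'n
    show E: "schur_multiplier I (\<lambda>m m'. (1 - \<rho>\<^sup>2) / 4 * (if t m i = t m' i then 1 else 0))"
      using \<rho> by (intro schur_multiplier_cmult schur_multiplier_eq[where N=N] tN) (auto simp: power_le_one)
    show KE: "schur_multiplier I (\<lambda>m m'. \<rho> ^ ?e m m' i - (1 - \<rho>\<^sup>2) / 4 * (if t m i = t m' i then 1 else 0))"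
      by (rule schur_multiplier_geometric_minus_diagonal[where N=N]) (use tN \<rho> in auto)
    show "schur_multiplier I (\<lambda>m m'. \<rho> ^ ?e m m' i)"
      using schur_multiplier_add[OF KE E] by simp
  qed simp
  let ?c = "((1 - \<rho>\<^sup>2) / 4) ^ CARD('n)"
  \<comment> \<open>The subtracted kernel is supported on m = m', where K2 equals 1, so
    multiplication by K2 leaves it unchanged.\<close>
  have "0 \<le> quad_form I (\<lambda>m m'. (K1 m m' - (\<Prod>i\<in>UNIV. (1 - \<rho>\<^sup>2) / 4 * (if t m i = t m' i then 1 else 0))) * K2 m m') w"
    by (intro quad_form_schur_multiplier_nonneg schur_multiplier_mult K1 K2)
  also have "\<dots> = quad_form I (\<lambda>m m'. exp (- (v * grid_dist a r m m')) - (if m = m' then ?c else 0)) w"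
  proof -
    have "(K1 m m' - (\<Prod>i\<in>UNIV. (1 - \<rho>\<^sup>2) / 4 * (if t m i = t m' i then 1 else 0))) * K2 m m'
        = exp (- (v * grid_dist a r m m')) - (if m = m' then ?c else 0)" if m: "m \<in> I" "m' \<in> I" for m m'
    proof -
      have teq: "t m = m" "t m' = m'" using m by (auto simp: t_def)
      have "(\<Prod>i\<in>UNIV. (1 - \<rho>\<^sup>2) / 4 * (if t m i = t m' i then 1 else 0)) = (if m = m' then ?c else 0)"
      proof (cases "m = m'")
        case False
        then obtain i where "m i \<noteq> m' i" by auto
        then have "(\<Prod>i\<in>UNIV. (1 - \<rho>\<^sup>2) / 4 * (if t m i = t m' i then 1 else 0)) = 0"
          by (intro prod_zero) (auto simp: teq)
        then show ?thesis using False by simp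
      qed simp
      then show ?thesis using kernel[OF m] K2_diag by (auto simp: left_diff_distrib)
    qed
    then show ?thesis unfolding quad_form_def by (intro sum.cong) auto
  qed
  also have "\<dots> = quad_form I (\<lambda>m m'. exp (- (v * grid_dist a r m m'))) w - ?c * (\<Sum>m\<in>I. (w m)\<^sup>2)"
  proof -
    have "(\<Sum>m\<in>I. \<Sum>m'\<in>I. w m * w m' * (if m = m' then ?c else 0)) = (\<Sum>m\<in>I. ?c * (w m)\<^sup>2)"
      using \<open>finite I\<close> by (intro sum.cong refl) (simp add: sum.delta' if_distrib[of "(*) _"] power2_eq_square mult_ac cong: if_cong)
    then show ?thesis
      by (simp add: quad_form_def right_diff_distrib sum_subtractf sum_distrib_left[symmetric])
  qed
  finally show ?thesis by simp
qed

section \<open>Multiparameter fractional Brownian motion on dyadic nets\<close>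

definition rect_dist :: "real^'n \<Rightarrow> real^'n \<Rightarrow> real" where
  "rect_dist s t = (\<Prod>i\<in>UNIV. s $ i) + (\<Prod>i\<in>UNIV. t $ i) - 2 * (\<Prod>i\<in>UNIV. min (s $ i) (t $ i))"

lemma measure_lborel_rect:
  fixes t :: "real^'n"
  assumes "0 \<le> t"
  shows "measure lborel {0..t} = (\<Prod>i\<in>UNIV. t $ i)"
proof -
  have "cbox 0 t \<noteq> {}" using assms by (simp add: interval_cbox[symmetric])
  then show ?thesis using content_cbox_cart[of 0 t] by (simp add: interval_cbox)
qed

lemma measure_lborel_sym_diff_rect:
  fixes s t :: "real^'n"
  assumes "0 \<le> s" "0 \<le> t"
  shows "measure lborel (sym_diff {0..s} {0..t}) = rect_dist s t"
proof -
  let ?m = "(\<chi> i. min (s $ i) (t $ i)) :: real^'n"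
  have int: "{0..s} \<inter> {0..t} = {0..?m}" by (auto simp: less_eq_vec_def)
  have m0: "0 \<le> ?m" using assms by (auto simp: less_eq_vec_def)
  have fin: "emeasure lborel {0..x} \<noteq> \<infinity>" for x :: "real^'n"
    unfolding interval_cbox using emeasure_lborel_cbox_finite[of 0 x] by simp
  have meas [measurable]: "{0..x} \<in> sets lborel" for x :: "real^'n" by (simp add: interval_cbox)
  have find: "emeasure lborel ({0..x} - {0..y}) \<noteq> \<infinity>" for x y :: "real^'n"
    using emeasure_mono[of "{0..x} - {0..y}" "{0..x}" lborel] fin[of x] meas[of x] by (auto simp: top_unique)
  have d: "measure lborel ({0..x} - {0..y}) = measure lborel {0..x} - measure lborel ({0..x} \<inter> {0..y})" for x y :: "real^'n"
  proof -
    have "measure lborel ({0..x} - {0..x} \<inter> {0..y}) = measure lborel {0..x} - measure lborel ({0..x} \<inter> {0..y})"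
      by (rule measure_Diff) (use fin[of x] in auto)
    moreover have "{0..x} - {0..x} \<inter> {0..y} = {0..x} - {0..y}" by auto
    ultimately show ?thesis by simp
  qed
  have "measure lborel (sym_diff {0..s} {0..t}) = measure lborel ({0..s} - {0..t}) + measure lborel ({0..t} - {0..s})"
    by (rule measure_Union) (use find in auto)
  also have "\<dots> = measure lborel {0..s} + measure lborel {0..t} - 2 * measure lborel {0..?m}"
    unfolding d by (simp add: int Int_commute[of "{0..t}" "{0..s}"])
  also have "\<dots> = rect_dist s t"
    using assms m0 by (simp add: measure_lborel_rect rect_dist_def)
  finally show ?thesis .
qed

lemma mpfbm_cov_eq:
  fixes s t :: "real^'n"
  assumes "0 \<le> s" "0 \<le> t"
  shows "mpfbm_cov h s t = ((\<Prod>i\<in>UNIV. s $ i) powr (2 * h) + (\<Prod>i\<in>UNIV. t $ i) powr (2 * h) - rect_dist s t powr (2 * h)) / 2"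
  unfolding mpfbm_cov_def using assms by (simp only: measure_lborel_rect measure_lborel_sym_diff_rect)

lemma rect_dist_commute: "rect_dist s t = rect_dist t s"
  by (simp add: rect_dist_def min.commute)

lemma rect_dist_self [simp]: "rect_dist s s = 0"
  by (simp add: rect_dist_def)

lemma prod_min_le:
  fixes s t :: "real^'n"
  assumes "0 \<le> s" "0 \<le> t"
  shows "(\<Prod>i\<in>UNIV. min (s $ i) (t $ i)) \<le> (\<Prod>i\<in>UNIV. s $ i)"
    "(\<Prod>i\<in>UNIV. min (s $ i) (t $ i)) \<le> (\<Prod>i\<in>UNIV. t $ i)" "0 \<le> (\<Prod>i\<in>UNIV. min (s $ i) (t $ i))"
  using assms by (auto intro!: prod_mono prod_nonneg simp: less_eq_vec_def)

lemma rect_dist_nonneg: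
  fixes s t :: "real^'n"
  assumes "0 \<le> s" "0 \<le> t"
  shows "0 \<le> rect_dist s t"
  using prod_min_le[OF assms] by (simp add: rect_dist_def)

lemma rect_dist_diff_le:
  fixes s t :: "real^'n"
  assumes "0 \<le> s" "0 \<le> t"
  shows "\<bar>rect_dist s t - (\<Prod>i\<in>UNIV. s $ i)\<bar> \<le> (\<Prod>i\<in>UNIV. t $ i)"
  using prod_min_le[OF assms] by (simp add: rect_dist_def abs_le_iff)

lemma rect_dist_zero_right:
  fixes s :: "real^'n"
  assumes "0 \<le> s"
  shows "rect_dist s 0 = (\<Prod>i\<in>UNIV. s $ i)"
proof -
  have "min (s $ i) 0 = 0" for i using assms by (simp add: less_eq_vec_def)
  then show ?thesis by (simp add: rect_dist_def power_0_left)
qed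

text \<open>On the unit cube the product is 1-Lipschitz in each coordinate; compare both products
  with that of the minima.\<close>

lemma rect_dist_le_sum:
  fixes s t :: "real^'n"
  assumes "s \<in> {0..vec 1}" "t \<in> {0..vec 1}"
  shows "rect_dist s t \<le> (\<Sum>i\<in>UNIV. \<bar>s $ i - t $ i\<bar>)"
proof -
  have st: "0 \<le> s $ i \<and> s $ i \<le> 1 \<and> 0 \<le> t $ i \<and> t $ i \<le> 1" for i
    using assms by (auto simp: less_eq_vec_def)
  have *: "(\<Prod>i\<in>UNIV. f i) - (\<Prod>i\<in>UNIV. min (s $ i) (t $ i)) \<le> (\<Sum>i\<in>UNIV. \<bar>f i - min (s $ i) (t $ i)\<bar>)"
    if "\<And>i. 0 \<le> f i \<and> f i \<le> 1" for f :: "'n \<Rightarrow> real"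
  proof -
    have "norm ((\<Prod>i\<in>UNIV. f i) - (\<Prod>i\<in>UNIV. min (s $ i) (t $ i))) \<le> (\<Sum>i\<in>UNIV. norm (f i - min (s $ i) (t $ i)))"
    proof (rule norm_prod_diff)
      fix i show "norm (f i) \<le> 1" using that[of i] by simp
      show "norm (min (s $ i) (t $ i)) \<le> 1" using st[of i] by (auto simp: min_def)
    qed
    then show ?thesis by simp
  qed
  have "rect_dist s t \<le> (\<Sum>i\<in>UNIV. \<bar>s $ i - min (s $ i) (t $ i)\<bar>) + (\<Sum>i\<in>UNIV. \<bar>t $ i - min (s $ i) (t $ i)\<bar>)"
    using *[of "\<lambda>i. s $ i"] *[of "\<lambda>i. t $ i"] st by (simp add: rect_dist_def)
  also have "\<dots> = (\<Sum>i\<in>UNIV. \<bar>s $ i - t $ i\<bar>)"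
    unfolding sum.distrib[symmetric] by (intro sum.cong) (auto simp: min_def)
  finally show ?thesis .
qed

lemma rect_dist_scale:
  fixes s t :: "real^'n"
  assumes "0 \<le> r"
  shows "rect_dist (r *\<^sub>R s) (r *\<^sub>R t) = r ^ CARD('n) * rect_dist s t"
proof -
  have "min (r * x) (r * y) = r * min x y" for x y using assms by (simp add: min_mult_distrib_left)
  then show ?thesis by (simp add: rect_dist_def prod.distrib right_diff_distrib distrib_left)
qed

lemma mpfbm_cov_scale:
  fixes s t :: "real^'n" and r h :: real
  assumes "0 < r" "0 \<le> s" "0 \<le> t"
  shows "mpfbm_cov h (r *\<^sub>R s) (r *\<^sub>R t) = (r powr (CARD('n) * h))\<^sup>2 * mpfbm_cov h s t"
proof -
  have 0: "0 \<le> r *\<^sub>R s" "0 \<le> r *\<^sub>R t" using assms by (auto simp: less_eq_vec_def)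
  have e: "(r ^ CARD('n) * x) powr (2 * h) = (r powr (CARD('n) * h))\<^sup>2 * x powr (2 * h)" if "0 \<le> x" for x
  proof -
    have "(r ^ CARD('n)) powr (2 * h) = (r powr (CARD('n) * h))\<^sup>2"
      using assms by (simp add: powr_realpow[symmetric] powr_powr powr_power mult_ac)
    then show ?thesis using assms that by (simp add: powr_mult)
  qed
  have "0 \<le> (\<Prod>i\<in>UNIV. s $ i)" "0 \<le> (\<Prod>i\<in>UNIV. t $ i)"
    using assms by (auto intro!: prod_nonneg simp: less_eq_vec_def)
  then show ?thesis
    using assms 0
    by (simp add: mpfbm_cov_eq rect_dist_scale prod.distrib e rect_dist_nonneg right_diff_distrib distrib_left
        add_divide_distrib diff_divide_distrib)
qed

text \<open>Since 2 * h < 1, powers with this exponent are subadditive, so the powers of the volume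
  of [0, s] and of the symmetric difference differ by at most that of the volume of [0, t]. Only one
  of the two times enters: this makes correlations between distant scales decay.\<close>

lemma abs_mpfbm_cov_le:
  fixes s t :: "real^'n"
  assumes h: "0 < h" "h < 1 / 2" and "0 \<le> s" "0 \<le> t"
  shows "\<bar>mpfbm_cov h s t\<bar> \<le> (\<Prod>i\<in>UNIV. t $ i) powr (2 * h)"
proof -
  have sub: "x powr (2 * h) - y powr (2 * h) \<le> (x - y) powr (2 * h)" if "0 \<le> y" "y \<le> x" for x y :: real
  proof (cases "x = 0")
    case False
    then have x: "x > 0" using that by simp
    have p: "u \<le> u powr (2 * h)" if "0 \<le> u" "u \<le> 1" for u :: real
    proof (cases "u = 0")
      case False
      then show ?thesis using powr_mono'[of "2 * h" 1 u] that h by simp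
    qed simp
    have "1 \<le> (y / x) powr (2 * h) + ((x - y) / x) powr (2 * h)"
      using p[of "y / x"] p[of "(x - y) / x"] that x by (simp add: diff_divide_distrib)
    then have "x powr (2 * h) * 1 \<le> x powr (2 * h) * ((y / x) powr (2 * h) + ((x - y) / x) powr (2 * h))"
      by (intro mult_left_mono) auto
    also have "\<dots> = y powr (2 * h) + (x - y) powr (2 * h)"
      using that x by (simp add: distrib_left powr_divide)
    finally show ?thesis by simp
  qed (use that in simp)
  let ?S = "\<Prod>i\<in>UNIV. s $ i" and ?T = "\<Prod>i\<in>UNIV. t $ i" and ?R = "rect_dist s t"
  have nn: "0 \<le> ?S" "0 \<le> ?T" "0 \<le> ?R"
    using assms by (auto intro!: prod_nonneg rect_dist_nonneg simp: less_eq_vec_def)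
  have "\<bar>?S powr (2 * h) - ?R powr (2 * h)\<bar> \<le> \<bar>?S - ?R\<bar> powr (2 * h)"
  proof (cases "?R \<le> ?S")
    case True
    then have "?R powr (2 * h) \<le> ?S powr (2 * h)" using nn h by (intro powr_mono2) auto
    then show ?thesis using sub[OF nn(3) True] True by simp
  next
    case False
    then have "?S powr (2 * h) \<le> ?R powr (2 * h)" using nn h by (intro powr_mono2) auto
    then show ?thesis using sub[OF nn(1), of ?R] False by simp
  qed
  also have "\<dots> \<le> ?T powr (2 * h)"
    using rect_dist_diff_le[OF assms(3,4)] h by (intro powr_mono2) auto
  finally show ?thesis
    using assms by (simp add: mpfbm_cov_eq abs_le_iff)
qed

section \<open>Dyadic nets of the unit cube\<close>

definition dyadic_point :: "nat \<Rightarrow> ('n \<Rightarrow> nat) \<Rightarrow> real^'n" where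
  "dyadic_point n k = (\<chi> i. real (k i) / 2 ^ n)"

definition dyadic_index :: "nat \<Rightarrow> ('n \<Rightarrow> nat) set" where
  "dyadic_index n = {k. \<forall>i. k i \<le> 2 ^ n}"

definition dyadic_floor :: "nat \<Rightarrow> real^'n \<Rightarrow> 'n \<Rightarrow> nat" where
  "dyadic_floor n t i = nat \<lfloor>2 ^ n * t $ i\<rfloor>"

lemma dyadic_index_eq_PiE: "dyadic_index n = PiE UNIV (\<lambda>_. {..2 ^ n})"
  by (auto simp: dyadic_index_def)

lemma finite_dyadic_index [simp]: "finite (dyadic_index n :: ('n::finite \<Rightarrow> nat) set)"
  unfolding dyadic_index_eq_PiE by (intro finite_PiE) auto

lemma card_dyadic_index: "card (dyadic_index n :: ('n::finite \<Rightarrow> nat) set) = (2 ^ n + 1) ^ CARD('n)"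
  unfolding dyadic_index_eq_PiE by (subst card_PiE) auto

lemma dyadic_point_in_cube: "k \<in> dyadic_index n \<Longrightarrow> dyadic_point n k \<in> {0..vec 1}"
  by (auto simp: dyadic_point_def dyadic_index_def less_eq_vec_def divide_le_eq)

lemma dyadic_point_Suc: "dyadic_point n k = dyadic_point (Suc n) (\<lambda>i. 2 * k i)"
  by (simp add: dyadic_point_def)

lemma dyadic_index_double: "k \<in> dyadic_index n \<Longrightarrow> (\<lambda>i. 2 * k i) \<in> dyadic_index (Suc n)"
  by (simp add: dyadic_index_def)

lemma dyadic_index_half: "k \<in> dyadic_index (Suc n) \<Longrightarrow> (\<lambda>i. k i div 2) \<in> dyadic_index n"
  by (auto simp: dyadic_index_def intro: order_trans[OF div_le_mono])

lemma dyadic_floor_in_index: "t \<in> {0..vec 1} \<Longrightarrow> dyadic_floor n t \<in> dyadic_index n"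
proof -
  assume t: "t \<in> {0..vec 1}"
  have "nat \<lfloor>2 ^ n * t $ i\<rfloor> \<le> 2 ^ n" for i
  proof -
    have "2 ^ n * t $ i \<le> 2 ^ n" using t by (auto simp: less_eq_vec_def)
    then have "\<lfloor>2 ^ n * t $ i\<rfloor> \<le> \<lfloor>(2::real) ^ n\<rfloor>" by (rule floor_mono)
    then show ?thesis by (simp add: nat_le_iff)
  qed
  then show ?thesis by (simp add: dyadic_floor_def dyadic_index_def)
qed

lemma dyadic_floor_tendsto:
  assumes "t \<in> {0..vec 1}"
  shows "(\<lambda>n. dyadic_point n (dyadic_floor n t)) \<longlonglongrightarrow> t"
proof (rule vec_tendstoI)
  fix i
  have t: "0 \<le> t $ i" using assms by (auto simp: less_eq_vec_def)
  have "(\<lambda>n. real (dyadic_floor n t i) / 2 ^ n) \<longlonglongrightarrow> t $ i"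
  proof (rule tendsto_sandwich)
    show "\<forall>\<^sub>F n in sequentially. t $ i - 1 / 2 ^ n \<le> real (dyadic_floor n t i) / 2 ^ n"
    proof (rule always_eventually, rule allI)
      fix n
      have "2 ^ n * t $ i - 1 \<le> real (dyadic_floor n t i)" using t by (simp add: dyadic_floor_def)
      then have "(2 ^ n * t $ i - 1) / 2 ^ n \<le> real (dyadic_floor n t i) / 2 ^ n" by (rule divide_right_mono) simp
      then show "t $ i - 1 / 2 ^ n \<le> real (dyadic_floor n t i) / 2 ^ n" by (simp add: diff_divide_distrib)
    qed
    show "\<forall>\<^sub>F n in sequentially. real (dyadic_floor n t i) / 2 ^ n \<le> t $ i"
    proof (rule always_eventually, rule allI)
      fix n
      have "real (dyadic_floor n t i) \<le> 2 ^ n * t $ i" using t by (simp add: dyadic_floor_def)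
      then show "real (dyadic_floor n t i) / 2 ^ n \<le> t $ i" by (simp add: divide_le_eq mult.commute)
    qed
    show "(\<lambda>n. t $ i - 1 / 2 ^ n) \<longlonglongrightarrow> t $ i" by real_asymp
  qed simp
  then show "(\<lambda>n. dyadic_point n (dyadic_floor n t) $ i) \<longlonglongrightarrow> t $ i" by (simp add: dyadic_point_def)
qed

section \<open>The process: Gaussian families, suprema over dyadic nets, self-similarity\<close>

locale mpfbm_process =
  fixes M :: "'a measure" and h :: real and B :: "real^'n \<Rightarrow> 'a \<Rightarrow> real"
  assumes h: "0 < h" "h < 1 / 2" and mpfbm: "mpfbm M h B"
begin

sublocale prob_space M
  using mpfbm by (simp add: mpfbm_def)

text \<open>The definition of \<open>mpfbm\<close> speaks of combinations over a set of times. Here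
  p may repeat a time, as the parents of neighbouring dyadic points do, so the coefficients of equal
  times are collected first.\<close>

lemma gaussian_linear:
  assumes "finite K" and p: "\<And>k. k \<in> K \<Longrightarrow> 0 \<le> p k"
  shows "centred_gaussian M (\<lambda>\<omega>. \<Sum>k\<in>K. u k * B (p k) \<omega>)"
proof -
  have "(\<Sum>k\<in>K. u k * B (p k) \<omega>) = (\<Sum>t\<in>p ` K. (\<Sum>k\<in>{k\<in>K. p k = t}. u k) * B t \<omega>)" for \<omega>
  proof -
    have "(\<Sum>k\<in>K. u k * B (p k) \<omega>) = (\<Sum>t\<in>p ` K. \<Sum>k\<in>{k\<in>K. p k = t}. u k * B (p k) \<omega>)"
      by (rule sum.image_gen) fact
    also have "\<dots> = (\<Sum>t\<in>p ` K. (\<Sum>k\<in>{k\<in>K. p k = t}. u k) * B t \<omega>)"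
      by (intro sum.cong refl) (simp add: sum_distrib_right)
    finally show ?thesis .
  qed
  moreover have "centred_gaussian M (\<lambda>\<omega>. \<Sum>t\<in>p ` K. (\<Sum>k\<in>{k\<in>K. p k = t}. u k) * B t \<omega>)"
  proof -
    have G: "finite T \<and> T \<subseteq> {0..} \<longrightarrow> centred_gaussian M (\<lambda>\<omega>. \<Sum>t\<in>T. c t * B t \<omega>)" for T c
      using mpfbm by (simp add: mpfbm_def)
    show ?thesis by (rule G[rule_format]) (use assms in auto)
  qed
  ultimately show ?thesis by simp
qed

lemma B_measurable: "0 \<le> t \<Longrightarrow> B t \<in> borel_measurable M"
  using gaussian_linear[of "{()}" "\<lambda>_. t" "\<lambda>_. 1"] by (simp add: centred_gaussian_def)

lemma B_cov: "0 \<le> s \<Longrightarrow> 0 \<le> t \<Longrightarrow> (LINT \<omega>|M. B s \<omega> * B t \<omega>) = mpfbm_cov h s t"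
  using mpfbm by (simp add: mpfbm_def)

lemma B_family:
  assumes "finite K" and p: "\<And>k. k \<in> K \<Longrightarrow> 0 \<le> p k"
  shows "gaussian_family M K (\<lambda>k. B (p k)) (\<lambda>k l. mpfbm_cov h (p k) (p l))"
    and "(LINT \<omega>|M. (\<Sum>k\<in>K. u k * B (p k) \<omega>)\<^sup>2) = quad_form K (\<lambda>k l. mpfbm_cov h (p k) (p l)) u"
  by (rule gaussian_familyI[OF prob_space_axioms assms(1) gaussian_linear[OF assms]]; simp add: B_cov p)+

lemma gaussian_diff:
  assumes "finite K" and p: "\<And>k. k \<in> K \<Longrightarrow> 0 \<le> p k" and q: "\<And>k. k \<in> K \<Longrightarrow> 0 \<le> q k"
  shows "centred_gaussian M (\<lambda>\<omega>. \<Sum>k\<in>K. u k * (B (p k) \<omega> - B (q k) \<omega>))"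
proof -
  let ?r = "\<lambda>z. case z of Inl k \<Rightarrow> p k | Inr k \<Rightarrow> q k" and ?v = "\<lambda>z. case z of Inl k \<Rightarrow> u k | Inr k \<Rightarrow> - u k"
  have "centred_gaussian M (\<lambda>\<omega>. \<Sum>z\<in>K <+> K. ?v z * B (?r z) \<omega>)"
    by (rule gaussian_linear) (use assms in auto)
  then show ?thesis
    using assms(1) by (simp add: sum.Plus right_diff_distrib sum_subtractf sum_negf)
qed

lemma diff_family:
  assumes "finite K" and p: "\<And>k. k \<in> K \<Longrightarrow> 0 \<le> p k" and q: "\<And>k. k \<in> K \<Longrightarrow> 0 \<le> q k"
  shows "gaussian_family M K (\<lambda>k \<omega>. B (p k) \<omega> - B (q k) \<omega>)
    (\<lambda>k l. LINT \<omega>|M. (B (p k) \<omega> - B (q k) \<omega>) * (B (p l) \<omega> - B (q l) \<omega>))"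
  by (rule gaussian_familyI(1)[OF prob_space_axioms assms(1) gaussian_diff[OF assms]]) auto

lemma increment_variance:
  assumes "0 \<le> s" "0 \<le> t"
  shows "(LINT \<omega>|M. (B s \<omega> - B t \<omega>)\<^sup>2) = rect_dist s t powr (2 * h)"
proof -
  let ?p = "\<lambda>b. if b then s else t" and ?u = "\<lambda>b. if b then 1 else -1 :: real"
  have "(LINT \<omega>|M. (B s \<omega> - B t \<omega>)\<^sup>2) = (LINT \<omega>|M. (\<Sum>b\<in>UNIV. ?u b * B (?p b) \<omega>)\<^sup>2)"
    by (simp add: UNIV_bool add.commute)
  also have "\<dots> = quad_form UNIV (\<lambda>k l. mpfbm_cov h (?p k) (?p l)) ?u"
    by (rule B_family(2)) (use assms in auto)
  also have "\<dots> = mpfbm_cov h s s + mpfbm_cov h t t - mpfbm_cov h s t - mpfbm_cov h t s"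
    by (simp add: quad_form_def UNIV_bool)
  also have "\<dots> = rect_dist s t powr (2 * h)"
    using assms h by (simp add: mpfbm_cov_eq rect_dist_commute[of t s] add_divide_distrib diff_divide_distrib)
  finally show ?thesis .
qed

lemma increment_moments:
  assumes "0 \<le> s" "0 \<le> t"
  shows "integrable M (\<lambda>\<omega>. (B s \<omega> - B t \<omega>) ^ j)"
    and "(LINT \<omega>|M. (B s \<omega> - B t \<omega>) ^ (2 * q)) = fact (2 * q) / (2 ^ q * fact q) * (rect_dist s t powr (2 * h)) ^ q"
proof -
  have "centred_gaussian M (\<lambda>\<omega>. B s \<omega> - B t \<omega>)"
    using gaussian_diff[of "{()}" "\<lambda>_. s" "\<lambda>_. t" "\<lambda>_. 1"] assms by simp
  note c = centred_gaussian_moments[OF prob_space_axioms this]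
  show "integrable M (\<lambda>\<omega>. (B s \<omega> - B t \<omega>) ^ j)" by (rule c(1))
  show "(LINT \<omega>|M. (B s \<omega> - B t \<omega>) ^ (2 * q)) = fact (2 * q) / (2 ^ q * fact q) * (rect_dist s t powr (2 * h)) ^ q"
    using c(2)[of q] increment_variance[OF assms] by simp
qed

lemma B_continuous: "\<omega> \<in> space M \<Longrightarrow> continuous_on {0..} (\<lambda>t. B t \<omega>)"
  using mpfbm by (simp add: mpfbm_def)

lemma sup_abs_le_iff:
  assumes "\<omega> \<in> space M" "0 \<le> r"
  shows "sup_abs B r \<omega> \<le> x \<longleftrightarrow> (\<forall>t\<in>{0..vec r}. \<bar>B t \<omega>\<bar> \<le> x)"
proof -
  have "compact ((\<lambda>t. \<bar>B t \<omega>\<bar>) ` {0..vec r})"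
  proof (rule compact_continuous_image)
    have "continuous_on {0..vec r} (\<lambda>t. B t \<omega>)"
      by (rule continuous_on_subset[OF B_continuous[OF assms(1)]]) auto
    then show "continuous_on {0..vec r} (\<lambda>t. \<bar>B t \<omega>\<bar>)" by (intro continuous_intros)
  qed (simp add: interval_cbox)
  then have "bdd_above ((\<lambda>t. \<bar>B t \<omega>\<bar>) ` {0..vec r})"
    by (intro bounded_imp_bdd_above compact_imp_bounded)
  moreover have "{0..vec r :: real^'n} \<noteq> {}" using assms(2) by (auto simp: less_eq_vec_def)
  ultimately show ?thesis unfolding sup_abs_def by (intro cSUP_le_iff)
qed

lemma sup_abs_nonneg: "\<omega> \<in> space M \<Longrightarrow> 0 \<le> r \<Longrightarrow> 0 \<le> sup_abs B r \<omega>"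
proof -
  assume \<omega>: "\<omega> \<in> space M" "0 \<le> r"
  have "0 \<in> {0..vec r :: real^'n}" using \<omega> by (auto simp: less_eq_vec_def)
  then have "\<bar>B 0 \<omega>\<bar> \<le> sup_abs B r \<omega>" using sup_abs_le_iff[OF \<omega>, of "sup_abs B r \<omega>"] by blast
  then show ?thesis by linarith
qed

lemma sup_abs_mono: "\<omega> \<in> space M \<Longrightarrow> 0 \<le> r \<Longrightarrow> r \<le> r' \<Longrightarrow> sup_abs B r \<omega> \<le> sup_abs B r' \<omega>"
proof -
  assume \<omega>: "\<omega> \<in> space M" "0 \<le> r" "r \<le> r'"
  have "{0..vec r} \<subseteq> {0..vec r' :: real^'n}"
    using \<omega> by (auto simp: less_eq_vec_def intro: order_trans)
  then show ?thesis
    using sup_abs_le_iff[OF \<omega>(1), of r "sup_abs B r' \<omega>"] sup_abs_le_iff[OF \<omega>(1), of r' "sup_abs B r' \<omega>"] \<omega> by auto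
qed

text \<open>Path continuity reduces the supremum to countably many times, which yields measurability
  and approximation by finite Gaussian families.\<close>

lemma sup_abs_1_le_iff_dyadic:
  assumes "\<omega> \<in> space M"
  shows "sup_abs B 1 \<omega> \<le> x \<longleftrightarrow> (\<forall>n. \<forall>k\<in>dyadic_index n. \<bar>B (dyadic_point n k) \<omega>\<bar> \<le> x)"
proof (subst sup_abs_le_iff[OF assms], simp, intro iffI allI ballI)
  fix n and k :: "'n \<Rightarrow> nat" assume "\<forall>t\<in>{0..vec 1}. \<bar>B t \<omega>\<bar> \<le> x" "k \<in> dyadic_index n"
  then show "\<bar>B (dyadic_point n k) \<omega>\<bar> \<le> x" using dyadic_point_in_cube by blast
next
  fix t :: "real^'n" assume D: "\<forall>n. \<forall>k\<in>dyadic_index n. \<bar>B (dyadic_point n k) \<omega>\<bar> \<le> x" and t: "t \<in> {0..vec 1}"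
  have "(\<lambda>n. B (dyadic_point n (dyadic_floor n t)) \<omega>) \<longlonglongrightarrow> B t \<omega>"
  proof (rule continuous_on_tendsto_compose[OF B_continuous[OF assms] dyadic_floor_tendsto[OF t]])
    show "t \<in> {0..}" using t by auto
    show "\<forall>\<^sub>F n in sequentially. dyadic_point n (dyadic_floor n t) \<in> {0..}"
      using dyadic_point_in_cube[OF dyadic_floor_in_index[OF t]] by (intro always_eventually) auto
  qed
  then have "(\<lambda>n. \<bar>B (dyadic_point n (dyadic_floor n t)) \<omega>\<bar>) \<longlonglongrightarrow> \<bar>B t \<omega>\<bar>" by (rule tendsto_rabs)
  then show "\<bar>B t \<omega>\<bar> \<le> x"
    by (rule LIMSEQ_le_const2) (use D dyadic_floor_in_index[OF t] in auto)
qed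

lemma dyadic_event_measurable [measurable]:
  "{\<omega>\<in>space M. \<forall>k\<in>dyadic_index n. \<bar>B (dyadic_point n k) \<omega>\<bar> \<le> x} \<in> sets M"
proof -
  have [measurable]: "k \<in> dyadic_index n \<Longrightarrow> B (dyadic_point n k) \<in> borel_measurable M" for k
    using dyadic_point_in_cube[of k n] by (intro B_measurable) auto
  show ?thesis by measurable
qed

lemma sup_abs_1_event:
  "{\<omega>\<in>space M. sup_abs B 1 \<omega> \<le> x} = (\<Inter>n. {\<omega>\<in>space M. \<forall>k\<in>dyadic_index n. \<bar>B (dyadic_point n k) \<omega>\<bar> \<le> x})"
  by (auto simp: sup_abs_1_le_iff_dyadic)

lemma sup_abs_1_event_measurable [measurable]: "{\<omega>\<in>space M. sup_abs B 1 \<omega> \<le> x} \<in> sets M"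
  unfolding sup_abs_1_event by measurable

lemma dyadic_events_decseq:
  "decseq (\<lambda>n. {\<omega>\<in>space M. \<forall>k\<in>dyadic_index n. \<bar>B (dyadic_point n k) \<omega>\<bar> \<le> x})"
proof (rule decseq_SucI, rule subsetI)
  fix n \<omega> assume \<omega>: "\<omega> \<in> {\<omega>\<in>space M. \<forall>k\<in>dyadic_index (Suc n). \<bar>B (dyadic_point (Suc n) k) \<omega>\<bar> \<le> x}"
  have "\<bar>B (dyadic_point n k) \<omega>\<bar> \<le> x" if "k \<in> dyadic_index n" for k
    unfolding dyadic_point_Suc[of n] using \<omega> dyadic_index_double[OF that] by auto
  then show "\<omega> \<in> {\<omega>\<in>space M. \<forall>k\<in>dyadic_index n. \<bar>B (dyadic_point n k) \<omega>\<bar> \<le> x}" using \<omega> by auto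
qed

lemma sup_abs_1_prob_limit:
  "(\<lambda>n. measure M {\<omega>\<in>space M. \<forall>k\<in>dyadic_index n. \<bar>B (dyadic_point n k) \<omega>\<bar> \<le> x})
    \<longlonglongrightarrow> measure M {\<omega>\<in>space M. sup_abs B 1 \<omega> \<le> x}"
  unfolding sup_abs_1_event
  by (rule finite_Lim_measure_decseq) (auto intro: dyadic_events_decseq)

text \<open>The covariance is homogeneous of degree 2 * CARD('n) * h, which the normalisation
  compensates.\<close>

lemma rescaled_mpfbm:
  assumes r: "0 < r"
  shows "mpfbm_process M h (\<lambda>t \<omega>. B (r *\<^sub>R t) \<omega> / r powr (CARD('n) * h))"
proof
  let ?B = "\<lambda>t \<omega>. B (r *\<^sub>R t) \<omega> / r powr (CARD('n) * h)"
  have r0: "0 \<le> t \<Longrightarrow> 0 \<le> r *\<^sub>R t" for t :: "real^'n" using r by (simp add: less_eq_vec_def)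
  show "mpfbm M h ?B"
    unfolding mpfbm_def
  proof (intro conjI allI ballI impI prob_space_axioms)
    fix T :: "(real^'n) set" and c :: "real^'n \<Rightarrow> real" assume T: "finite T \<and> T \<subseteq> {0..}"
    have "centred_gaussian M (\<lambda>\<omega>. \<Sum>t\<in>T. (c t / r powr (CARD('n) * h)) * B (r *\<^sub>R t) \<omega>)"
      using T r0 by (intro gaussian_linear) auto
    then show "centred_gaussian M (\<lambda>\<omega>. \<Sum>t\<in>T. c t * ?B t \<omega>)" by simp
  next
    fix s t :: "real^'n" assume st: "s \<in> {0..}" "t \<in> {0..}"
    have "(LINT \<omega>|M. ?B s \<omega> * ?B t \<omega>) = (LINT \<omega>|M. B (r *\<^sub>R s) \<omega> * B (r *\<^sub>R t) \<omega> / (r powr (CARD('n) * h))\<^sup>2)"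
      by (simp add: power2_eq_square)
    also have "\<dots> = mpfbm_cov h (r *\<^sub>R s) (r *\<^sub>R t) / (r powr (CARD('n) * h))\<^sup>2"
      using B_cov[of "r *\<^sub>R s" "r *\<^sub>R t"] r0 st by simp
    also have "\<dots> = mpfbm_cov h s t" using st r by (simp add: mpfbm_cov_scale)
    finally show "(LINT \<omega>|M. ?B s \<omega> * ?B t \<omega>) = mpfbm_cov h s t" .
  next
    fix \<omega> assume "\<omega> \<in> space M"
    then have "continuous_on {0..} (\<lambda>t. B (r *\<^sub>R t) \<omega>)"
      using r0 by (intro continuous_on_compose2[OF B_continuous]) (auto intro!: continuous_intros)
    then show "continuous_on {0..} (\<lambda>t. ?B t \<omega>)" using r by (intro continuous_intros) auto
  qed
qed (use h in auto)

lemma sup_abs_rescale: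
  assumes r: "0 < r" and \<omega>: "\<omega> \<in> space M"
  shows "sup_abs B r \<omega> = r powr (CARD('n) * h) * sup_abs (\<lambda>t \<omega>. B (r *\<^sub>R t) \<omega> / r powr (CARD('n) * h)) 1 \<omega>"
proof -
  let ?B = "\<lambda>t \<omega>. B (r *\<^sub>R t) \<omega> / r powr (CARD('n) * h)"
  interpret R: mpfbm_process M h ?B by (rule rescaled_mpfbm[OF r])
  have pos: "0 < r powr (CARD('n) * h)" using r by simp
  have "sup_abs B r \<omega> \<le> x \<longleftrightarrow> r powr (CARD('n) * h) * sup_abs ?B 1 \<omega> \<le> x" for x
  proof -
    have img: "{0..vec r :: real^'n} = (\<lambda>t. r *\<^sub>R t) ` {0..vec 1}"
    proof (intro equalityI subsetI)
      fix t :: "real^'n" assume "t \<in> {0..vec r}"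
      then have "(1 / r) *\<^sub>R t \<in> {0..vec 1}" "t = r *\<^sub>R ((1 / r) *\<^sub>R t)"
        using r by (auto simp: less_eq_vec_def divide_le_eq)
      then show "t \<in> (\<lambda>t. r *\<^sub>R t) ` {0..vec 1}" by blast
    next
      fix t :: "real^'n" assume "t \<in> (\<lambda>t. r *\<^sub>R t) ` {0..vec 1}"
      then show "t \<in> {0..vec r}" using r by (auto simp: less_eq_vec_def mult_left_le)
    qed
    have "r powr (CARD('n) * h) * sup_abs ?B 1 \<omega> \<le> x \<longleftrightarrow> sup_abs ?B 1 \<omega> \<le> x / r powr (CARD('n) * h)"
      using pos by (simp add: le_divide_eq mult.commute)
    also have "\<dots> \<longleftrightarrow> (\<forall>t\<in>{0..vec 1}. \<bar>?B t \<omega>\<bar> \<le> x / r powr (CARD('n) * h))"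
      by (rule R.sup_abs_le_iff[OF \<omega>]) simp
    also have "\<dots> \<longleftrightarrow> (\<forall>t\<in>{0..vec 1}. \<bar>B (r *\<^sub>R t) \<omega>\<bar> \<le> x)"
      using pos by (simp add: divide_le_cancel)
    also have "\<dots> \<longleftrightarrow> sup_abs B r \<omega> \<le> x"
      using sup_abs_le_iff[OF \<omega>, of r x] r by (simp add: img)
    finally show ?thesis by simp
  qed
  then show ?thesis by (meson order.refl order_antisym)
qed

end

text \<open>On each finite dyadic net only the covariance matters; then the level tends to
  infinity.\<close>

lemma sup_abs_1_prob_eq:
  fixes B :: "real^'n \<Rightarrow> 'a \<Rightarrow> real" and B' :: "real^'n \<Rightarrow> 'b \<Rightarrow> real"
  assumes B: "mpfbm_process M h B" and B': "mpfbm_process N h B'" and x: "0 < x"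
  shows "measure M {\<omega>\<in>space M. sup_abs B 1 \<omega> \<le> x} = measure N {\<omega>\<in>space N. sup_abs B' 1 \<omega> \<le> x}"
proof -
  interpret B: mpfbm_process M h B by fact
  interpret B': mpfbm_process N h B' by fact
  have p: "0 \<le> dyadic_point n k" if "k \<in> dyadic_index n" for n and k :: "'n \<Rightarrow> nat"
    using dyadic_point_in_cube[OF that] by simp
  have "measure M {\<omega>\<in>space M. \<forall>k\<in>dyadic_index n. \<bar>B (dyadic_point n k) \<omega>\<bar> \<le> x}
      = measure N {\<omega>\<in>space N. \<forall>k\<in>dyadic_index n. \<bar>B' (dyadic_point n k) \<omega>\<bar> \<le> x}" for n
    by (rule box_probability_eq_scaled[OF B.B_family(1) B'.B_family(1)]) (use p x in auto)
  then show ?thesis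
    using B.sup_abs_1_prob_limit[of x] B'.sup_abs_1_prob_limit[of x] LIMSEQ_unique by simp
qed

section \<open>Small balls: upper bound\<close>

text \<open>For indices in \<open>grid_index N\<close>, a grid of mesh 1 / (2 * N) in the cube
  [1/2, 1] ^ CARD('n).\<close>

definition grid_point :: "nat \<Rightarrow> ('n \<Rightarrow> nat) \<Rightarrow> real^'n" where
  "grid_point N m = (\<chi> i. grid_coord (1 / 2) (1 / (2 * real N)) m i)"

definition grid_index :: "nat \<Rightarrow> ('n \<Rightarrow> nat) set" where
  "grid_index N = PiE UNIV (\<lambda>_. {1..N})"

lemma rect_dist_grid_point: "rect_dist (grid_point N m) (grid_point N m') = grid_dist (1 / 2) (1 / (2 * real N)) m m'"
  by (simp add: rect_dist_def grid_dist_def grid_point_def)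

lemma grid_point_in_cube:
  assumes "\<And>i. m i \<le> N"
  shows "grid_point N m \<in> {0..vec 1}"
proof -
  have "1 / 2 + 1 / (2 * real N) * real (m i) \<le> 1" for i
  proof (cases "N = 0")
    case False
    then have "real (m i) / real N \<le> 1" using assms[of i] by simp
    then show ?thesis by simp
  qed simp
  then show ?thesis
    by (auto simp: grid_point_def grid_coord_def less_eq_vec_def)
qed

lemma finite_grid_index [simp]: "finite (grid_index N :: ('n::finite \<Rightarrow> nat) set)"
  unfolding grid_index_def by (intro finite_PiE) auto

lemma grid_index_iff: "m \<in> grid_index N \<longleftrightarrow> (\<forall>i. 1 \<le> m i \<and> m i \<le> N)"
  by (auto simp: grid_index_def PiE_iff)

lemma card_grid_index: "card (grid_index N :: ('n::finite \<Rightarrow> nat) set) = N ^ CARD('n)"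
  unfolding grid_index_def by (subst card_PiE) auto

text \<open>Giving the base point z the weight - sum u I makes all weights add up to 0. The terms d
  i z and d j z are then absorbed into a single quadratic form in d.\<close>

lemma quad_form_power_dist:
  fixes d :: "'i \<Rightarrow> 'i \<Rightarrow> real"
  assumes "finite I" "z \<notin> I" "d z z = 0" and sym: "\<And>i. i \<in> I \<Longrightarrow> d z i = d i z"
  shows "quad_form I (\<lambda>i j. (d i z + d j z - d i j) / 2) u
    = - quad_form (insert z I) d (\<lambda>i. if i = z then - sum u I else u i) / 2"
proof -
  define U where "U = sum u I"
  define W where "W = (\<Sum>j\<in>I. u j * d j z)"
  let ?w = "\<lambda>i. if i = z then - U else u i"
  have wI: "?w i = u i" if "i \<in> I" for i using assms(2) that by auto
  have inner: "(\<Sum>j\<in>insert z I. ?w i * ?w j * d i j) = ?w i * (- U) * d i z + (\<Sum>j\<in>I. ?w i * u j * d i j)" for i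
  proof -
    have "(\<Sum>j\<in>insert z I. ?w i * ?w j * d i j) = ?w i * ?w z * d i z + (\<Sum>j\<in>I. ?w i * ?w j * d i j)"
      using assms(1,2) by (rule sum.insert)
    also have "(\<Sum>j\<in>I. ?w i * ?w j * d i j) = (\<Sum>j\<in>I. ?w i * u j * d i j)"
      by (intro sum.cong refl) (simp only: wI)
    finally show ?thesis by simp
  qed
  have "quad_form (insert z I) d ?w = (\<Sum>j\<in>insert z I. ?w z * ?w j * d z j) + (\<Sum>i\<in>I. \<Sum>j\<in>insert z I. ?w i * ?w j * d i j)"
    unfolding quad_form_def using assms(1,2) by (rule sum.insert)
  also have "(\<Sum>i\<in>I. \<Sum>j\<in>insert z I. ?w i * ?w j * d i j) = (\<Sum>i\<in>I. (- U) * (u i * d i z) + (\<Sum>j\<in>I. u i * u j * d i j))"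
    unfolding inner by (intro sum.cong refl) (simp only: wI mult_ac)
  also have "\<dots> = - (U * W) + (\<Sum>i\<in>I. \<Sum>j\<in>I. u i * u j * d i j)"
    unfolding sum.distrib W_def by (simp only: sum_distrib_left[symmetric]; simp)
  also have "(\<Sum>j\<in>insert z I. ?w z * ?w j * d z j) = (\<Sum>j\<in>I. (- U) * (u j * d j z))"
    unfolding inner using assms(3) sym by (simp add: mult.assoc)
  also have "\<dots> = - (U * W)"
    unfolding W_def by (simp only: sum_distrib_left[symmetric]; simp)
  finally have R: "quad_form (insert z I) d ?w = - (U * W) + (- (U * W) + (\<Sum>i\<in>I. \<Sum>j\<in>I. u i * u j * d i j))" .
  have "quad_form I (\<lambda>i j. (d i z + d j z - d i j) / 2) u
      = ((\<Sum>i\<in>I. \<Sum>j\<in>I. (u i * d i z) * u j) + (\<Sum>i\<in>I. \<Sum>j\<in>I. u i * (u j * d j z)) - (\<Sum>i\<in>I. \<Sum>j\<in>I. u i * u j * d i j)) / 2"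
    unfolding quad_form_def sum.distrib[symmetric] sum_subtractf[symmetric] sum_divide_distrib
    by (intro sum.cong refl) (simp add: algebra_simps)
  also have "(\<Sum>i\<in>I. \<Sum>j\<in>I. (u i * d i z) * u j) = W * U"
    unfolding W_def U_def by (rule sum_product[symmetric])
  also have "(\<Sum>i\<in>I. \<Sum>j\<in>I. u i * (u j * d j z)) = U * W"
    unfolding W_def U_def by (rule sum_product[symmetric])
  finally show ?thesis unfolding U_def[symmetric] R by (simp add: algebra_simps)
qed

text \<open>By the representation of \<open>x powr (2 * h)\<close> through \<open>1 - exp (- v * x)\<close>, the variance of a linear
  combination is an integral over \<open>v\<close> of quadratic forms in \<open>exp (- v * dist)\<close>; the range
  \<open>2 * N \<le> v \<le> 4 * N\<close>, where \<open>v\<close> is inversely proportional to the mesh, already gives the bound.\<close>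

lemma grid_covariance_lower_bound:
  fixes h :: real
  assumes h: "0 < h" "h < 1 / 2"
  obtains c where "0 < c" "\<And>N u. 1 \<le> N \<Longrightarrow>
    c * (1 / (2 * real N)) powr (2 * h) * (\<Sum>m\<in>grid_index N. (u m)\<^sup>2)
      \<le> quad_form (grid_index N) (\<lambda>m m'. mpfbm_cov h (grid_point N m :: real^'n) (grid_point N m')) u"
proof -
  obtain C where C: "C > 0" "\<And>x. x \<ge> 0 \<Longrightarrow> has_bochner_integral lborel
        (\<lambda>v. indicator {0<..} v * ((1 - exp (- (v * x))) * v powr (-(2*h)-1))) (C * x powr (2*h))"
    using powr_Laplace_representation[of "2*h"] h by auto
  define A where "A = (1 / 2 :: real) ^ (CARD('n) - 1)"
  have A: "0 < A" by (simp add: A_def)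
  \<comment> \<open>The diagonal bound at v * r = 1, the left end of the range of v.\<close>
  define c0 where "c0 = ((1 - (exp (- A))\<^sup>2) / 4) ^ CARD('n)"
  have expA: "(exp (- A))\<^sup>2 < 1" using A by (simp add: power_less_one_iff)
  then have c0: "0 < c0" by (simp add: c0_def)
  \<comment> \<open>The length 1 / r of the range of v times the smallest weight (2 / r) powr (- 2 *
    h - 1) is of order r powr (2 * h). The divisor 2 * C comes from the Laplace representation and
    from the 1/2 in the covariance.\<close>
  define c where "c = c0 * 2 powr (-(2*h)-1) / (2 * C)"
  have cpos: "0 < c" using c0 C by (simp add: c_def)
  have "c * (1 / (2 * real N)) powr (2 * h) * (\<Sum>m\<in>grid_index N. (u m)\<^sup>2)
      \<le> quad_form (grid_index N) (\<lambda>m m'. mpfbm_cov h (grid_point N m :: real^'n) (grid_point N m')) u"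
    if N: "1 \<le> N" for N u
  proof -
    define r where "r = 1 / (2 * real N)"
    have r: "0 < r" using N by (simp add: r_def)
    let ?I = "grid_index N :: ('n \<Rightarrow> nat) set"
    let ?z = "(\<lambda>_. 0) :: 'n \<Rightarrow> nat"
    let ?Iz = "insert ?z ?I"
    let ?S = "\<Sum>m\<in>?I. (u m)\<^sup>2"
    let ?w = "\<lambda>m. if m = ?z then - sum u ?I else u m"
    let ?D = "grid_dist (1 / 2) r :: ('n \<Rightarrow> nat) \<Rightarrow> _"
    have zI: "?z \<notin> ?I"
      by (simp add: grid_index_iff)
    have bd: "m i \<le> N" if "m \<in> ?Iz" for m i
      using that by (auto simp: grid_index_iff)
    have cube: "grid_point N m \<in> {0..vec 1 :: real^'n}" if "m \<in> ?Iz" for m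
      by (rule grid_point_in_cube) (rule bd[OF that])
    have pz: "grid_point N ?z = (0 :: real^'n)" by (simp add: grid_point_def grid_coord_def vec_eq_iff)
    have Dge: "0 \<le> ?D m m'" if "m \<in> ?Iz" "m' \<in> ?Iz" for m m'
      using rect_dist_nonneg[of "grid_point N m :: real^'n" "grid_point N m'"] cube[OF that(1)] cube[OF that(2)]
      by (simp add: rect_dist_grid_point r_def)
    have Dsym: "?D m m' = ?D m' m" for m m'
      by (simp add: grid_dist_def min.commute)
    have Dz: "?D m ?z = (\<Prod>i\<in>UNIV. (grid_point N m :: real^'n) $ i)" if "m \<in> ?Iz" for m
      using rect_dist_zero_right[of "grid_point N m :: real^'n"] cube[OF that]
      by (simp add: rect_dist_grid_point[of N m ?z, unfolded pz] r_def)
    have Dzz: "?D ?z ?z = 0" using Dz[of ?z] by (simp add: pz power_0_left)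
    have cov: "mpfbm_cov h (grid_point N m :: real^'n) (grid_point N m')
        = (?D m ?z powr (2*h) + ?D m' ?z powr (2*h) - ?D m m' powr (2*h)) / 2" if "m \<in> ?Iz" "m' \<in> ?Iz" for m m'
      using mpfbm_cov_eq[of "grid_point N m :: real^'n" "grid_point N m'" h] cube[OF that(1)] cube[OF that(2)]
      by (simp add: rect_dist_grid_point Dz[OF that(1), unfolded r_def] Dz[OF that(2), unfolded r_def] r_def)
    have Q: "quad_form ?I (\<lambda>m m'. mpfbm_cov h (grid_point N m :: real^'n) (grid_point N m')) u
        = - quad_form ?Iz (\<lambda>m m'. ?D m m' powr (2*h)) ?w / 2"
    proof -
      have "quad_form ?I (\<lambda>m m'. mpfbm_cov h (grid_point N m :: real^'n) (grid_point N m')) u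
          = quad_form ?I (\<lambda>m m'. (?D m ?z powr (2*h) + ?D m' ?z powr (2*h) - ?D m m' powr (2*h)) / 2) u"
        unfolding quad_form_def by (intro sum.cong refl) (simp add: cov)
      also have "\<dots> = - quad_form ?Iz (\<lambda>m m'. ?D m m' powr (2*h)) ?w / 2"
        by (rule quad_form_power_dist) (use zI Dzz Dsym in auto)
      finally show ?thesis .
    qed
    \<comment> \<open>Hence the 1 in 1 - exp (- v * d) cancels and only the exponential kernel is
      left.\<close>
    have sumw: "(\<Sum>m\<in>?Iz. ?w m) = 0"
    proof -
      have "(\<Sum>m\<in>?Iz. ?w m) = - sum u ?I + (\<Sum>m\<in>?I. ?w m)" using zI by simp
      also have "(\<Sum>m\<in>?I. ?w m) = sum u ?I" by (intro sum.cong) (use zI in auto)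
      finally show ?thesis by simp
    qed
    let ?g = "\<lambda>v. indicator {0<..} v * (quad_form ?Iz (\<lambda>m m'. exp (- (v * ?D m m'))) ?w * v powr (-(2*h)-1))"
    have "has_bochner_integral lborel
        (\<lambda>v. \<Sum>m\<in>?Iz. \<Sum>m'\<in>?Iz. (?w m * ?w m') * (indicator {0<..} v * ((1 - exp (- (v * ?D m m'))) * v powr (-(2*h)-1))))
        (\<Sum>m\<in>?Iz. \<Sum>m'\<in>?Iz. (?w m * ?w m') * (C * ?D m m' powr (2*h)))"
      by (intro has_bochner_integral_sum has_bochner_integral_mult_right C(2) Dge)
    also have "(\<lambda>v. \<Sum>m\<in>?Iz. \<Sum>m'\<in>?Iz. (?w m * ?w m') * (indicator {0<..} v * ((1 - exp (- (v * ?D m m'))) * v powr (-(2*h)-1))))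
        = (\<lambda>v. - ?g v)"
    proof
      fix v :: real
      have "(\<Sum>m\<in>?Iz. \<Sum>m'\<in>?Iz. (?w m * ?w m') * (indicator {0<..} v * ((1 - exp (- (v * ?D m m'))) * v powr (-(2*h)-1))))
          = (\<Sum>m\<in>?Iz. \<Sum>m'\<in>?Iz. ((?w m * ?w m') - ?w m * ?w m' * exp (- (v * ?D m m'))) * (indicator {0<..} v * v powr (-(2*h)-1)))"
        by (intro sum.cong refl) (simp only: right_diff_distrib left_diff_distrib mult_1_right mult_1_left mult_ac)
      also have "\<dots> = ((\<Sum>m\<in>?Iz. \<Sum>m'\<in>?Iz. ?w m * ?w m') - quad_form ?Iz (\<lambda>m m'. exp (- (v * ?D m m'))) ?w) * (indicator {0<..} v * v powr (-(2*h)-1))"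
        unfolding quad_form_def by (simp only: sum_subtractf sum_distrib_right[symmetric])
      also have "(\<Sum>m\<in>?Iz. \<Sum>m'\<in>?Iz. ?w m * ?w m') = 0"
        unfolding sum_product[symmetric] sumw by simp
      finally show "(\<Sum>m\<in>?Iz. \<Sum>m'\<in>?Iz. (?w m * ?w m') * (indicator {0<..} v * ((1 - exp (- (v * ?D m m'))) * v powr (-(2*h)-1)))) = - ?g v"
        by (simp add: mult_ac)
    qed
    also have "(\<Sum>m\<in>?Iz. \<Sum>m'\<in>?Iz. (?w m * ?w m') * (C * ?D m m' powr (2*h))) = C * quad_form ?Iz (\<lambda>m m'. ?D m m' powr (2*h)) ?w"
      unfolding quad_form_def sum_distrib_left by (intro sum.cong refl) (simp only: mult_ac)
    finally have G: "has_bochner_integral lborel (\<lambda>v. - ?g v) (C * quad_form ?Iz (\<lambda>m m'. ?D m m' powr (2*h)) ?w)" .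
    have G': "has_bochner_integral lborel ?g (2 * C * quad_form ?I (\<lambda>m m'. mpfbm_cov h (grid_point N m :: real^'n) (grid_point N m')) u)"
      using has_bochner_integral_minus[OF G] unfolding Q by simp
    have Sw: "?S \<le> (\<Sum>m\<in>?Iz. (?w m)\<^sup>2)"
    proof -
      have "?S = (\<Sum>m\<in>?I. (?w m)\<^sup>2)" by (intro sum.cong) (use zI in auto)
      then show ?thesis using zI by simp
    qed
    have S0: "0 \<le> ?S" by (intro sum_nonneg) auto
    have lower: "((1 - (exp (- (v * (r * A))))\<^sup>2) / 4) ^ CARD('n) * ?S \<le> quad_form ?Iz (\<lambda>m m'. exp (- (v * ?D m m'))) ?w" if v: "v > 0" for v
    proof -
      have "(exp (- (v * (r * A))))\<^sup>2 \<le> 1" using v r A by (intro power_le_one) auto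
      then have "((1 - (exp (- (v * (r * A))))\<^sup>2) / 4) ^ CARD('n) * ?S \<le> ((1 - (exp (- (v * (r * A))))\<^sup>2) / 4) ^ CARD('n) * (\<Sum>m\<in>?Iz. (?w m)\<^sup>2)"
        using Sw by (intro mult_left_mono) auto
      also have "\<dots> \<le> quad_form ?Iz (\<lambda>m m'. exp (- (v * ?D m m'))) ?w"
        unfolding A_def by (rule exp_grid_dist_lower_bound[where N=N]) (use bd r v in auto)
      finally show ?thesis .
    qed
    let ?k = "c0 * ?S * (2 / r) powr (-(2*h)-1)"
    have "1 / r * ?k = (LINT v|lborel. indicator {1/r..2/r} v * ?k)"
      using r by (simp add: field_simps)
    also have "\<dots> \<le> (LINT v|lborel. ?g v)"
    proof (rule integral_mono)
      have "integrable lborel (\<lambda>v. indicator {1/r..2/r} v *\<^sub>R ?k)"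
        using r by (intro integrable_scaleR_left integrable_real_indicator) (auto simp: emeasure_lborel_Icc_eq)
      then show "integrable lborel (\<lambda>v. indicator {1/r..2/r} v * ?k)" by simp
      show "integrable lborel ?g" using G' by (simp add: has_bochner_integral_iff)
      fix v :: real
      show "indicator {1/r..2/r} v * ?k \<le> ?g v"
      proof (cases "v > 0")
        case False
        have "0 < 1 / r" using r by simp
        then have "v \<notin> {1/r..2/r}" unfolding atLeastAtMost_iff using False by linarith
        then show ?thesis using False by simp
      next
        case v: True
        have q0: "0 \<le> quad_form ?Iz (\<lambda>m m'. exp (- (v * ?D m m'))) ?w"
        proof -
          have "(exp (- (v * (r * A))))\<^sup>2 \<le> 1" using v r A by (intro power_le_one) auto
          then have "0 \<le> ((1 - (exp (- (v * (r * A))))\<^sup>2) / 4) ^ CARD('n) * ?S"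
            using S0 by (intro mult_nonneg_nonneg zero_le_power) auto
          then show ?thesis using lower[OF v] by linarith
        qed
        show ?thesis
        proof (cases "v \<in> {1/r..2/r}")
          case False
          then show ?thesis using q0 v by simp
        next
          case True
          then have vr: "1 \<le> v * r" "v \<le> 2 / r" using r by (auto simp: divide_le_eq mult.commute)
          have "A \<le> v * r * A" using mult_right_mono[OF vr(1), of A] A by simp
          then have "(exp (- (v * (r * A))))\<^sup>2 \<le> (exp (- A))\<^sup>2" by (intro power_mono) (auto simp: mult.assoc)
          then have "c0 \<le> ((1 - (exp (- (v * (r * A))))\<^sup>2) / 4) ^ CARD('n)"
            unfolding c0_def using expA by (intro power_mono) auto
          then have "c0 * ?S \<le> quad_form ?Iz (\<lambda>m m'. exp (- (v * ?D m m'))) ?w"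
            using lower[OF v] mult_right_mono[OF _ S0, of c0] by (meson order_trans)
          moreover have "(2 / r) powr (-(2*h)-1) \<le> v powr (-(2*h)-1)"
            using v vr(2) h by (intro powr_mono2') auto
          ultimately have "?k \<le> quad_form ?Iz (\<lambda>m m'. exp (- (v * ?D m m'))) ?w * v powr (-(2*h)-1)"
            using q0 by (intro mult_mono) auto
          then show ?thesis using True v by simp
        qed
      qed
    qed
    also have "\<dots> = 2 * C * quad_form ?I (\<lambda>m m'. mpfbm_cov h (grid_point N m :: real^'n) (grid_point N m')) u"
      using G' by (simp add: has_bochner_integral_iff)
    finally have main: "1 / r * ?k \<le> 2 * C * quad_form ?I (\<lambda>m m'. mpfbm_cov h (grid_point N m :: real^'n) (grid_point N m')) u" .
    have "1 / r * ?k = 2 * C * (c * r powr (2*h) * ?S)"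
    proof -
      have "1 / r * (2 / r) powr (-(2*h)-1) = 2 powr (-(2*h)-1) * (r powr (-1) * r powr (2*h+1))"
        using r by (simp add: powr_divide powr_minus_divide powr_minus[of r 1] powr_diff powr_add field_simps)
      also have "r powr (-1) * r powr (2*h+1) = r powr (2*h)" by (simp only: powr_add[symmetric]) simp
      finally have e: "1 / r * (2 / r) powr (-(2*h)-1) = 2 powr (-(2*h)-1) * r powr (2*h)" .
      have "1 / r * ?k = c0 * ?S * (1 / r * (2 / r) powr (-(2*h)-1))" by simp
      also have "\<dots> = c0 * ?S * (2 powr (-(2*h)-1) * r powr (2*h))" by (simp only: e)
      also have "\<dots> = 2 * C * (c * r powr (2*h) * ?S)" using C(1) by (simp add: c_def)
      finally show ?thesis .
    qed
    then show ?thesis using main C(1) unfolding r_def[symmetric] by simp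
  qed
  then show ?thesis using that cpos by blast
qed

context mpfbm_process
begin

text \<open>Take a grid so coarse that the covariance divided by \<epsilon>^2 dominates A times the
  identity. Each of its N ^ CARD('n) points then costs a factor exp (- 1), with N of order
  \<epsilon> powr (- 1 / h).\<close>

lemma small_ball_upper_bound:
  "\<exists>\<kappa>>0. \<forall>\<^sub>F \<epsilon> in at_right 0. measure M {\<omega>\<in>space M. sup_abs B 1 \<omega> \<le> \<epsilon>} \<le> exp (- \<kappa> / \<epsilon> powr (CARD('n) / h))"
proof -
  obtain c where c: "0 < c" "\<And>N u. 1 \<le> N \<Longrightarrow>
    c * (1 / (2 * real N)) powr (2 * h) * (\<Sum>m\<in>grid_index N. (u m)\<^sup>2)
      \<le> quad_form (grid_index N) (\<lambda>m m'. mpfbm_cov h (grid_point N m :: real^'n) (grid_point N m')) u"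
    by (rule grid_covariance_lower_bound[OF h, where 'n='n], rule that)
  obtain s \<Lambda> where "trapezoid_representation 2 s \<Lambda>" using trapezoid_representation_exists[of 2] by auto
  then interpret trapezoid_representation 2 s \<Lambda> .
  \<comment> \<open>This A makes the price of one variable at most exp (- 1), although \<Lambda> is
    at least 1.\<close>
  have "\<exists>A>0. \<Lambda> * (LINT u|cauchy_law. exp (- (A / 2 * u\<^sup>2))) \<le> exp (- 1)"
  proof -
    have "\<forall>\<^sub>F A in at_top. (LINT u|cauchy_law. exp (- (A * u\<^sup>2))) < exp (- 1) / \<Lambda>"
      using cauchy_law_exp_tendsto_0 by (rule order_tendstoD) (use \<Lambda> in auto)
    then have "\<forall>\<^sub>F A in at_top. (LINT u|cauchy_law. exp (- (A * u\<^sup>2))) < exp (- 1) / \<Lambda> \<and> 0 < A"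
      using eventually_gt_at_top[of 0] by eventually_elim auto
    then have "\<exists>A. (LINT u|cauchy_law. exp (- (A * u\<^sup>2))) < exp (- 1) / \<Lambda> \<and> 0 < A"
      by (rule eventually_happens'[OF trivial_limit_at_top_linorder])
    then obtain A where A: "(LINT u|cauchy_law. exp (- (A * u\<^sup>2))) < exp (- 1) / \<Lambda>" "0 < A"
      by (elim exE conjE)
    have "\<Lambda> * (LINT u|cauchy_law. exp (- (2 * A / 2 * u\<^sup>2))) \<le> exp (- 1)"
      using A(1) \<Lambda> by (simp add: less_divide_eq mult.commute)
    then show ?thesis using A(2) by (intro exI[of _ "2 * A"]) auto
  qed
  then obtain A where A: "0 < A" "\<Lambda> * (LINT u|cauchy_law. exp (- (A / 2 * u\<^sup>2))) \<le> exp (- 1)" by blast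
  \<comment> \<open>Solves c * (b * \<epsilon> powr (1 / h)) powr (2 * h) = A * \<epsilon>^2, so b *
    \<epsilon> powr (1 / h) is the smallest admissible mesh.\<close>
  define b where "b = (A / c) powr (1 / (2 * h))"
  have b: "0 < b" using A c by (simp add: b_def)
  \<comment> \<open>Rounding y = 1 / (2 * b * \<epsilon> powr (1 / h)) down to N loses at most a
    factor 2, and (y / 2) ^ CARD('n) is \<kappa> / \<epsilon> powr (CARD('n) / h).\<close>
  define \<kappa> where "\<kappa> = (1 / (4 * b)) ^ CARD('n)"
  have \<kappa>: "0 < \<kappa>" using b by (simp add: \<kappa>_def)
  have bound: "measure M {\<omega>\<in>space M. sup_abs B 1 \<omega> \<le> \<epsilon>} \<le> exp (- \<kappa> / \<epsilon> powr (CARD('n) / h))"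
    if \<epsilon>: "0 < \<epsilon>" and small: "2 * b * \<epsilon> powr (1 / h) \<le> 1" for \<epsilon>
  proof -
    define y where "y = 1 / (2 * b * \<epsilon> powr (1 / h))"
    have den: "0 < 2 * b * \<epsilon> powr (1 / h)" using b \<epsilon> by simp
    have y: "1 \<le> y" unfolding y_def using small den by simp
    define N where "N = nat \<lfloor>y\<rfloor>"
    have N: "1 \<le> N" "real N \<le> y" "y \<le> 2 * real N"
    proof -
      have f: "1 \<le> \<lfloor>y\<rfloor>" using y by simp
      then have rN: "real N = of_int \<lfloor>y\<rfloor>" by (simp add: N_def)
      show "1 \<le> N" using f by (simp add: N_def le_nat_iff)
      show "real N \<le> y" unfolding rN by simp
      have "(1::real) \<le> of_int \<lfloor>y\<rfloor>" using f by simp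
      then show "y \<le> 2 * real N" unfolding rN using floor_correct[of y] by linarith
    qed
    let ?r = "1 / (2 * real N)"
    have r: "b * \<epsilon> powr (1 / h) \<le> ?r"
    proof -
      have "real N * (2 * b * \<epsilon> powr (1 / h)) \<le> 1"
        using N(2) den unfolding y_def by (simp add: le_divide_eq)
      then show ?thesis using N(1) by (simp add: le_divide_eq mult_ac)
    qed
    have "A * \<epsilon>\<^sup>2 \<le> c * ?r powr (2 * h)"
    proof -
      have "A / c * \<epsilon>\<^sup>2 = (b * \<epsilon> powr (1 / h)) powr (2 * h)"
        using A c \<epsilon> h b by (simp add: b_def powr_mult powr_powr powr_numeral)
      also have "\<dots> \<le> ?r powr (2 * h)" using r h b \<epsilon> by (intro powr_mono2) auto
      finally show ?thesis using c by (simp add: field_simps)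
    qed
    then have AQ: "A \<le> c * ?r powr (2 * h) / \<epsilon>\<^sup>2" using \<epsilon> by (simp add: le_divide_eq)
    let ?I = "grid_index N :: ('n \<Rightarrow> nat) set"
    have cube: "grid_point N m \<in> {0..vec 1 :: real^'n}" if "m \<in> ?I" for m
      by (rule grid_point_in_cube) (use that in \<open>auto simp: grid_index_iff\<close>)
    have p0: "0 \<le> (grid_point N m :: real^'n)" if "m \<in> ?I" for m using cube[OF that] by simp
    have fam: "gaussian_family M ?I (\<lambda>m \<omega>. 1 / \<epsilon> * B (grid_point N m) \<omega>)
        (\<lambda>m m'. 1 / \<epsilon> * (1 / \<epsilon>) * mpfbm_cov h (grid_point N m) (grid_point N m'))"
      by (rule gaussian_family_scale[OF B_family(1)]) (use p0 in auto)
    have "measure M {\<omega>\<in>space M. sup_abs B 1 \<omega> \<le> \<epsilon>} \<le> measure M {\<omega>\<in>space M. \<forall>m\<in>?I. \<bar>1 / \<epsilon> * B (grid_point N m) \<omega>\<bar> \<le> 1}"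
    proof (rule finite_measure_mono)
      have [measurable]: "m \<in> ?I \<Longrightarrow> B (grid_point N m) \<in> borel_measurable M" for m
        using p0 by (rule B_measurable)
      show "{\<omega>\<in>space M. \<forall>m\<in>?I. \<bar>1 / \<epsilon> * B (grid_point N m) \<omega>\<bar> \<le> 1} \<in> sets M" by measurable
      show "{\<omega>\<in>space M. sup_abs B 1 \<omega> \<le> \<epsilon>} \<subseteq> {\<omega>\<in>space M. \<forall>m\<in>?I. \<bar>1 / \<epsilon> * B (grid_point N m) \<omega>\<bar> \<le> 1}"
        using cube \<epsilon> by (auto simp: sup_abs_le_iff divide_le_eq)
    qed
    also have "\<dots> \<le> (\<Lambda> * (LINT u|cauchy_law. exp (- (A / 2 * u\<^sup>2)))) ^ card ?I"
    proof (rule box_probability_le[OF fam])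
      fix u :: "('n \<Rightarrow> nat) \<Rightarrow> real"
      have "A * (\<Sum>m\<in>?I. (u m)\<^sup>2) \<le> c * ?r powr (2 * h) / \<epsilon>\<^sup>2 * (\<Sum>m\<in>?I. (u m)\<^sup>2)"
        using AQ by (intro mult_right_mono) (auto intro: sum_nonneg)
      also have "\<dots> = 1 / \<epsilon>\<^sup>2 * (c * ?r powr (2 * h) * (\<Sum>m\<in>?I. (u m)\<^sup>2))" by simp
      also have "\<dots> \<le> 1 / \<epsilon>\<^sup>2 * quad_form ?I (\<lambda>m m'. mpfbm_cov h (grid_point N m :: real^'n) (grid_point N m')) u"
        by (intro mult_left_mono c(2) N(1)) simp
      also have "\<dots> = quad_form ?I (\<lambda>m m'. 1 / \<epsilon> * (1 / \<epsilon>) * mpfbm_cov h (grid_point N m :: real^'n) (grid_point N m')) u"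
        unfolding quad_form_def sum_distrib_left by (intro sum.cong refl) (simp add: power2_eq_square)
      finally show "A * (\<Sum>m\<in>?I. (u m)\<^sup>2) \<le> quad_form ?I (\<lambda>m m'. 1 / \<epsilon> * (1 / \<epsilon>) * mpfbm_cov h (grid_point N m :: real^'n) (grid_point N m')) u" .
    qed (use A in auto)
    also have "\<dots> \<le> exp (- 1) ^ card ?I"
      using A \<Lambda> by (intro power_mono mult_nonneg_nonneg integral_nonneg_AE) auto
    also have "\<dots> = exp (- (real N ^ CARD('n)))"
      by (simp add: card_grid_index exp_of_nat_mult[symmetric])
    also have "\<dots> \<le> exp (- \<kappa> / \<epsilon> powr (CARD('n) / h))"
    proof -
      have "(y / 2) ^ CARD('n) \<le> real N ^ CARD('n)" using N y by (intro power_mono) auto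
      moreover have "(y / 2) ^ CARD('n) = \<kappa> / \<epsilon> powr (CARD('n) / h)"
      proof -
        have "y / 2 = 1 / (4 * b) * (1 / \<epsilon> powr (1 / h))" by (simp add: y_def)
        moreover have "(1 / \<epsilon> powr (1 / h)) ^ CARD('n) = 1 / \<epsilon> powr (CARD('n) / h)"
          using \<epsilon> by (simp add: power_divide powr_power)
        ultimately show ?thesis by (simp add: \<kappa>_def power_mult_distrib power_divide)
      qed
      ultimately show ?thesis by simp
    qed
    finally show ?thesis .
  qed
  have "((\<lambda>\<epsilon>. 2 * b * \<epsilon> powr (1 / h)) \<longlongrightarrow> 0) (at_right 0)"
    using h by real_asymp
  then have "\<forall>\<^sub>F \<epsilon> in at_right 0. 2 * b * \<epsilon> powr (1 / h) < 1" by (rule order_tendstoD) simp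
  then have "\<forall>\<^sub>F \<epsilon> in at_right 0. measure M {\<omega>\<in>space M. sup_abs B 1 \<omega> \<le> \<epsilon>} \<le> exp (- \<kappa> / \<epsilon> powr (CARD('n) / h))"
    using eventually_at_right_less[of "0::real"] by eventually_elim (rule bound, auto)
  then show ?thesis using \<kappa> by blast
qed

end

section \<open>Small balls: lower bound\<close>

text \<open>At level 0 the parent is the origin, where the process vanishes almost surely, so
  increments from the parents recover the values.\<close>

definition dyadic_parent :: "nat \<Rightarrow> ('n \<Rightarrow> nat) \<Rightarrow> real^'n" where
  "dyadic_parent n k = (case n of 0 \<Rightarrow> 0 | Suc j \<Rightarrow> dyadic_point j (\<lambda>i. k i div 2))"

lemma dyadic_parent_in_cube: "k \<in> dyadic_index n \<Longrightarrow> dyadic_parent n k \<in> {0..vec 1}"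
proof (cases n)
  case (Suc j)
  assume "k \<in> dyadic_index n"
  then show ?thesis using Suc dyadic_point_in_cube[OF dyadic_index_half[of k j]] by (simp add: dyadic_parent_def)
qed (simp add: dyadic_parent_def less_eq_vec_def)

lemma rect_dist_dyadic_parent:
  fixes k :: "'n::finite \<Rightarrow> nat"
  assumes "k \<in> dyadic_index n"
  shows "rect_dist (dyadic_point n k) (dyadic_parent n k) \<le> CARD('n) / 2 ^ n"
proof -
  have "\<bar>dyadic_point n k $ i - dyadic_parent n k $ i\<bar> \<le> 1 / 2 ^ n" for i
  proof (cases n)
    case 0
    then show ?thesis using assms by (auto simp: dyadic_point_def dyadic_parent_def dyadic_index_def)
  next
    case (Suc j)
    have "real (k i) = 2 * real (k i div 2) + real (k i mod 2)"
      using mult_div_mod_eq[of 2 "k i"] by (metis of_nat_add of_nat_mult of_nat_numeral)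
    then have "dyadic_point n k $ i - dyadic_parent n k $ i = real (k i mod 2) / 2 ^ n"
      using Suc by (simp add: dyadic_point_def dyadic_parent_def field_simps)
    also have "\<bar>\<dots>\<bar> \<le> 1 / 2 ^ n" by (simp add: divide_le_cancel)
    finally show ?thesis .
  qed
  then have "(\<Sum>i\<in>UNIV. \<bar>dyadic_point n k $ i - dyadic_parent n k $ i\<bar>) \<le> (\<Sum>i\<in>(UNIV::'n set). 1 / 2 ^ n)"
    by (intro sum_mono)
  then show ?thesis
    using rect_dist_le_sum[OF dyadic_point_in_cube[OF assms] dyadic_parent_in_cube[OF assms]] by simp
qed

text \<open>Each distance from n0 occurs at most once on either side.\<close>

lemma sum_abs_distance_le:
  fixes g :: "nat \<Rightarrow> real"
  assumes g: "summable g" "\<And>d. 0 \<le> g d"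
  shows "(\<Sum>n\<le>n1. g (if n \<le> n0 then n0 - n else n - n0)) \<le> 2 * suminf g"
proof -
  let ?f = "\<lambda>n. g (if n \<le> n0 then n0 - n else n - n0)"
  have "(\<Sum>n\<le>n1. ?f n) = (\<Sum>n\<in>{..n1} \<inter> {..n0}. ?f n) + (\<Sum>n\<in>{..n1} - {..n0}. ?f n)"
    by (rule sum.Int_Diff) simp
  also have "(\<Sum>n\<in>{..n1} \<inter> {..n0}. ?f n) \<le> (\<Sum>n\<in>{..n0}. ?f n)"
    using g(2) by (intro sum_mono2) auto
  also have "(\<Sum>n\<in>{..n0}. ?f n) = (\<Sum>d\<in>{..n0}. g d)"
    by (rule sum.reindex_bij_witness[of _ "\<lambda>d. n0 - d" "\<lambda>d. n0 - d"]) auto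
  also have "\<dots> \<le> suminf g" using g by (intro sum_le_suminf) auto
  also have "(\<Sum>n\<in>{..n1} - {..n0}. ?f n) = (\<Sum>d\<in>(\<lambda>n. n - n0) ` ({..n1} - {..n0}). g d)"
    by (subst sum.reindex) (auto simp: inj_on_def intro!: sum.cong)
  also have "\<dots> \<le> suminf g" using g by (intro sum_le_suminf) auto
  finally show ?thesis by simp
qed

context mpfbm_process
begin

lemma dyadic_increment_moment:
  assumes k: "k \<in> dyadic_index n"
  shows "integrable M (\<lambda>\<omega>. (B (dyadic_point n k) \<omega> - B (dyadic_parent n k) \<omega>) ^ j)"
    and "(LINT \<omega>|M. (B (dyadic_point n k) \<omega> - B (dyadic_parent n k) \<omega>) ^ (2 * q))
      \<le> fact (2 * q) / (2 ^ q * fact q) * ((CARD('n) / 2 ^ n) powr (2 * h)) ^ q"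
proof -
  have p: "0 \<le> dyadic_point n k" "0 \<le> dyadic_parent n k"
    using dyadic_point_in_cube[OF k] dyadic_parent_in_cube[OF k] by auto
  show "integrable M (\<lambda>\<omega>. (B (dyadic_point n k) \<omega> - B (dyadic_parent n k) \<omega>) ^ j)"
    by (rule increment_moments(1)[OF p])
  show "(LINT \<omega>|M. (B (dyadic_point n k) \<omega> - B (dyadic_parent n k) \<omega>) ^ (2 * q))
      \<le> fact (2 * q) / (2 ^ q * fact q) * ((CARD('n) / 2 ^ n) powr (2 * h)) ^ q"
    unfolding increment_moments(2)[OF p]
    using rect_dist_dyadic_parent[OF k] rect_dist_nonneg[OF p] h
    by (intro mult_left_mono power_mono powr_mono2) auto
qed

lemma dyadic_increment_measurable:
  "k \<in> dyadic_index n \<Longrightarrow> (\<lambda>\<omega>. B (dyadic_point n k) \<omega> - B (dyadic_parent n k) \<omega>) \<in> borel_measurable M"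
  using borel_measurable_integrable[OF dyadic_increment_moment(1)[of k n 1]] by simp

text \<open>A finer dyadic point is reached from level m through its successive ancestors; a coarser
  one already belongs to the net of level m.\<close>

lemma sup_abs_chaining:
  assumes \<omega>: "\<omega> \<in> space M"
    and start: "\<And>k. k \<in> dyadic_index m \<Longrightarrow> \<bar>B (dyadic_point m k) \<omega>\<bar> \<le> x"
    and incr: "\<And>n k. m < n \<Longrightarrow> k \<in> dyadic_index n \<Longrightarrow> \<bar>B (dyadic_point n k) \<omega> - B (dyadic_parent n k) \<omega>\<bar> \<le> b n"
    and S: "\<And>n. (\<Sum>j\<in>{m<..n}. b j) \<le> S"
  shows "sup_abs B 1 \<omega> \<le> x + S"
proof -
  have fine: "\<bar>B (dyadic_point n k) \<omega>\<bar> \<le> x + (\<Sum>j\<in>{m<..n}. b j)" if "m \<le> n" "k \<in> dyadic_index n" for n k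
    using that
  proof (induction n arbitrary: k rule: dec_induct)
    case base
    then show ?case using start by simp
  next
    case (step n)
    have p: "dyadic_parent (Suc n) k = dyadic_point n (\<lambda>i. k i div 2)" by (simp add: dyadic_parent_def)
    have "\<bar>B (dyadic_point n (\<lambda>i. k i div 2)) \<omega>\<bar> \<le> x + (\<Sum>j\<in>{m<..n}. b j)"
      by (rule step.IH[OF dyadic_index_half[OF step.prems]])
    moreover have "\<bar>B (dyadic_point (Suc n) k) \<omega> - B (dyadic_point n (\<lambda>i. k i div 2)) \<omega>\<bar> \<le> b (Suc n)"
      using incr[of "Suc n" k] step unfolding p by simp
    moreover have "(\<Sum>j\<in>{m<..Suc n}. b j) = b (Suc n) + (\<Sum>j\<in>{m<..n}. b j)"
    proof -
      have "{m<..Suc n} = insert (Suc n) {m<..n}" using step by auto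
      then show ?thesis by simp
    qed
    ultimately show ?case by linarith
  qed
  have all: "\<bar>B (dyadic_point n k) \<omega>\<bar> \<le> x + S" if k: "k \<in> dyadic_index n" for n k
  proof (cases "m \<le> n")
    case True
    then show ?thesis using fine[OF True k] S[of n] by linarith
  next
    case False
    have "\<forall>k\<in>dyadic_index m. \<bar>B (dyadic_point m k) \<omega>\<bar> \<le> x + S"
      using start S[of m] by force
    moreover have "{\<omega>\<in>space M. \<forall>k\<in>dyadic_index m. \<bar>B (dyadic_point m k) \<omega>\<bar> \<le> x + S}
        \<subseteq> {\<omega>\<in>space M. \<forall>k\<in>dyadic_index n. \<bar>B (dyadic_point n k) \<omega>\<bar> \<le> x + S}"
      using decseqD[OF dyadic_events_decseq, of n m] False by simp
    ultimately have "\<omega> \<in> {\<omega>\<in>space M. \<forall>k\<in>dyadic_index n. \<bar>B (dyadic_point n k) \<omega>\<bar> \<le> x + S}"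
      using \<omega> by blast
    then show ?thesis using k by blast
  qed
  then show ?thesis by (simp add: sup_abs_1_le_iff_dyadic[OF \<omega>])
qed

lemma B_0: "AE \<omega> in M. B 0 \<omega> = 0"
proof -
  have int: "integrable M (\<lambda>\<omega>. (B 0 \<omega>)\<^sup>2)"
  proof -
    have "centred_gaussian M (\<lambda>\<omega>. B 0 \<omega>)" using gaussian_linear[of "{()}" "\<lambda>_. 0" "\<lambda>_. 1"] by simp
    then show ?thesis by (rule centred_gaussian_moments(1)[OF prob_space_axioms])
  qed
  have "(LINT \<omega>|M. (B 0 \<omega>)\<^sup>2) = mpfbm_cov h 0 (0 :: real^'n)"
    using B_cov[of 0 0] by (simp add: power2_eq_square)
  also have "\<dots> = 0" by (simp add: mpfbm_cov_eq power_0_left)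
  finally have "AE \<omega> in M. (B 0 \<omega>)\<^sup>2 = 0"
    using integral_nonneg_eq_0_iff_AE[OF int] by simp
  then show ?thesis by simp
qed

end

text \<open>If |x| < 1/2 the rounding is 0; otherwise 2 * |x| is at least 1 and any power of it is
  larger. So an expected rounding is controlled by moments of any order, and is very small when x is
  typically small.\<close>

lemma abs_round_le_power:
  fixes x :: real
  assumes "1 \<le> p"
  shows "real_of_int \<bar>round x\<bar> \<le> (2 * \<bar>x\<bar>) ^ p"
proof (cases "\<bar>x\<bar> < 1 / 2")
  case True
  then have "round x = 0" by (intro round_unique') simp
  then show ?thesis by simp
next
  case False
  then have 1: "1 \<le> 2 * \<bar>x\<bar>" by simp
  have "real_of_int \<bar>round x\<bar> \<le> \<bar>x\<bar> + 1 / 2"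
    using of_int_round_abs_le[of x] by linarith
  also have "\<dots> \<le> 2 * \<bar>x\<bar>" using 1 by linarith
  also have "\<dots> \<le> (2 * \<bar>x\<bar>) ^ p" using 1 assms self_le_power by fastforce
  finally show ?thesis .
qed

text \<open>Cost of coding an increment \<open>d\<close> levels below, respectively above, the critical level: the
  expected rounded increment is at most \<open>4 * R\<close> with \<open>R\<close> large, respectively at most \<open>K * \<theta>\<close> with
  \<open>\<theta>\<close> small.\<close>

lemma coarse_code_length:
  fixes R E :: real
  assumes "1 \<le> R" "E \<le> 4 * R" "0 \<le> E"
  shows "ln ((1 + (1 - 1 / (2 * R))) / (1 - (1 - 1 / (2 * R)))) + ln (1 / (1 - 1 / (2 * R))) * E \<le> 6 + ln R"
proof -
  have R: "0 < R" using assms by simp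
  have inv: "1 / (2 * R) \<le> 1 / 2" "0 < 1 / (2 * R)" using assms by (auto simp: field_simps)
  have "(1 + (1 - 1 / (2 * R))) / (1 - (1 - 1 / (2 * R))) \<le> 4 * R"
    using R by (simp add: field_simps)
  moreover have "0 < (1 + (1 - 1 / (2 * R))) / (1 - (1 - 1 / (2 * R)))"
    using inv by (intro divide_pos_pos) linarith+
  ultimately have "ln ((1 + (1 - 1 / (2 * R))) / (1 - (1 - 1 / (2 * R)))) \<le> ln (4 * R)"
    by (intro ln_mono)
  also have "\<dots> = ln 4 + ln R" using R by (simp add: ln_mult)
  also have "ln (4::real) \<le> 2" using ln_add_one_self_le_self[of 1] ln_realpow[of 2 2] by simp
  finally have 1: "ln ((1 + (1 - 1 / (2 * R))) / (1 - (1 - 1 / (2 * R)))) \<le> 2 + ln R" by simp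
  have "ln (1 / (1 - 1 / (2 * R))) \<le> 1 / (1 - 1 / (2 * R)) - 1"
    using inv by (intro ln_le_minus_one) auto
  also have "\<dots> \<le> 1 / R"
  proof -
    have "1 / (1 - 1 / (2 * R)) - 1 = 1 / (2 * R - 1)" using R inv assms(1) by (simp add: field_simps)
    also have "\<dots> \<le> 1 / R" using assms(1) by (intro divide_left_mono mult_pos_pos) auto
    finally show ?thesis .
  qed
  finally have "ln (1 / (1 - 1 / (2 * R))) * E \<le> 1 / R * (4 * R)"
    using assms R by (intro mult_mono) auto
  also have "\<dots> = 4" using R by simp
  finally show ?thesis using 1 by simp
qed

lemma fine_code_length:
  fixes \<theta> E K :: real
  assumes "0 < \<theta>" "\<theta> \<le> 1 / 2" "E \<le> K * \<theta>" "0 \<le> E"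
  shows "ln ((1 + \<theta>) / (1 - \<theta>)) + ln (1 / \<theta>) * E \<le> (4 + ln (1 / \<theta>) * K) * \<theta>"
proof -
  have "ln ((1 + \<theta>) / (1 - \<theta>)) \<le> (1 + \<theta>) / (1 - \<theta>) - 1"
    using assms by (intro ln_le_minus_one) auto
  also have "\<dots> = 2 * \<theta> / (1 - \<theta>)" using assms by (simp add: field_simps)
  also have "\<dots> \<le> 2 * \<theta> / (1 / 2)" using assms by (intro divide_left_mono) auto
  finally have 1: "ln ((1 + \<theta>) / (1 - \<theta>)) \<le> 4 * \<theta>" by simp
  have "0 \<le> ln (1 / \<theta>)" using assms by (intro ln_ge_zero) auto
  then have "ln (1 / \<theta>) * E \<le> ln (1 / \<theta>) * (K * \<theta>)" using assms by (intro mult_left_mono) auto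
  then show ?thesis using 1 by (simp add: algebra_simps)
qed

context mpfbm_process
begin

text \<open>The critical level n0 is the one whose increments have size comparable with the radius.
  The tolerances decay geometrically away from n0, so they add up to the order of 2 powr (- n0 * h),
  while the coding cost of level n is at most 2 ^ (n0 * \<nu>) times a summable function of the
  distance to n0.\<close>

lemma small_ball_lower_bound_dyadic:
  obtains Ca CL where "0 < Ca" "0 < CL" "\<And>n0. exp (- CL * (2 ^ n0) ^ CARD('n)) / 4
    \<le> measure M {\<omega>\<in>space M. sup_abs B 1 \<omega> \<le> Ca * 2 powr (- (n0 * h))}"
proof -
  define \<nu> where "\<nu> = CARD('n)"
  have \<nu>: "1 \<le> \<nu>" by (simp add: \<nu>_def Suc_le_eq)
  \<comment> \<open>Makes the 2 * q-th moments on level n0 + d at most of order 2 ^ (- d * (\<nu> +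
    1)), which beats the factor 2 ^ (d * \<nu>) in the number of points.\<close>
  define q where "q = nat \<lceil>(\<nu> + 1) / h\<rceil>"
  have q: "real (\<nu> + 1) \<le> q * h" "1 \<le> q"
  proof -
    have pos: "0 < (\<nu> + 1) / h" using h by simp
    have "(\<nu> + 1) / h \<le> q" unfolding q_def by linarith
    then show "real (\<nu> + 1) \<le> q * h" using h by (simp add: divide_le_eq)
    then show "1 \<le> q" by (cases q) auto
  qed
  \<comment> \<open>The factor 4 ^ q from (2 * |x|) ^ (2 * q), times the Gaussian moment
    constant.\<close>
  define K where "K = 4 ^ q * (fact (2 * q) / (2 ^ q * fact q) :: real)"
  have K: "0 < K" by (simp add: K_def)
  define dist where "dist n0 n = (if n \<le> n0 then n0 - n else n - n0)" for n0 n :: nat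
  \<comment> \<open>The exponent h / 2 is a compromise: the tolerances are summable, yet on fine
    levels they still exceed the standard deviation by a growing factor.\<close>
  define a where "a n0 n = \<nu> powr h * 2 powr (- (n0 * h)) * 2 powr (- (dist n0 n * h / 2))" for n0 n
  have a: "0 < a n0 n" for n0 n using \<nu> by (simp add: a_def)
  define Y where "Y n k \<omega> = B (dyadic_point n k) \<omega> - B (dyadic_parent n k) \<omega>" for n k \<omega>
  have Ym: "k \<in> dyadic_index n \<Longrightarrow> Y n k \<in> borel_measurable M" for n k
    unfolding Y_def[abs_def] by (rule dyadic_increment_measurable)
  \<comment> \<open>The bound for the variance of an increment divided by the squared tolerance:
    large on coarse levels, small on fine ones.\<close>
  define R where "R n0 n = (if n \<le> n0 then 2 powr (3 * dist n0 n * h) else 2 powr (- (dist n0 n * h)))" for n0 n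
  have ratio: "(\<nu> / 2 ^ n) powr (2 * h) / (a n0 n)\<^sup>2 = R n0 n" for n0 n
  proof -
    have "(\<nu> / 2 ^ n) powr (2 * h) = \<nu> powr (2 * h) * 2 powr (- (2 * n * h))"
      using \<nu> by (simp add: powr_divide powr_realpow[symmetric] powr_powr powr_minus_divide mult_ac)
    moreover have "(a n0 n)\<^sup>2 = \<nu> powr (2 * h) * 2 powr (- (2 * n0 * h) - dist n0 n * h)"
    proof -
      have sq: "(x powr e)\<^sup>2 = x powr (2 * e)" for x e :: real
        by (simp add: power2_eq_square powr_add[symmetric])
      show ?thesis by (simp add: a_def power_mult_distrib sq powr_add[symmetric] mult_ac)
    qed
    ultimately have "(\<nu> / 2 ^ n) powr (2 * h) / (a n0 n)\<^sup>2 = 2 powr (- (2 * n * h)) / 2 powr (- (2 * n0 * h) - dist n0 n * h)"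
      using \<nu> by simp
    also have "\<dots> = 2 powr (2 * n0 * h - 2 * n * h + dist n0 n * h)"
      by (simp add: powr_diff[symmetric] algebra_simps)
    also have "\<dots> = R n0 n"
      by (auto simp: R_def dist_def of_nat_diff algebra_simps)
    finally show ?thesis .
  qed
  have round_int: "integrable M (\<lambda>\<omega>. real_of_int \<bar>round (Y n k \<omega> / a n0 n)\<bar>)"
    and round_E: "1 \<le> p \<Longrightarrow> (LINT \<omega>|M. real_of_int \<bar>round (Y n k \<omega> / a n0 n)\<bar>) \<le> 4 ^ p * (fact (2 * p) / (2 ^ p * fact p)) * R n0 n ^ p"
    if k: "k \<in> dyadic_index n" for n k n0 p
  proof -
    have [measurable]: "Y n k \<in> borel_measurable M" using Ym[OF k] .
    have le: "real_of_int \<bar>round (Y n k \<omega> / a n0 n)\<bar> \<le> (2 / a n0 n) ^ (2 * p) * Y n k \<omega> ^ (2 * p)" if "1 \<le> p" for p \<omega>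
    proof -
      have "real_of_int \<bar>round (Y n k \<omega> / a n0 n)\<bar> \<le> (2 * \<bar>Y n k \<omega> / a n0 n\<bar>) ^ (2 * p)"
        by (rule abs_round_le_power) (use that in simp)
      also have "\<dots> = (2 * (Y n k \<omega> / a n0 n)) ^ (2 * p)"
        by (simp add: power_mult_distrib power_mult power_divide)
      also have "\<dots> = (2 / a n0 n) ^ (2 * p) * Y n k \<omega> ^ (2 * p)"
        by (simp add: power_mult_distrib power_divide)
      finally show ?thesis .
    qed
    have mom: "integrable M (\<lambda>\<omega>. (2 / a n0 n) ^ (2 * p) * Y n k \<omega> ^ (2 * p))" for p
      unfolding Y_def using dyadic_increment_moment(1)[OF k] by simp
    show int: "integrable M (\<lambda>\<omega>. real_of_int \<bar>round (Y n k \<omega> / a n0 n)\<bar>)"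
    proof (rule Bochner_Integration.integrable_bound[OF mom[of 1]])
      show "(\<lambda>\<omega>. real_of_int \<bar>round (Y n k \<omega> / a n0 n)\<bar>) \<in> borel_measurable M"
        unfolding round_def by measurable
      show "AE \<omega> in M. norm (real_of_int \<bar>round (Y n k \<omega> / a n0 n)\<bar>) \<le> norm ((2 / a n0 n) ^ (2 * 1) * Y n k \<omega> ^ (2 * 1))"
        using le[of 1] by (intro AE_I2) (auto intro: order_trans[OF _ abs_ge_self])
    qed
    show "(LINT \<omega>|M. real_of_int \<bar>round (Y n k \<omega> / a n0 n)\<bar>) \<le> 4 ^ p * (fact (2 * p) / (2 ^ p * fact p)) * R n0 n ^ p" if p: "1 \<le> p"
    proof -
      have "(LINT \<omega>|M. real_of_int \<bar>round (Y n k \<omega> / a n0 n)\<bar>) \<le> (LINT \<omega>|M. (2 / a n0 n) ^ (2 * p) * Y n k \<omega> ^ (2 * p))"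
        by (rule integral_mono[OF int mom le[OF p]])
      also have "\<dots> = (2 / a n0 n) ^ (2 * p) * (LINT \<omega>|M. Y n k \<omega> ^ (2 * p))" by simp
      also have "\<dots> \<le> (2 / a n0 n) ^ (2 * p) * (fact (2 * p) / (2 ^ p * fact p) * ((\<nu> / 2 ^ n) powr (2 * h)) ^ p)"
        unfolding Y_def \<nu>_def using a[of n0 n] by (intro mult_left_mono dyadic_increment_moment(2)[OF k]) auto
      also have "\<dots> = 4 ^ p * (fact (2 * p) / (2 ^ p * fact p)) * ((\<nu> / 2 ^ n) powr (2 * h) / (a n0 n)\<^sup>2) ^ p"
      proof -
        have e: "(2 / a n0 n) ^ (2 * p) = 4 ^ p / ((a n0 n)\<^sup>2) ^ p" by (simp add: power_mult power_divide)
        have gen: "x / y * (z * w) = x * z * (w / y)" for x y z w :: real by simp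
        show ?thesis unfolding e power_divide[of "(\<nu> / 2 ^ n) powr (2 * h)"] by (rule gen)
      qed
      finally show ?thesis by (simp only: ratio)
    qed
  qed
  \<comment> \<open>On coarse levels a code spread over a range of order R, costing about ln R per
    point; on fine levels a code concentrated on the cell 0, matched to the probability of leaving
    it.\<close>
  define \<theta> where "\<theta> n0 n = (if n \<le> n0 then 1 - 1 / (2 * R n0 n) else 2 powr (- (real (dist n0 n) * (real \<nu> + 1))))" for n0 n
  have R1: "1 \<le> R n0 n" if "n \<le> n0" for n0 n
    using that h by (simp add: R_def ge_one_powr_ge_zero)
  have \<theta>half: "\<theta> n0 n \<le> 1 / 2" if "\<not> n \<le> n0" for n0 n
  proof -
    have "1 \<le> real (dist n0 n)" using that by (simp add: dist_def)
    then have "1 * 1 \<le> real (dist n0 n) * (real \<nu> + 1)" by (intro mult_mono) auto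
    then have "2 powr (- (real (dist n0 n) * (real \<nu> + 1))) \<le> (2::real) powr (- 1)" by (intro powr_mono) auto
    then have "\<theta> n0 n \<le> 2 powr (- 1)" using that by (simp add: \<theta>_def)
    then show ?thesis by (simp add: powr_minus)
  qed
  have \<theta>: "0 < \<theta> n0 n \<and> \<theta> n0 n < 1" for n0 n
  proof (cases "n \<le> n0")
    case True
    have "0 < 1 / (2 * R n0 n)" "1 / (2 * R n0 n) \<le> 1 / 2" using R1[OF True] by (auto simp: field_simps)
    then show ?thesis using True by (simp add: \<theta>_def)
  next
    case False
    then show ?thesis using \<theta>half[OF False] by (simp add: \<theta>_def)
  qed
  \<comment> \<open>Common bound for both sides: the 3 comes from ln R on coarse levels, (\<nu> + 1)
    * K from ln (1 / \<theta>) on fine ones. The factor (1 / 2) ^ d is the smaller number of points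
    on coarse levels and what \<theta> leaves over on fine ones.\<close>
  define g where "g d = (6 + (3 + (real \<nu> + 1) * K) * real d) * (1 / 2) ^ d" for d
  have g0: "0 \<le> g d" for d using K by (simp add: g_def)
  have gsum: "summable g"
  proof -
    have "summable (\<lambda>d. 6 * (1 / 2) ^ d + (3 + (real \<nu> + 1) * K) * (real d * (1 / 2) ^ d))"
    proof (intro summable_add summable_mult)
      show "summable (\<lambda>d. real d * (1 / 2) ^ d)"
      proof (rule summable_comparison_test_bigo)
        show "summable (\<lambda>d. norm ((3 / 4 :: real) ^ d))" by simp
        show "(\<lambda>d. real d * (1 / 2) ^ d) \<in> O(\<lambda>d. (3 / 4) ^ d)" by real_asymp
      qed
    qed simp
    then show ?thesis unfolding g_def[abs_def] by (simp add: algebra_simps)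
  qed
  define cost where "cost n0 n k = ln ((1 + \<theta> n0 n) / (1 - \<theta> n0 n)) + ln (1 / \<theta> n0 n) * (LINT \<omega>|M. real_of_int \<bar>round (Y n k \<omega> / a n0 n)\<bar>)" for n0 n k
  have E0: "0 \<le> (LINT \<omega>|M. real_of_int \<bar>round (Y n k \<omega> / a n0 n)\<bar>)" for n0 n k
    by (rule integral_nonneg_AE) auto
  have cost: "cost n0 n k * 2 ^ (n * \<nu>) \<le> 2 ^ (n0 * \<nu>) * g (dist n0 n)" if k: "k \<in> dyadic_index n" for n0 n k
  proof (cases "n \<le> n0")
    case True
    define d where "d = n0 - n"
    have d: "dist n0 n = d" "n0 = n + d" using True by (auto simp: dist_def d_def)
    have \<theta>eq: "\<theta> n0 n = 1 - 1 / (2 * R n0 n)" using True by (simp add: \<theta>_def)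
    have "(LINT \<omega>|M. real_of_int \<bar>round (Y n k \<omega> / a n0 n)\<bar>) \<le> 4 * R n0 n"
      using round_E[OF k, of 1 n0] by simp
    then have "cost n0 n k \<le> 6 + ln (R n0 n)"
      unfolding cost_def \<theta>eq by (rule coarse_code_length[OF R1[OF True] _ E0])
    also have "ln (R n0 n) \<le> 3 * real d"
    proof -
      have "ln (R n0 n) = 3 * real d * (h * ln 2)" using True by (simp add: R_def d(1))
      also have "\<dots> \<le> 3 * real d * 1"
        using h ln_2_less_1 by (intro mult_left_mono mult_le_one) auto
      finally show ?thesis by simp
    qed
    finally have "cost n0 n k \<le> 6 + 3 * real d" by simp
    moreover have "0 \<le> (real \<nu> + 1) * K * real d" using K by simp
    ultimately have "cost n0 n k \<le> 6 + (3 + (real \<nu> + 1) * K) * real d"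
      unfolding distrib_right[of 3] by linarith
    then have "cost n0 n k * 2 ^ (n * \<nu>) \<le> (6 + (3 + (real \<nu> + 1) * K) * real d) * 2 ^ (n * \<nu>)" by (rule mult_right_mono) simp
    also have "\<dots> \<le> (6 + (3 + (real \<nu> + 1) * K) * real d) * (2 ^ (n0 * \<nu>) * (1 / 2) ^ d)"
    proof (rule mult_left_mono)
      have "(2::real) ^ (n * \<nu>) * 2 ^ d \<le> 2 ^ (n * \<nu>) * 2 ^ (d * \<nu>)" using \<nu> by (intro mult_left_mono power_increasing) auto
      then show "(2::real) ^ (n * \<nu>) \<le> 2 ^ (n0 * \<nu>) * (1 / 2) ^ d"
        by (simp add: d(2) power_add distrib_right power_one_over field_simps)
    qed (use K in simp)
    also have "\<dots> = 2 ^ (n0 * \<nu>) * g (dist n0 n)" by (simp add: g_def d(1))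
    finally show ?thesis .
  next
    case False
    define d where "d = n - n0"
    have d: "dist n0 n = d" "n = n0 + d" using False by (auto simp: dist_def d_def)
    have Rq: "R n0 n ^ q \<le> \<theta> n0 n"
    proof -
      have "R n0 n ^ q = 2 powr (- (d * (q * h)))" using False by (simp add: R_def d(1) powr_power mult_ac)
      also have "\<dots> \<le> 2 powr (- (real d * (real \<nu> + 1)))"
        using q by (intro powr_mono) (auto intro!: mult_left_mono)
      finally show ?thesis using False by (simp add: \<theta>_def d(1) algebra_simps)
    qed
    have "cost n0 n k \<le> (4 + ln (1 / \<theta> n0 n) * K) * \<theta> n0 n"
      unfolding cost_def
    proof (rule fine_code_length[OF _ \<theta>half[OF False] _ E0])
      have "(LINT \<omega>|M. real_of_int \<bar>round (Y n k \<omega> / a n0 n)\<bar>) \<le> K * R n0 n ^ q"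
        using round_E[OF k q(2), of n0] by (simp add: K_def)
      also have "\<dots> \<le> K * \<theta> n0 n" using Rq K by (intro mult_left_mono) auto
      finally show "(LINT \<omega>|M. real_of_int \<bar>round (Y n k \<omega> / a n0 n)\<bar>) \<le> K * \<theta> n0 n" .
    qed (use \<theta> in auto)
    also have "ln (1 / \<theta> n0 n) = real d * (real \<nu> + 1) * ln 2"
      using False by (simp add: \<theta>_def d(1) ln_div ln_powr)
    also have "(4 + real d * (real \<nu> + 1) * ln 2 * K) * \<theta> n0 n \<le> (6 + (3 + (real \<nu> + 1) * K) * real d) * \<theta> n0 n"
    proof (rule mult_right_mono)
      have "real d * (real \<nu> + 1) * ln 2 * K \<le> real d * (real \<nu> + 1) * 1 * K"
        using K ln_2_less_1 by (intro mult_right_mono mult_left_mono) auto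
      then show "4 + real d * (real \<nu> + 1) * ln 2 * K \<le> 6 + (3 + (real \<nu> + 1) * K) * real d" by (simp add: algebra_simps)
    qed (use \<theta>[of n0 n] in auto)
    finally have "cost n0 n k * 2 ^ (n * \<nu>) \<le> (6 + (3 + (real \<nu> + 1) * K) * real d) * \<theta> n0 n * 2 ^ (n * \<nu>)"
      by (rule mult_right_mono) simp
    also have "\<dots> = (6 + (3 + (real \<nu> + 1) * K) * real d) * (\<theta> n0 n * 2 ^ (n * \<nu>))" by (simp only: mult.assoc)
    also have "\<theta> n0 n * 2 ^ (n * \<nu>) = 2 ^ (n0 * \<nu>) * (1 / 2) ^ d"
    proof -
      have "\<theta> n0 n = 1 / 2 ^ (d * (\<nu> + 1))"
      proof -
        have "\<theta> n0 n = 2 powr (- real (d * (\<nu> + 1)))" using False by (simp add: \<theta>_def d(1) algebra_simps)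
        also have "\<dots> = 1 / 2 ^ (d * (\<nu> + 1))" unfolding powr_minus_divide by (simp only: powr_realpow zero_less_numeral)
        finally show ?thesis .
      qed
      then show ?thesis by (simp add: d(2) power_add distrib_right distrib_left power_one_over field_simps)
    qed
    finally show ?thesis by (simp add: g_def d(1) mult_ac)
  qed
  have level: "(\<Sum>k\<in>dyadic_index n. cost n0 n k) \<le> 2 ^ \<nu> * (2 ^ (n0 * \<nu>) * g (dist n0 n))" for n0 n
  proof -
    have "(\<Sum>k\<in>dyadic_index n. cost n0 n k) \<le> (\<Sum>k\<in>(dyadic_index n :: ('n \<Rightarrow> nat) set). 2 ^ (n0 * \<nu>) * g (dist n0 n) / 2 ^ (n * \<nu>))"
      by (intro sum_mono) (simp add: le_divide_eq cost)
    also have "\<dots> = real ((2 ^ n + 1) ^ \<nu>) * (2 ^ (n0 * \<nu>) * g (dist n0 n) / 2 ^ (n * \<nu>))"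
      by (simp add: card_dyadic_index \<nu>_def)
    also have "\<dots> \<le> (2 ^ \<nu> * 2 ^ (n * \<nu>)) * (2 ^ (n0 * \<nu>) * g (dist n0 n) / 2 ^ (n * \<nu>))"
    proof (rule mult_right_mono)
      have "(2 ^ n + 1) ^ \<nu> \<le> (2 * 2 ^ n :: nat) ^ \<nu>" by (intro power_mono) auto
      also have "\<dots> = 2 ^ \<nu> * 2 ^ (n * \<nu>)" by (simp add: power_mult_distrib power_mult)
      finally have "real ((2 ^ n + 1) ^ \<nu>) \<le> real (2 ^ \<nu> * 2 ^ (n * \<nu>))" by (rule of_nat_mono)
      then show "real ((2 ^ n + 1) ^ \<nu>) \<le> 2 ^ \<nu> * 2 ^ (n * \<nu>)" by simp
    qed (use g0 in simp)
    finally show ?thesis by simp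
  qed
  define CL where "CL = 2 ^ \<nu> * (2 * suminf g)"
  have CL: "0 < CL"
  proof -
    have "g 0 \<le> suminf g" using sum_le_suminf[OF gsum, of "{0}"] g0 by simp
    then show ?thesis by (simp add: CL_def g_def)
  qed
  define ga where "ga d = 2 powr (- (real d * h / 2))" for d
  have ga: "summable ga" "\<And>d. 0 \<le> ga d"
  proof -
    have "ga = (\<lambda>d. (2 powr (- (h / 2))) ^ d)" by (simp add: ga_def fun_eq_iff powr_power mult_ac)
    moreover have "2 powr (- (h / 2)) < (1::real)" using h by (simp add: powr_less_one)
    ultimately show "summable ga" by (simp add: summable_geometric)
  qed (simp add: ga_def)
  define Ca where "Ca = \<nu> powr h * (2 * suminf ga)"
  have Ca: "0 < Ca"
  proof -
    have "ga 0 \<le> suminf ga" using sum_le_suminf[OF ga(1), of "{0}"] ga(2) by simp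
    then show ?thesis using \<nu> by (simp add: Ca_def ga_def)
  qed
  have suma: "(\<Sum>n\<le>n1. a n0 n) \<le> Ca * 2 powr (- (n0 * h))" for n0 n1
  proof -
    have "(\<Sum>n\<le>n1. a n0 n) = \<nu> powr h * 2 powr (- (n0 * h)) * (\<Sum>n\<le>n1. ga (if n \<le> n0 then n0 - n else n - n0))"
      by (simp add: sum_distrib_left a_def dist_def ga_def)
    also have "\<dots> \<le> \<nu> powr h * 2 powr (- (n0 * h)) * (2 * suminf ga)"
      by (intro mult_left_mono sum_abs_distance_le ga) auto
    finally show ?thesis by (simp add: Ca_def mult_ac)
  qed
  have finite_level: "exp (- (2 * CL) * (2 ^ n0) ^ \<nu>) / 4
      \<le> measure M {\<omega>\<in>space M. \<forall>n\<in>{..n1}. \<forall>k\<in>dyadic_index n. \<bar>Y n k \<omega>\<bar> \<le> a n0 n}" for n0 n1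
  proof -
    let ?T = "Sigma {..n1} (\<lambda>n. dyadic_index n :: ('n \<Rightarrow> nat) set)"
    let ?Y = "\<lambda>t. Y (fst t) (snd t)"
    let ?L = "CL * (2 ^ n0) ^ \<nu>"
    have fin: "finite ?T" by auto
    have kT: "t \<in> ?T \<Longrightarrow> snd t \<in> dyadic_index (fst t)" for t by auto
    obtain c where fam: "gaussian_family M ?T ?Y c"
    proof
      show "gaussian_family M ?T ?Y (\<lambda>t t'. LINT \<omega>|M. (B (dyadic_point (fst t) (snd t)) \<omega> - B (dyadic_parent (fst t) (snd t)) \<omega>) *
          (B (dyadic_point (fst t') (snd t')) \<omega> - B (dyadic_parent (fst t') (snd t')) \<omega>))"
        unfolding Y_def
        by (rule diff_family[OF fin]) (use kT dyadic_point_in_cube dyadic_parent_in_cube in force)+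
    qed
    have "(\<Sum>t\<in>?T. cost n0 (fst t) (snd t)) = (\<Sum>n\<le>n1. \<Sum>k\<in>dyadic_index n. cost n0 n k)"
      by (subst sum.Sigma) (auto simp: case_prod_beta)
    also have "\<dots> \<le> (\<Sum>n\<le>n1. 2 ^ \<nu> * (2 ^ (n0 * \<nu>) * g (dist n0 n)))" by (intro sum_mono level)
    also have "\<dots> = 2 ^ \<nu> * 2 ^ (n0 * \<nu>) * (\<Sum>n\<le>n1. g (if n \<le> n0 then n0 - n else n - n0))"
      by (simp add: sum_distrib_left dist_def mult.assoc)
    also have "\<dots> \<le> 2 ^ \<nu> * 2 ^ (n0 * \<nu>) * (2 * suminf g)"
      by (intro mult_left_mono sum_abs_distance_le gsum g0) auto
    also have "\<dots> = ?L" unfolding CL_def power_mult by simp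
    finally have L: "(\<Sum>t\<in>?T. cost n0 (fst t) (snd t)) \<le> ?L" .
    have "exp (- 2 * ?L) / 4 \<le> measure (M \<Otimes>\<^sub>M M) {p\<in>space (M \<Otimes>\<^sub>M M). \<forall>t\<in>?T. \<bar>?Y t (fst p) - ?Y t (snd p)\<bar> \<le> a n0 (fst t)}"
    proof (rule collision_probability_ge[OF prob_space_axioms fin, where \<theta>="\<lambda>t. \<theta> n0 (fst t)"])
      show "(\<Sum>t\<in>?T. ln ((1 + \<theta> n0 (fst t)) / (1 - \<theta> n0 (fst t))) +
          ln (1 / \<theta> n0 (fst t)) * (LINT \<omega>|M. real_of_int \<bar>round (?Y t \<omega> / a n0 (fst t))\<bar>)) \<le> ?L"
        using L by (simp add: cost_def)
      show "0 < ?L" using CL by simp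
    qed (use kT Ym a \<theta> round_int in auto)
    \<comment> \<open>Dividing by sqrt 2 turns the difference of the two copies into a family with
      the original covariance.\<close>
    also have "\<dots> = measure (M \<Otimes>\<^sub>M M) {p\<in>space (M \<Otimes>\<^sub>M M). \<forall>t\<in>?T. \<bar>(?Y t (fst p) - ?Y t (snd p)) / sqrt 2\<bar> \<le> a n0 (fst t) / sqrt 2}"
      by (simp add: divide_le_cancel)
    also have "\<dots> = measure M {\<omega>\<in>space M. \<forall>t\<in>?T. \<bar>?Y t \<omega>\<bar> \<le> a n0 (fst t) / sqrt 2}"
      by (rule box_probability_eq_scaled[OF gaussian_family_pair_diff[OF fam] fam]) (use a in simp)
    also have "\<dots> \<le> measure M {\<omega>\<in>space M. \<forall>n\<in>{..n1}. \<forall>k\<in>dyadic_index n. \<bar>Y n k \<omega>\<bar> \<le> a n0 n}"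
    proof (rule finite_measure_mono)
      have [measurable]: "k \<in> dyadic_index n \<Longrightarrow> Y n k \<in> borel_measurable M" for n k by (rule Ym)
      show "{\<omega>\<in>space M. \<forall>n\<in>{..n1}. \<forall>k\<in>dyadic_index n. \<bar>Y n k \<omega>\<bar> \<le> a n0 n} \<in> sets M"
        by measurable
      have "a n0 n / sqrt 2 \<le> a n0 n" for n using a[of n0 n] by (simp add: divide_le_eq)
      then show "{\<omega>\<in>space M. \<forall>t\<in>?T. \<bar>?Y t \<omega>\<bar> \<le> a n0 (fst t) / sqrt 2}
          \<subseteq> {\<omega>\<in>space M. \<forall>n\<in>{..n1}. \<forall>k\<in>dyadic_index n. \<bar>Y n k \<omega>\<bar> \<le> a n0 n}"
        by (force intro: order_trans)
    qed
    finally show ?thesis by (simp add: mult.assoc)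
  qed
  have bound: "exp (- (2 * CL) * (2 ^ n0) ^ CARD('n)) / 4
      \<le> measure M {\<omega>\<in>space M. sup_abs B 1 \<omega> \<le> Ca * 2 powr (- (n0 * h))}" for n0
  proof -
    let ?A = "\<lambda>n1. {\<omega>\<in>space M. \<forall>n\<in>{..n1}. \<forall>k\<in>dyadic_index n. \<bar>Y n k \<omega>\<bar> \<le> a n0 n}"
    have [measurable]: "k \<in> dyadic_index n \<Longrightarrow> Y n k \<in> borel_measurable M" for n k by (rule Ym)
    have A_meas: "?A n1 \<in> sets M" for n1 by measurable
    have "(\<lambda>n1. measure M (?A n1)) \<longlonglongrightarrow> measure M (\<Inter>n1. ?A n1)"
      by (rule finite_Lim_measure_decseq) (use A_meas in \<open>auto simp: decseq_def\<close>)
    then have "exp (- (2 * CL) * (2 ^ n0) ^ \<nu>) / 4 \<le> measure M (\<Inter>n1. ?A n1)"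
      by (rule LIMSEQ_le_const) (use finite_level in auto)
    also have "\<dots> \<le> measure M {\<omega>\<in>space M. sup_abs B 1 \<omega> \<le> Ca * 2 powr (- (n0 * h))}"
    proof (rule finite_measure_mono_AE)
      show "AE \<omega> in M. \<omega> \<in> (\<Inter>n1. ?A n1) \<longrightarrow> \<omega> \<in> {\<omega>\<in>space M. sup_abs B 1 \<omega> \<le> Ca * 2 powr (- (n0 * h))}"
        using B_0
      proof eventually_elim
        case (elim \<omega>)
        show ?case
        proof
          assume \<omega>A: "\<omega> \<in> (\<Inter>n1. ?A n1)"
          then have \<omega>: "\<omega> \<in> space M" by auto
          have Yb: "\<bar>Y n k \<omega>\<bar> \<le> a n0 n" if "k \<in> dyadic_index n" for n k using \<omega>A that by auto
          \<comment> \<open>Chaining starts at level 0, where an increment is the value itself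
            because B 0 = 0; the other tolerances make up the remainder.\<close>
          have "sup_abs B 1 \<omega> \<le> a n0 0 + (Ca * 2 powr (- (n0 * h)) - a n0 0)"
          proof (rule sup_abs_chaining[OF \<omega>, where m=0 and b="a n0"])
            fix k :: "'n \<Rightarrow> nat" assume "k \<in> dyadic_index 0"
            then show "\<bar>B (dyadic_point 0 k) \<omega>\<bar> \<le> a n0 0"
              using Yb[of k 0] elim by (simp add: Y_def dyadic_parent_def)
          next
            fix n and k :: "'n \<Rightarrow> nat" assume "k \<in> dyadic_index n"
            then show "\<bar>B (dyadic_point n k) \<omega> - B (dyadic_parent n k) \<omega>\<bar> \<le> a n0 n" using Yb[of k n] by (simp add: Y_def)
          next
            fix n :: nat
            have "{..n} = insert 0 {0<..n}" by auto
            then have "(\<Sum>j\<le>n. a n0 j) = a n0 0 + (\<Sum>j\<in>{0<..n}. a n0 j)" by simp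
            then show "(\<Sum>j\<in>{0<..n}. a n0 j) \<le> Ca * 2 powr (- (n0 * h)) - a n0 0"
              using suma[of n0 n] by linarith
          qed
          then show "\<omega> \<in> {\<omega>\<in>space M. sup_abs B 1 \<omega> \<le> Ca * 2 powr (- (n0 * h))}" using \<omega> by simp
        qed
      qed
    qed (rule sup_abs_1_event_measurable)
    finally show ?thesis by (simp add: \<nu>_def)
  qed
  show ?thesis by (rule that[of Ca "2 * CL"]) (use Ca CL bound in auto)
qed

lemma small_ball_lower_bound:
  "\<exists>\<kappa>>0. \<forall>\<^sub>F \<epsilon> in at_right 0. exp (- \<kappa> / \<epsilon> powr (CARD('n) / h)) \<le> measure M {\<omega>\<in>space M. sup_abs B 1 \<omega> \<le> \<epsilon>}"
proof -
  obtain Ca CL where C: "0 < Ca" "0 < CL" "\<And>n0. exp (- CL * (2 ^ n0) ^ CARD('n)) / 4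
    \<le> measure M {\<omega>\<in>space M. sup_abs B 1 \<omega> \<le> Ca * 2 powr (- (n0 * h))}"
    by (rule small_ball_lower_bound_dyadic, rule that)
  \<comment> \<open>The factor 2 ^ CARD('n) pays for rounding n0 up, the summand 2 for the prefactor
    1/4, as exp (- 2) \<le> 1/4 and \<epsilon> \<le> 1.\<close>
  define \<kappa> where "\<kappa> = CL * 2 ^ CARD('n) * Ca powr (CARD('n) / h) + 2"
  have bound: "exp (- \<kappa> / \<epsilon> powr (CARD('n) / h)) \<le> measure M {\<omega>\<in>space M. sup_abs B 1 \<omega> \<le> \<epsilon>}"
    if \<epsilon>: "0 < \<epsilon>" "\<epsilon> \<le> 1" "\<epsilon> \<le> Ca" for \<epsilon>
  proof -
    define y where "y = (Ca / \<epsilon>) powr (1 / h)"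
    have y: "1 \<le> y" unfolding y_def using \<epsilon> h C by (intro ge_one_powr_ge_zero) auto
    \<comment> \<open>Rounding up keeps the radius at most \<epsilon> and at most doubles 2 ^
      n0.\<close>
    define n0 where "n0 = nat \<lceil>log 2 y\<rceil>"
    have l0: "0 \<le> log 2 y" using y by simp
    have n0: "log 2 y \<le> n0" "n0 \<le> log 2 y + 1" unfolding n0_def using l0 by linarith+
    have pw: "(2::real) ^ n0 = 2 powr n0" by (simp add: powr_realpow)
    have up: "2 ^ n0 \<le> 2 * y"
    proof -
      have "(2::real) powr n0 \<le> 2 powr (log 2 y + 1)" using n0 by (intro powr_mono) auto
      also have "\<dots> = 2 * y" using y by (simp add: powr_add)
      finally show ?thesis by (simp add: pw)
    qed
    have low: "y \<le> 2 powr n0"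
    proof -
      have "y = 2 powr (log 2 y)" using y by simp
      also have "\<dots> \<le> 2 powr n0" using n0 by (intro powr_mono) auto
      finally show ?thesis .
    qed
    have "Ca * 2 powr (- (n0 * h)) \<le> \<epsilon>"
    proof -
      have "Ca / \<epsilon> = y powr h" using C \<epsilon> h by (simp add: y_def powr_powr)
      also have "\<dots> \<le> (2 powr n0) powr h" using low y h by (intro powr_mono2) auto
      also have "\<dots> = 2 powr (n0 * h)" by (simp add: powr_powr)
      finally have "Ca \<le> \<epsilon> * 2 powr (n0 * h)" using \<epsilon> by (simp add: divide_le_eq mult.commute)
      then show ?thesis by (simp add: powr_minus_divide divide_le_eq)
    qed
    then have "measure M {\<omega>\<in>space M. sup_abs B 1 \<omega> \<le> Ca * 2 powr (- (n0 * h))} \<le> measure M {\<omega>\<in>space M. sup_abs B 1 \<omega> \<le> \<epsilon>}"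
      by (intro finite_measure_mono) auto
    with C(3)[of n0] have 1: "exp (- CL * (2 ^ n0) ^ CARD('n)) / 4 \<le> measure M {\<omega>\<in>space M. sup_abs B 1 \<omega> \<le> \<epsilon>}"
      by linarith
    have e1: "1 \<le> 1 / \<epsilon> powr (CARD('n) / h)"
      using \<epsilon> h by (simp add: powr_le1)
    have "(2 ^ n0) ^ CARD('n) \<le> (2 * y) ^ CARD('n)" using up by (intro power_mono) auto
    also have "\<dots> = 2 ^ CARD('n) * (Ca powr (CARD('n) / h) / \<epsilon> powr (CARD('n) / h))"
    proof -
      have "y ^ CARD('n) = (Ca / \<epsilon>) powr (CARD('n) / h)" using C \<epsilon> by (simp add: y_def powr_power)
      then show ?thesis using C \<epsilon> by (simp add: power_mult_distrib powr_divide)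
    qed
    finally have "CL * (2 ^ n0) ^ CARD('n) \<le> CL * (2 ^ CARD('n) * (Ca powr (CARD('n) / h) / \<epsilon> powr (CARD('n) / h)))"
      using C by (intro mult_left_mono) auto
    also have "\<dots> = (\<kappa> - 2) / \<epsilon> powr (CARD('n) / h)" by (simp add: \<kappa>_def)
    finally have "CL * (2 ^ n0) ^ CARD('n) + 2 \<le> \<kappa> / \<epsilon> powr (CARD('n) / h)"
      using e1 by (simp add: diff_divide_distrib)
    then have "exp (- \<kappa> / \<epsilon> powr (CARD('n) / h)) \<le> exp (- CL * (2 ^ n0) ^ CARD('n) - 2)" by simp
    also have "\<dots> = exp (- CL * (2 ^ n0) ^ CARD('n)) / exp 2" by (simp add: exp_diff)
    also have "\<dots> \<le> exp (- CL * (2 ^ n0) ^ CARD('n)) / 4"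
    proof (rule divide_left_mono)
      have "(2::real) \<le> exp 1" using exp_ge_add_one_self[of 1] by simp
      then have "(2::real) * 2 \<le> exp 1 * exp 1" by (intro mult_mono) auto
      then show "(4::real) \<le> exp 2" by (simp add: exp_add[symmetric])
    qed auto
    finally show ?thesis using 1 by linarith
  qed
  have "\<forall>\<^sub>F \<epsilon> in at_right 0. \<epsilon> < min 1 Ca" by (rule eventually_at_rightI[of 0 "min 1 Ca"]) (use C in auto)
  then have "\<forall>\<^sub>F \<epsilon> in at_right 0. exp (- \<kappa> / \<epsilon> powr (CARD('n) / h)) \<le> measure M {\<omega>\<in>space M. sup_abs B 1 \<omega> \<le> \<epsilon>}"
    using eventually_at_right_less[of "0::real"] by eventually_elim (rule bound, auto)
  moreover have "0 < \<kappa>" using C by (simp add: \<kappa>_def add_nonneg_pos)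
  ultimately show ?thesis by blast
qed

end

section \<open>Second moments and chaining tails\<close>

text \<open>The sum of Z over a block has some mean \<mu> and variance at most \<mu> + 2 * C, so by
  Chebyshev it vanishes with probability at most (\<mu> + 2 * C) / \<mu>^2. Divergence of the
  expectations lets \<mu> tend to infinity.\<close>

lemma (in prob_space) AE_frequently_pos_second_moment:
  fixes Z :: "nat \<Rightarrow> 'a \<Rightarrow> real" and e :: "nat \<Rightarrow> real"
  assumes Z [measurable]: "\<And>k. Z k \<in> borel_measurable M"
    and Z01: "\<And>k \<omega>. 0 \<le> Z k \<omega> \<and> Z k \<omega> \<le> 1"
    and div: "\<not> summable (\<lambda>k. expectation (Z k))"
    and e: "\<And>j. 0 \<le> e j" "summable (\<lambda>j. real j * e j)"
    and cov: "\<And>i j. k0 \<le> i \<Longrightarrow> i < j \<Longrightarrow>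
      \<bar>expectation (\<lambda>\<omega>. Z i \<omega> * Z j \<omega>) - expectation (Z i) * expectation (Z j)\<bar> \<le> e j"
  shows "AE \<omega> in M. \<exists>\<^sub>F k in sequentially. 0 < Z k \<omega>"
proof -
  have int: "integrable M (Z k)" for k
    by (rule integrable_const_bound[where B=1]) (use Z01 in auto)
  have int2: "integrable M (\<lambda>\<omega>. Z i \<omega> * Z j \<omega>)" for i j
    by (rule integrable_const_bound[where B=1]) (use Z01 in \<open>auto simp: abs_mult intro!: mult_le_one\<close>)
  have E0: "0 \<le> expectation (Z k)" for k by (rule integral_nonneg_AE) (use Z01 in auto)
  define C where "C = (\<Sum>j. real j * e j)"
  have C: "0 \<le> C" unfolding C_def using e by (intro suminf_nonneg) auto
  have null: "measure M {\<omega>\<in>space M. \<forall>k\<ge>K. Z k \<omega> = 0} = 0" if K: "k0 \<le> K" for K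
  proof (rule ccontr)
    let ?p = "measure M {\<omega>\<in>space M. \<forall>k\<ge>K. Z k \<omega> = 0}"
    assume "?p \<noteq> 0"
    then have p: "0 < ?p" using measure_nonneg[of M "{\<omega>\<in>space M. \<forall>k\<ge>K. Z k \<omega> = 0}"] by linarith
    \<comment> \<open>A positive probability of vanishing for ever would bound the block means,
      against the divergence assumed in \<open>div\<close>.\<close>
    have bnd: "(\<Sum>k\<in>{K..<N}. expectation (Z k)) \<le> max 1 ((1 + 2 * C) / ?p)" for N
    proof (rule ccontr)
      let ?I = "{K..<N}"
      let ?\<mu> = "\<Sum>k\<in>?I. expectation (Z k)"
      assume "\<not> ?\<mu> \<le> max 1 ((1 + 2 * C) / ?p)"
      then have \<mu>: "1 < ?\<mu>" "(1 + 2 * C) / ?p < ?\<mu>" by auto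
      let ?S = "\<lambda>\<omega>. \<Sum>k\<in>?I. Z k \<omega>"
      have S: "expectation ?S = ?\<mu>" using int by simp
      have S2: "(?S \<omega>)\<^sup>2 = (\<Sum>i\<in>?I. \<Sum>j\<in>?I. Z i \<omega> * Z j \<omega>)" for \<omega>
        by (simp add: power2_eq_square sum_product)
      have S2int: "integrable M (\<lambda>\<omega>. (?S \<omega>)\<^sup>2)" unfolding S2 using int2 by auto
      have "variance ?S = expectation (\<lambda>\<omega>. (?S \<omega>)\<^sup>2) - ?\<mu>\<^sup>2"
        unfolding S[symmetric] using int S2int by (intro variance_eq) auto
      also have "expectation (\<lambda>\<omega>. (?S \<omega>)\<^sup>2) = (\<Sum>i\<in>?I. \<Sum>j\<in>?I. expectation (\<lambda>\<omega>. Z i \<omega> * Z j \<omega>))"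
        unfolding S2 using int2 by (simp add: Bochner_Integration.integral_sum)
      also have "(\<Sum>i\<in>?I. \<Sum>j\<in>?I. expectation (\<lambda>\<omega>. Z i \<omega> * Z j \<omega>)) - ?\<mu>\<^sup>2
          = (\<Sum>i\<in>?I. \<Sum>j\<in>?I. expectation (\<lambda>\<omega>. Z i \<omega> * Z j \<omega>) - expectation (Z i) * expectation (Z j))"
        by (simp add: power2_eq_square sum_product sum_subtractf)
      \<comment> \<open>On the diagonal Z^2 \<le> Z is used; off it the error is charged to the
        larger index.\<close>
      also have "\<dots> \<le> (\<Sum>i\<in>?I. \<Sum>j\<in>?I. (if i = j then expectation (Z i) else 0) + ((if i < j then e j else 0) + (if j < i then e i else 0)))"
      proof (intro sum_mono)
        fix i j assume ij: "i \<in> ?I" "j \<in> ?I"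
        consider "i = j" | "i < j" | "j < i" by linarith
        then show "expectation (\<lambda>\<omega>. Z i \<omega> * Z j \<omega>) - expectation (Z i) * expectation (Z j)
            \<le> (if i = j then expectation (Z i) else 0) + ((if i < j then e j else 0) + (if j < i then e i else 0))"
        proof cases
          case 1
          have "expectation (\<lambda>\<omega>. Z i \<omega> * Z i \<omega>) \<le> expectation (Z i)"
            by (rule integral_mono[OF int2 int]) (use Z01 in \<open>auto intro: mult_left_le\<close>)
          moreover have "0 \<le> expectation (Z i) * expectation (Z i)" using E0 by simp
          ultimately have "expectation (\<lambda>\<omega>. Z i \<omega> * Z i \<omega>) - expectation (Z i) * expectation (Z i) \<le> expectation (Z i)"
            by linarith
          then show ?thesis using 1 by simp
        next
          case 2
          then show ?thesis using cov[of i j] ij K by auto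
        next
          case 3
          then show ?thesis using cov[of j i] ij K by (auto simp: mult.commute)
        qed
      qed
      also have "\<dots> = ?\<mu> + ((\<Sum>i\<in>?I. \<Sum>j\<in>?I. (if i < j then e j else 0)) + (\<Sum>i\<in>?I. \<Sum>j\<in>?I. (if j < i then e i else 0)))"
        by (simp only: sum.distrib sum.delta' finite_atLeastLessThan) simp
      also have "(\<Sum>i\<in>?I. \<Sum>j\<in>?I. (if i < j then e j else 0)) = (\<Sum>j\<in>?I. \<Sum>i\<in>?I. (if i < j then e j else 0))"
        by (rule sum.swap)
      also have "?\<mu> + ((\<Sum>j\<in>?I. \<Sum>i\<in>?I. (if i < j then e j else 0)) + (\<Sum>i\<in>?I. \<Sum>j\<in>?I. (if j < i then e i else 0))) \<le> ?\<mu> + (C + C)"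
      proof -
        \<comment> \<open>At most j indices lie below j, hence the weight \<open>real j\<close> in
          the summability assumption.\<close>
        have "(\<Sum>j\<in>?I. \<Sum>i\<in>?I. (if i < j then e j else 0)) \<le> (\<Sum>j\<in>?I. real j * e j)"
        proof (rule sum_mono)
          fix j
          have "(\<Sum>i\<in>?I. (if i < j then e j else 0)) = (\<Sum>i\<in>{i\<in>?I. i < j}. e j)"
            by (rule sum.inter_filter[symmetric]) simp
          also have "\<dots> = real (card {i\<in>?I. i < j}) * e j" by simp
          also have "\<dots> \<le> real j * e j"
          proof (rule mult_right_mono)
            have "card {i\<in>?I. i < j} \<le> card {..<j}" by (rule card_mono) auto
            then show "real (card {i\<in>?I. i < j}) \<le> real j" by simp
          qed (rule e(1))
          finally show "(\<Sum>i\<in>?I. (if i < j then e j else 0)) \<le> real j * e j" .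
        qed
        also have "\<dots> \<le> C" unfolding C_def using e by (intro sum_le_suminf) auto
        finally show ?thesis by simp
      qed
      finally have var: "variance ?S \<le> ?\<mu> + 2 * C" by simp
      have "?p \<le> measure M {\<omega>\<in>space M. ?\<mu> \<le> \<bar>?S \<omega> - ?\<mu>\<bar>}"
      proof (rule finite_measure_mono)
        show "{\<omega>\<in>space M. \<forall>k\<ge>K. Z k \<omega> = 0} \<subseteq> {\<omega>\<in>space M. ?\<mu> \<le> \<bar>?S \<omega> - ?\<mu>\<bar>}" by auto
        show "{\<omega>\<in>space M. ?\<mu> \<le> \<bar>?S \<omega> - ?\<mu>\<bar>} \<in> sets M" by measurable
      qed
      also have "\<dots> \<le> variance ?S / ?\<mu>\<^sup>2"
        using Chebyshev_inequality[of ?S ?\<mu>] S2int \<mu>(1) unfolding S by simp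
      also have "\<dots> \<le> (?\<mu> + 2 * C) / ?\<mu>\<^sup>2" using var by (rule divide_right_mono) simp
      finally have "?p * (?\<mu> * ?\<mu>) \<le> ?\<mu> + 2 * C" using \<mu>(1) by (simp add: le_divide_eq power2_eq_square)
      also have "\<dots> \<le> ?\<mu> * (1 + 2 * C)"
        using \<mu>(1) C mult_right_mono[of 1 ?\<mu> "2 * C"] by (simp add: distrib_left)
      finally have "?\<mu> * (?p * ?\<mu>) \<le> ?\<mu> * (1 + 2 * C)" by (simp add: mult_ac)
      then have "?p * ?\<mu> \<le> 1 + 2 * C" using \<mu>(1) by simp
      then show False using \<mu>(2) p by (simp add: divide_less_eq mult.commute)
    qed
    have "summable (\<lambda>k. expectation (Z (k + K)))"
    proof (rule summableI_nonneg_bounded)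
      fix n
      have "(\<Sum>k<n. expectation (Z (k + K))) = (\<Sum>k\<in>{K..<n + K}. expectation (Z k))"
        using sum.shift_bounds_nat_ivl[of "\<lambda>k. expectation (Z k)" 0 K n] by (simp add: atLeast0LessThan)
      then show "(\<Sum>k<n. expectation (Z (k + K))) \<le> max 1 ((1 + 2 * C) / ?p)" using bnd by simp
    qed (rule E0)
    then have "summable (\<lambda>k. expectation (Z k))" by (subst (asm) summable_iff_shift)
    with div show False by simp
  qed
  have "AE \<omega> in M. \<not> (\<forall>k\<ge>K + k0. Z k \<omega> = 0)" for K
  proof -
    have "{\<omega>\<in>space M. \<forall>k\<ge>K + k0. Z k \<omega> = 0} \<in> null_sets M"
      using null[of "K + k0"] by (intro null_setsI) (auto simp: emeasure_eq_measure)
    then have "AE \<omega> in M. \<omega> \<notin> {\<omega>\<in>space M. \<forall>k\<ge>K + k0. Z k \<omega> = 0}" by (rule AE_not_in)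
    then show ?thesis using AE_space by eventually_elim auto
  qed
  then have "AE \<omega> in M. \<forall>K. \<not> (\<forall>k\<ge>K + k0. Z k \<omega> = 0)" by (simp add: AE_all_countable)
  then show ?thesis
  proof eventually_elim
    case (elim \<omega>)
    show ?case
      unfolding frequently_sequentially
    proof
      fix K
      obtain k where "K + k0 \<le> k" "Z k \<omega> \<noteq> 0" using elim by blast
      then have "K \<le> k" "0 < Z k \<omega>" using Z01[of k \<omega>] by auto
      then show "\<exists>k\<ge>K. 0 < Z k \<omega>" by blast
    qed
  qed
qed

text \<open>Union bound over all finer levels with moments of order 2 * q; the gain 2 powr (- m * h
  * q) is an arbitrarily high power of the mesh. K is the same for all processes, levels and
  tolerances, as it is needed for a whole sequence of rescaled processes.\<close>

lemma chaining_tail: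
  fixes h :: real and q :: nat
  assumes h: "0 < h" and q: "real (CARD('n) + 1) \<le> q * h"
  obtains K where "0 \<le> K"
    "\<And>(M :: 'a measure) (B :: real^'n \<Rightarrow> 'a \<Rightarrow> real) m a. mpfbm_process M h B \<Longrightarrow> 0 < a \<Longrightarrow>
      \<exists>E\<in>sets M. measure M E \<le> K * 2 powr (- (m * h * q)) / a ^ (2 * q) \<and>
        (\<forall>\<omega>\<in>space M - E. \<forall>x. (\<forall>k\<in>dyadic_index m. \<bar>B (dyadic_point m k) \<omega>\<bar> \<le> x) \<longrightarrow> sup_abs B 1 \<omega> \<le> x + a)"
proof -
  define \<nu> where "\<nu> = CARD('n)"
  have \<nu>: "1 \<le> \<nu>" by (simp add: \<nu>_def Suc_le_eq)
  define g where "g d = 2 powr (- (real d * h / 2))" for d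
  have g: "summable g" "\<And>d. 0 \<le> g d"
  proof -
    have "g = (\<lambda>d. (2 powr (- (h / 2))) ^ d)" by (simp add: g_def fun_eq_iff powr_power mult_ac)
    moreover have "2 powr (- (h / 2)) < (1::real)" using h by (simp add: powr_less_one)
    ultimately show "summable g" by (simp add: summable_geometric)
  qed (simp add: g_def)
  define G where "G = suminf g"
  have G: "0 < G"
  proof -
    have "g 0 \<le> G" unfolding G_def using sum_le_suminf[OF g(1), of "{0}"] g(2) by simp
    then show ?thesis by (simp add: g_def)
  qed
  define Cq where "Cq = (fact (2 * q) / (2 ^ q * fact q) :: real)"
  have Cq: "0 < Cq" by (simp add: Cq_def)
  define K where "K = 2 ^ \<nu> * Cq * \<nu> powr (2 * h * q) * G ^ (2 * q)"
  have K: "0 \<le> K" using Cq G by (simp add: K_def)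
  have "\<exists>E\<in>sets M. measure M E \<le> K * 2 powr (- (m * h * q)) / a ^ (2 * q) \<and>
        (\<forall>\<omega>\<in>space M - E. \<forall>x. (\<forall>k\<in>dyadic_index m. \<bar>B (dyadic_point m k) \<omega>\<bar> \<le> x) \<longrightarrow> sup_abs B 1 \<omega> \<le> x + a)"
    if B: "mpfbm_process M h B" and a: "0 < a" for M :: "'a measure" and B :: "real^'n \<Rightarrow> 'a \<Rightarrow> real" and m a
  proof -
    interpret mpfbm_process M h B by fact
    let ?Y = "\<lambda>n k \<omega>. B (dyadic_point n k) \<omega> - B (dyadic_parent n k) \<omega>"
    \<comment> \<open>The tolerance a is shared out geometrically over the levels above m; G is the
      normalisation.\<close>
    define b where "b n = a / G * g (n - m)" for n
    have b: "0 < b n" for n using a G by (simp add: b_def g_def)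
    define E where "E d = (\<Union>k\<in>dyadic_index (m + Suc d). {\<omega>\<in>space M. b (m + Suc d) ^ (2 * q) \<le> ?Y (m + Suc d) k \<omega> ^ (2 * q)})" for d
    have Em: "{\<omega>\<in>space M. b n ^ (2 * q) \<le> ?Y n k \<omega> ^ (2 * q)} \<in> sets M" if "k \<in> dyadic_index n" for n k
      using dyadic_increment_measurable[OF that] by measurable
    have E_sets: "E d \<in> sets M" for d
      unfolding E_def using Em by (intro sets.finite_UN) auto
    have E_bound: "measure M (E d) \<le> K * 2 powr (- (m * h * q)) / a ^ (2 * q) * (1 / 2) ^ Suc d" for d
    proof -
      define D where "D = Suc d"
      define n where "n = m + D"
      let ?I = "dyadic_index n :: ('n \<Rightarrow> nat) set"
      have "measure M (E d) \<le> (\<Sum>k\<in>?I. measure M {\<omega>\<in>space M. b n ^ (2 * q) \<le> ?Y n k \<omega> ^ (2 * q)})"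
        unfolding E_def n_def D_def using Em by (intro finite_measure_subadditive_finite) auto
      also have "\<dots> \<le> (\<Sum>k\<in>?I. Cq * ((\<nu> / 2 ^ n) powr (2 * h)) ^ q / b n ^ (2 * q))"
      proof (rule sum_mono)
        fix k assume k: "k \<in> ?I"
        have "measure M {\<omega>\<in>space M. b n ^ (2 * q) \<le> ?Y n k \<omega> ^ (2 * q)} \<le> expectation (\<lambda>\<omega>. ?Y n k \<omega> ^ (2 * q)) / b n ^ (2 * q)"
          by (rule integral_Markov_inequality_measure[where A="{}"]) (use b dyadic_increment_moment(1)[OF k] in auto)
        also have "\<dots> \<le> Cq * ((\<nu> / 2 ^ n) powr (2 * h)) ^ q / b n ^ (2 * q)"
          using dyadic_increment_moment(2)[OF k, of q] b[of n] by (intro divide_right_mono) (auto simp: Cq_def \<nu>_def)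
        finally show "measure M {\<omega>\<in>space M. b n ^ (2 * q) \<le> ?Y n k \<omega> ^ (2 * q)} \<le> Cq * ((\<nu> / 2 ^ n) powr (2 * h)) ^ q / b n ^ (2 * q)" .
      qed
      also have "\<dots> = real ((2 ^ n + 1) ^ \<nu>) * (Cq * ((\<nu> / 2 ^ n) powr (2 * h)) ^ q / b n ^ (2 * q))"
        by (simp add: card_dyadic_index \<nu>_def)
      also have "\<dots> \<le> (2 ^ \<nu> * 2 powr (n * \<nu>)) * (Cq * ((\<nu> / 2 ^ n) powr (2 * h)) ^ q / b n ^ (2 * q))"
      proof (rule mult_right_mono)
        have "(2 ^ n + 1) ^ \<nu> \<le> (2 * 2 ^ n :: real) ^ \<nu>" by (intro power_mono) auto
        also have "\<dots> = 2 ^ \<nu> * 2 powr (n * \<nu>)" by (simp add: power_mult_distrib powr_realpow[symmetric] powr_power powr_powr mult_ac)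
        finally show "real ((2 ^ n + 1) ^ \<nu>) \<le> 2 ^ \<nu> * 2 powr (n * \<nu>)" by (simp add: add.commute)
      qed (use Cq b[of n] in \<open>auto intro!: divide_nonneg_nonneg mult_nonneg_nonneg\<close>)
      also have "((\<nu> / 2 ^ n) powr (2 * h)) ^ q = \<nu> powr (2 * h * q) * 2 powr (- (2 * n * h * q))"
        using \<nu> by (simp add: powr_power powr_divide powr_realpow[symmetric] powr_powr powr_minus_divide mult_ac)
      also have "b n ^ (2 * q) = (a ^ (2 * q) / G ^ (2 * q)) * 2 powr (- (D * h * q))"
        by (simp add: b_def g_def n_def power_mult_distrib power_divide powr_power mult_ac)
      also have "(2 ^ \<nu> * 2 powr (n * \<nu>)) * (Cq * (\<nu> powr (2 * h * q) * 2 powr (- (2 * n * h * q))) / ((a ^ (2 * q) / G ^ (2 * q)) * 2 powr (- (D * h * q))))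
          = K / a ^ (2 * q) * (2 powr (n * \<nu>) * (2 powr (- (2 * n * h * q)) / 2 powr (- (D * h * q))))"
        by (simp add: K_def)
      also have "2 powr (n * \<nu>) * (2 powr (- (2 * n * h * q)) / 2 powr (- (D * h * q))) = 2 powr (n * \<nu> - 2 * n * h * q + D * h * q)"
        by (simp add: powr_diff[symmetric] powr_add[symmetric] algebra_simps)
      \<comment> \<open>As q * h \<ge> \<nu> + 1, the moment beats the 2 powr (n * \<nu>) points and
        leaves 2 powr (- D) for summing over the levels.\<close>
      also have "\<dots> \<le> 2 powr (- (m * h * q) - D)"
      proof (rule powr_mono)
        have "real \<nu> - q * h \<le> - 1" using q by (simp add: \<nu>_def)
        then have "real n * (real \<nu> - q * h) \<le> real n * (- 1)" by (intro mult_left_mono) auto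
        then have "real n * real \<nu> - real n * (q * h) \<le> - real n" by (simp add: right_diff_distrib)
        moreover have "real D \<le> real n" by (simp add: n_def)
        moreover have "n * \<nu> - 2 * n * h * q + D * h * q = real n * real \<nu> - real n * (q * h) - m * h * q"
          by (simp add: n_def algebra_simps)
        ultimately show "n * \<nu> - 2 * n * h * q + D * h * q \<le> - (m * h * q) - D" by linarith
      qed simp
      also have "\<dots> = 2 powr (- (m * h * q)) * (1 / 2) ^ D"
        by (simp add: powr_diff powr_realpow power_one_over)
      finally show ?thesis
        using K a by (simp add: D_def mult_left_mono divide_right_mono)
    qed
    have geo: "(\<lambda>d. (1 / 2 :: real) ^ Suc d) sums 1" using power_half_series .
    let ?E = "\<Union>d. E d"
    have sE: "summable (\<lambda>d. measure M (E d))"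
      by (rule summable_comparison_test'[where g="\<lambda>d. K * 2 powr (- (m * h * q)) / a ^ (2 * q) * (1 / 2) ^ Suc d" and N=0])
        (use sums_summable[OF geo] E_bound in \<open>auto intro: summable_mult\<close>)
    have "measure M ?E \<le> (\<Sum>d. measure M (E d))"
      using E_sets sE by (intro finite_measure_subadditive_countably) auto
    also have "\<dots> \<le> (\<Sum>d. K * 2 powr (- (m * h * q)) / a ^ (2 * q) * (1 / 2) ^ Suc d)"
      by (rule suminf_le[OF E_bound sE summable_mult[OF sums_summable[OF geo]]])
    also have "\<dots> = K * 2 powr (- (m * h * q)) / a ^ (2 * q)"
      by (rule trans[OF sums_unique[OF sums_mult[OF geo], symmetric]]) simp
    finally have "measure M ?E \<le> K * 2 powr (- (m * h * q)) / a ^ (2 * q)" .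
    moreover have "sup_abs B 1 \<omega> \<le> x + a"
      if \<omega>: "\<omega> \<in> space M - ?E" and x: "\<forall>k\<in>dyadic_index m. \<bar>B (dyadic_point m k) \<omega>\<bar> \<le> x" for \<omega> x
    proof (rule sup_abs_chaining[where m=m and b=b])
      show "\<omega> \<in> space M" using \<omega> by simp
      fix n and k :: "'n \<Rightarrow> nat" assume n: "m < n" and k: "k \<in> dyadic_index n"
      obtain d where d: "n = m + Suc d" using n less_iff_Suc_add by auto
      have "\<omega> \<notin> E d" using \<omega> by auto
      then have "?Y n k \<omega> ^ (2 * q) < b n ^ (2 * q)"
        using \<omega> k unfolding E_def d by (auto simp: not_le)
      then have "\<bar>?Y n k \<omega>\<bar> ^ (2 * q) < b n ^ (2 * q)" by (simp add: power_even_abs)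
      then show "\<bar>?Y n k \<omega>\<bar> \<le> b n" using b[of n] by (meson less_imp_le power_less_imp_less_base)
    next
      fix n
      have "(\<Sum>j\<in>{m<..n}. b j) = a / G * (\<Sum>j\<in>{m<..n}. g (j - m))" by (simp add: b_def sum_distrib_left)
      also have "(\<Sum>j\<in>{m<..n}. g (j - m)) = (\<Sum>d\<in>(\<lambda>j. j - m) ` {m<..n}. g d)"
        by (subst sum.reindex) (auto simp: inj_on_def)
      also have "a / G * \<dots> \<le> a / G * G"
        unfolding G_def using g a G by (intro mult_left_mono sum_le_suminf) (auto simp: G_def)
      also have "\<dots> = a" using G by simp
      finally show "(\<Sum>j\<in>{m<..n}. b j) \<le> a" .
    qed (use x in auto)
    ultimately show ?thesis using E_sets by (intro bexI[of _ ?E]) auto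
  qed
  then show ?thesis using that K by blast
qed

section \<open>Small-ball constants at radius 1\<close>

context mpfbm_process
begin

lemma sup_abs_prob_rescale:
  assumes r: "0 < r" and x: "0 < x"
  shows "measure M {\<omega>\<in>space M. sup_abs B r \<omega> \<le> r powr (CARD('n) * h) * x} = measure M {\<omega>\<in>space M. sup_abs B 1 \<omega> \<le> x}"
proof -
  let ?B = "\<lambda>t \<omega>. B (r *\<^sub>R t) \<omega> / r powr (CARD('n) * h)"
  have "{\<omega>\<in>space M. sup_abs B r \<omega> \<le> r powr (CARD('n) * h) * x} = {\<omega>\<in>space M. sup_abs ?B 1 \<omega> \<le> x}"
    using r by (auto simp: sup_abs_rescale)
  also have "measure M \<dots> = measure M {\<omega>\<in>space M. sup_abs B 1 \<omega> \<le> x}"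
    by (rule sup_abs_1_prob_eq[OF rescaled_mpfbm[OF r] mpfbm_process_axioms x])
  finally show ?thesis .
qed

lemma scaled_exponent:
  assumes "0 < r" "0 < \<epsilon>"
  shows "r ^ (CARD('n)\<^sup>2) / (r powr (CARD('n) * h) * \<epsilon>) powr (real CARD('n) / h) = 1 / \<epsilon> powr (CARD('n) / h)"
proof -
  have "(r powr (CARD('n) * h)) powr (real CARD('n) / h) = r powr (real (CARD('n)\<^sup>2))"
    using h by (simp add: powr_powr power2_eq_square)
  also have "\<dots> = r ^ (CARD('n)\<^sup>2)" using assms(1) by (rule powr_realpow)
  finally show ?thesis using assms by (simp add: powr_mult)
qed

text \<open>By self-similarity the condition at radius r is the one at radius 1 with \<epsilon>
  multiplied by r powr (CARD('n) * h), and this substitution preserves limits at 0 from the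
  right.\<close>

lemma small_ball_constants_iff:
  "small_ball_constants M h B \<kappa>1 \<kappa>2 \<longleftrightarrow> 0 < \<kappa>1 \<and> \<kappa>1 \<le> \<kappa>2 \<and>
    (\<forall>\<^sub>F \<epsilon> in at_right 0. exp (- \<kappa>2 / \<epsilon> powr (CARD('n) / h)) \<le> measure M {\<omega>\<in>space M. sup_abs B 1 \<omega> \<le> \<epsilon>} \<and>
       measure M {\<omega>\<in>space M. sup_abs B 1 \<omega> \<le> \<epsilon>} \<le> exp (- \<kappa>1 / \<epsilon> powr (CARD('n) / h)))"
  (is "_ \<longleftrightarrow> _ \<and> _ \<and> eventually ?P _")
proof -
  let ?Q = "\<lambda>r \<epsilon>. exp (- \<kappa>2 * (r ^ (CARD('n)\<^sup>2) / \<epsilon> powr (real CARD('n) / h)))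
          \<le> measure M {\<omega> \<in> space M. sup_abs B r \<omega> \<le> \<epsilon>} \<and>
        measure M {\<omega> \<in> space M. sup_abs B r \<omega> \<le> \<epsilon>}
          \<le> exp (- \<kappa>1 * (r ^ (CARD('n)\<^sup>2) / \<epsilon> powr (real CARD('n) / h)))"
  have eq: "?Q r (r powr (CARD('n) * h) * \<epsilon>) \<longleftrightarrow> ?P \<epsilon>" if "0 < r" "0 < \<epsilon>" for r \<epsilon>
    unfolding scaled_exponent[OF that] sup_abs_prob_rescale[OF that] by simp
  have scale: "eventually (?Q r) (at_right 0) \<longleftrightarrow> eventually ?P (at_right 0)" if r: "0 < r" for r
  proof
    let ?c = "r powr (CARD('n) * h)"
    have c: "0 < ?c" using r by simp
    assume "eventually (?Q r) (at_right 0)"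
    moreover have "filterlim (\<lambda>\<epsilon>. ?c * \<epsilon>) (at_right 0) (at_right 0)"
      by (rule filterlim_times_pos[OF filterlim_ident c]) simp
    ultimately have "\<forall>\<^sub>F \<epsilon> in at_right 0. ?Q r (?c * \<epsilon>)" by (rule eventually_compose_filterlim)
    then show "eventually ?P (at_right 0)"
      using eventually_at_right_less[of "0::real"] by eventually_elim (use eq[OF r] in blast)
  next
    let ?c = "r powr (CARD('n) * h)"
    have c: "0 < 1 / ?c" using r by simp
    assume "eventually ?P (at_right 0)"
    moreover have "filterlim (\<lambda>\<epsilon>. 1 / ?c * \<epsilon>) (at_right 0) (at_right 0)"
      by (rule filterlim_times_pos[OF filterlim_ident c]) simp
    ultimately have "\<forall>\<^sub>F \<epsilon> in at_right 0. ?P (1 / ?c * \<epsilon>)" by (rule eventually_compose_filterlim)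
    then show "eventually (?Q r) (at_right 0)"
      using eventually_at_right_less[of "0::real"]
    proof eventually_elim
      case (elim \<epsilon>)
      then have "0 < 1 / ?c * \<epsilon>" using c by simp
      then have "?Q r (?c * (1 / ?c * \<epsilon>))" using eq[OF r] elim(1) by blast
      moreover have "?c * (1 / ?c * \<epsilon>) = \<epsilon>" using r by simp
      ultimately show ?case by simp
    qed
  qed
  have "(\<forall>r\<in>{0<..<1}. eventually (?Q r) (at_right 0)) \<longleftrightarrow> eventually ?P (at_right 0)"
  proof
    assume "\<forall>r\<in>{0<..<1}. eventually (?Q r) (at_right 0)"
    \<comment> \<open>By \<open>scale\<close> all radii are equivalent; 1/2 is an arbitrary
      one.\<close>
    then have "eventually (?Q (1/2)) (at_right 0)" by (rule bspec) simp
    then show "eventually ?P (at_right 0)" by (subst (asm) scale) simp_all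
  next
    assume P: "eventually ?P (at_right 0)"
    show "\<forall>r\<in>{0<..<1}. eventually (?Q r) (at_right 0)"
    proof
      fix r :: real assume "r \<in> {0<..<1}"
      then show "eventually (?Q r) (at_right 0)" using P by (subst scale) auto
    qed
  qed
  then show ?thesis unfolding small_ball_constants_def by simp
qed

lemma small_ball_constants_exist: "\<exists>\<kappa>1 \<kappa>2. small_ball_constants M h B \<kappa>1 \<kappa>2"
proof -
  obtain \<kappa>1 where 1: "0 < \<kappa>1" "\<forall>\<^sub>F \<epsilon> in at_right 0. measure M {\<omega>\<in>space M. sup_abs B 1 \<omega> \<le> \<epsilon>} \<le> exp (- \<kappa>1 / \<epsilon> powr (CARD('n) / h))"
    using small_ball_upper_bound by blast
  obtain \<kappa>2 where 2: "0 < \<kappa>2" "\<forall>\<^sub>F \<epsilon> in at_right 0. exp (- \<kappa>2 / \<epsilon> powr (CARD('n) / h)) \<le> measure M {\<omega>\<in>space M. sup_abs B 1 \<omega> \<le> \<epsilon>}"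
    using small_ball_lower_bound by blast
  have "\<forall>\<^sub>F \<epsilon> in at_right 0. exp (- max \<kappa>1 \<kappa>2 / \<epsilon> powr (CARD('n) / h)) \<le> measure M {\<omega>\<in>space M. sup_abs B 1 \<omega> \<le> \<epsilon>} \<and>
       measure M {\<omega>\<in>space M. sup_abs B 1 \<omega> \<le> \<epsilon>} \<le> exp (- \<kappa>1 / \<epsilon> powr (CARD('n) / h))"
    using 1(2) 2(2)
  proof eventually_elim
    case (elim \<epsilon>)
    have "\<kappa>2 / \<epsilon> powr (CARD('n) / h) \<le> max \<kappa>1 \<kappa>2 / \<epsilon> powr (CARD('n) / h)" by (rule divide_right_mono) auto
    then have "exp (- max \<kappa>1 \<kappa>2 / \<epsilon> powr (CARD('n) / h)) \<le> exp (- \<kappa>2 / \<epsilon> powr (CARD('n) / h))" by simp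
    then show ?case using elim by linarith
  qed
  then have "small_ball_constants M h B \<kappa>1 (max \<kappa>1 \<kappa>2)" using 1(1) by (simp add: small_ball_constants_iff)
  then show ?thesis by blast
qed

end

section \<open>The law of the iterated logarithm\<close>

lemma mpfbm_cov_commute:
  fixes s t :: "real^'n"
  assumes "0 \<le> s" "0 \<le> t"
  shows "mpfbm_cov h s t = mpfbm_cov h t s"
  using assms by (simp add: mpfbm_cov_eq rect_dist_commute[of s t])

lemma summable_inverse_square_bigo:
  assumes "f \<in> O(\<lambda>k. 1 / real k ^ 2)"
  shows "summable (f :: nat \<Rightarrow> real)"
proof (rule summable_comparison_test_bigo[OF _ assms])
  have "summable (\<lambda>k. inverse (real k ^ 2))" by (rule inverse_power_summable) simp
  then show "summable (\<lambda>k. norm (1 / real k ^ 2))" by (simp add: inverse_eq_divide)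
qed

lemma Psi_l_pos: "0 < r \<Longrightarrow> r < exp (- 1) \<Longrightarrow> 0 < Psi_l \<nu> h r"
proof -
  assume r: "0 < r" "r < exp (- 1)"
  then have "ln r < - 1" using ln_less_cancel_iff[of r "exp (- 1)"] by simp
  then have "1 < ln (1 / r)" using r by (simp add: ln_div)
  then show ?thesis by (simp add: Psi_l_def)
qed

section \<open>Lower bound of the liminf\<close>

context mpfbm_process
begin

text \<open>The room between x and the limit constant is spent twice: on y, which makes the exponent
  s of the Borel--Cantelli series exceed 1, and on z, the loss from monotone interpolation between
  radii of ratio \<rho>.\<close>

lemma liminf_lower_aux:
  assumes "small_ball_constants M h B \<kappa>1 \<kappa>2" and x: "0 < x" "x < \<kappa>1 powr (h / CARD('n))"
  shows "AE \<omega> in M. \<forall>\<^sub>F r in at_right 0. x \<le> sup_abs B r \<omega> / (r powr (CARD('n) * h) * Psi_l CARD('n) h r)"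
proof -
  define \<beta> where "\<beta> = h / CARD('n)"
  have \<beta>: "0 < \<beta>" using h by (simp add: \<beta>_def)
  have inv\<beta>: "CARD('n) / h = 1 / \<beta>" by (simp add: \<beta>_def)
  have \<nu>h: "0 < CARD('n) * h" using h by simp
  \<comment> \<open>Midway between x and the limit constant.\<close>
  define y where "y = (x + \<kappa>1 powr \<beta>) / 2"
  have y: "x < y" "y < \<kappa>1 powr \<beta>" "0 < y" using x by (auto simp: y_def \<beta>_def)
  \<comment> \<open>Midway between x / y and 1; the gap above x / y absorbs the slow variation of
    \<psi>.\<close>
  define z where "z = (x / y + 1) / 2"
  have z: "x / y < z" "z < 1" "0 < z" using x y by (auto simp: z_def field_simps add_pos_pos)
  \<comment> \<open>Chosen so that passing to the next radius multiplies the normalisation by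
    exactly z.\<close>
  define \<rho> where "\<rho> = z powr (1 / (CARD('n) * h))"
  have \<rho>0: "0 < \<rho>" using z by (simp add: \<rho>_def)
  have \<rho>1: "\<rho> < 1" unfolding \<rho>_def using powr_less_mono2[of "1 / (CARD('n) * h)" z 1] z h by simp
  have \<rho>z: "\<rho> powr (CARD('n) * h) = z" using z h by (simp add: \<rho>_def powr_powr)
  define L where "L = ln (1 / \<rho>)"
  have L: "0 < L" using \<rho>0 \<rho>1 by (simp add: L_def)
  define \<psi> where "\<psi> k = ln (real k * L) powr (- \<beta>)" for k
  have \<psi>: "Psi_l CARD('n) h (\<rho> ^ k) = \<psi> k" for k
    using \<rho>0 by (simp add: Psi_l_def \<psi>_def L_def ln_div ln_realpow \<beta>_def)
  define s where "s = \<kappa>1 * y powr (- (1 / \<beta>))"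
  \<comment> \<open>The exponent s makes the small-ball estimate at radius \<rho> ^ k equal to (k *
    L) powr (- s); it exceeds 1 because y is below the limit constant.\<close>
  have \<kappa>1: "0 < \<kappa>1" using assms(1) by (simp add: small_ball_constants_iff)
  have s: "1 < s"
  proof -
    have "y powr (1 / \<beta>) < (\<kappa>1 powr \<beta>) powr (1 / \<beta>)" using y \<beta> by (intro powr_less_mono2) auto
    then have "y powr (1 / \<beta>) < \<kappa>1" using \<beta> \<kappa>1 by (simp add: powr_powr)
    then show ?thesis using y by (simp add: s_def powr_minus_divide)
  qed
  let ?A = "\<lambda>k. {\<omega>\<in>space M. sup_abs B (\<rho> ^ k) \<omega> \<le> (\<rho> ^ k) powr (CARD('n) * h) * (y * \<psi> k)}"
  have A_eq: "?A k = {\<omega>\<in>space M. sup_abs (\<lambda>t \<omega>. B (\<rho> ^ k *\<^sub>R t) \<omega> / (\<rho> ^ k) powr (CARD('n) * h)) 1 \<omega> \<le> y * \<psi> k}" for k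
    using \<rho>0 by (auto simp: sup_abs_rescale)
  have A_meas: "?A k \<in> sets M" for k
  proof -
    interpret R: mpfbm_process M h "\<lambda>t \<omega>. B (\<rho> ^ k *\<^sub>R t) \<omega> / (\<rho> ^ k) powr (CARD('n) * h)"
      using \<rho>0 by (intro rescaled_mpfbm) simp
    show ?thesis unfolding A_eq by (rule R.sup_abs_1_event_measurable)
  qed
  have lim: "filterlim (\<lambda>k. y * \<psi> k) (at_right 0) sequentially"
    unfolding \<psi>_def using y L \<beta> by real_asymp
  have Lk: "\<forall>\<^sub>F k in sequentially. exp 1 < real k * L" using L by real_asymp
  have "\<forall>\<^sub>F \<epsilon> in at_right 0. measure M {\<omega>\<in>space M. sup_abs B 1 \<omega> \<le> \<epsilon>} \<le> exp (- \<kappa>1 / \<epsilon> powr (1 / \<beta>))"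
    using assms(1) unfolding small_ball_constants_iff inv\<beta> by (auto elim: eventually_mono)
  from eventually_compose_filterlim[OF this lim] Lk
  have "\<forall>\<^sub>F k in sequentially. norm (measure M (?A k)) \<le> (real k * L) powr (- s)"
  proof eventually_elim
    case (elim k)
    have l1: "1 < ln (real k * L)"
      using elim(2) by (metis exp_gt_zero less_trans ln_exp ln_less_cancel_iff)
    then have pos: "0 < real k * L" "0 < \<psi> k"
      using elim(2) by (auto simp: \<psi>_def intro: less_trans[OF exp_gt_zero])
    have "(y * \<psi> k) powr (1 / \<beta>) = y powr (1 / \<beta>) * (1 / ln (real k * L))"
    proof -
      have "\<psi> k powr (1 / \<beta>) = ln (real k * L) powr (- 1)" using \<beta> by (simp add: \<psi>_def powr_powr)
      also have "\<dots> = 1 / ln (real k * L)" using l1 by (simp add: powr_minus_divide)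
      finally show ?thesis using y pos by (simp add: powr_mult)
    qed
    then have "\<kappa>1 / (y * \<psi> k) powr (1 / \<beta>) = s * ln (real k * L)"
      using y by (simp add: s_def powr_minus_divide)
    moreover have "(real k * L) powr (- s) = exp (- (s * ln (real k * L)))"
    proof -
      have "w powr (- s) = exp (- (s * ln w))" if "0 < w" for w :: real using that by (simp add: powr_def)
      then show ?thesis using pos(1) .
    qed
    ultimately show ?case
      using elim(1) sup_abs_prob_rescale[of "\<rho> ^ k" "y * \<psi> k"] \<rho>0 y pos by simp
  qed
  moreover have "summable (\<lambda>k. (real k * L) powr (- s))"
  proof -
    have "summable (\<lambda>k. L powr (- s) * real k powr (- s))"
      using s by (intro summable_mult) (simp add: summable_real_powr_iff)
    then show ?thesis using L by (simp add: powr_mult mult.commute)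
  qed
  ultimately have summ: "summable (\<lambda>k. measure M (?A k))" by (rule summable_comparison_test_ev)
  have "emeasure M (?A k) < \<infinity>" for k unfolding emeasure_eq_measure by simp
  from borel_cantelli_AE1[OF A_meas this summ]
  have BC: "AE \<omega> in M. \<forall>\<^sub>F k in sequentially. \<omega> \<in> space M - ?A k" .
  have ratio: "\<forall>\<^sub>F k in sequentially. x / (y * z) < \<psi> (Suc k) / \<psi> k"
  proof (rule order_tendstoD(1))
    show "(\<lambda>k. \<psi> (Suc k) / \<psi> k) \<longlonglongrightarrow> 1" unfolding \<psi>_def using L \<beta> by real_asymp
    show "x / (y * z) < 1" using z y by (simp add: field_simps)
  qed
  from BC show ?thesis
  proof eventually_elim
    case (elim \<omega>)
    from elim have "\<forall>\<^sub>F k in sequentially. \<omega> \<in> space M - ?A (Suc k)"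
      by (subst eventually_sequentially_Suc)
    with ratio Lk have "\<forall>\<^sub>F k in sequentially. \<omega> \<in> space M - ?A (Suc k) \<and> x / (y * z) < \<psi> (Suc k) / \<psi> k \<and> exp 1 < real k * L"
      by eventually_elim auto
    then obtain k0 where k0: "\<And>k. k \<ge> k0 \<Longrightarrow> \<omega> \<in> space M - ?A (Suc k) \<and> x / (y * z) < \<psi> (Suc k) / \<psi> k \<and> exp 1 < real k * L"
      unfolding eventually_sequentially by blast
    have \<omega>: "\<omega> \<in> space M" using k0[of k0] by simp
    have "x \<le> sup_abs B r \<omega> / (r powr (CARD('n) * h) * Psi_l CARD('n) h r)" if r: "0 < r" "r < \<rho> ^ k0" for r
    proof -
      have "\<exists>n. \<rho> ^ n < r" using r(1) \<rho>1 by (rule real_arch_pow_inv)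
      \<comment> \<open>The first radius below r: then \<rho> ^ (k + 1) < r \<le> \<rho> ^ k for N =
        k + 1, and the supremum is bounded below on the smaller cube.\<close>
      define N where "N = (LEAST n. \<rho> ^ n < r)"
      have N: "\<rho> ^ N < r" unfolding N_def using \<open>\<exists>n. \<rho> ^ n < r\<close> by (rule LeastI_ex)
      have "k0 < N"
      proof (rule ccontr)
        assume "\<not> k0 < N"
        then have "\<rho> ^ k0 \<le> \<rho> ^ N" using \<rho>0 \<rho>1 by (intro power_decreasing) auto
        then show False using N r by simp
      qed
      then obtain k where k: "N = Suc k" "k0 \<le> k" by (cases N) auto
      have rk: "r \<le> \<rho> ^ k"
      proof (rule ccontr)
        assume "\<not> r \<le> \<rho> ^ k"
        then have "N \<le> k" unfolding N_def by (intro Least_le) simp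
        then show False using k by simp
      qed
      note K = k0[OF k(2)]
      have l1: "1 < ln (real k * L)"
        using K by (metis exp_gt_zero less_trans ln_exp ln_less_cancel_iff)
      have kL: "0 < real k * L" using K by (auto intro: less_trans[OF exp_gt_zero])
      have \<psi>k: "0 < \<psi> k" using l1 by (simp add: \<psi>_def)
      have "real k * L \<le> ln (1 / r)"
      proof -
        have "ln r \<le> ln (\<rho> ^ k)" using rk r by simp
        then show ?thesis using \<rho>0 r by (simp add: L_def ln_div ln_realpow)
      qed
      then have "ln (real k * L) \<le> ln (ln (1 / r))" using kL by simp
      then have \<Psi>: "Psi_l CARD('n) h r \<le> \<psi> k" "0 < Psi_l CARD('n) h r"
        using l1 \<beta> by (auto simp: Psi_l_def \<psi>_def \<beta>_def[symmetric] minus_divide_left[symmetric] intro!: powr_mono2')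
      have rp: "0 < r powr (CARD('n) * h)" using r by simp
      have step: "x * \<psi> k \<le> z * (y * \<psi> (Suc k))"
      proof -
        have "x * \<psi> k < \<psi> (Suc k) * (y * z)"
          using K \<psi>k y z by (simp add: divide_less_eq less_divide_eq mult_ac)
        then show ?thesis by (simp add: mult_ac)
      qed
      have "x * (r powr (CARD('n) * h) * Psi_l CARD('n) h r) \<le> r powr (CARD('n) * h) * (x * \<psi> k)"
        using \<Psi> x rp by (simp add: mult_left_mono mult_ac)
      also have "\<dots> \<le> r powr (CARD('n) * h) * (z * (y * \<psi> (Suc k)))"
        using step rp by (intro mult_left_mono) auto
      also have "\<dots> = (r powr (CARD('n) * h) * z) * (y * \<psi> (Suc k))" by simp
      also have "\<dots> \<le> (\<rho> ^ Suc k) powr (CARD('n) * h) * (y * \<psi> (Suc k))"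
      proof (rule mult_right_mono)
        have "r powr (CARD('n) * h) \<le> (\<rho> ^ k) powr (CARD('n) * h)" using rk r \<nu>h by (intro powr_mono2) auto
        then have "z * r powr (CARD('n) * h) \<le> z * (\<rho> ^ k) powr (CARD('n) * h)" using z by (intro mult_left_mono) auto
        also have "\<dots> = (\<rho> ^ Suc k) powr (CARD('n) * h)" using \<rho>0 by (simp add: powr_mult \<rho>z)
        finally show "r powr (CARD('n) * h) * z \<le> (\<rho> ^ Suc k) powr (CARD('n) * h)" by (simp add: mult.commute)
      qed (use y in \<open>simp add: \<psi>_def\<close>)
      also have "\<dots> \<le> sup_abs B (\<rho> ^ Suc k) \<omega>" using K by auto
      also have "\<dots> \<le> sup_abs B r \<omega>" using N k \<rho>0 by (intro sup_abs_mono[OF \<omega>]) auto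
      finally show ?thesis using rp \<Psi> by (simp add: le_divide_eq)
    qed
    then show ?case
      using \<rho>0 by (intro eventually_at_rightI[of 0 "\<rho> ^ k0"]) auto
  qed
qed

lemma liminf_lower:
  assumes C: "small_ball_constants M h B \<kappa>1 \<kappa>2"
  shows "AE \<omega> in M. ereal (\<kappa>1 powr (h / CARD('n)))
    \<le> Liminf (at_right 0) (\<lambda>r. ereal (sup_abs B r \<omega> / (r powr (CARD('n) * h) * Psi_l CARD('n) h r)))"
proof -
  let ?c = "\<kappa>1 powr (h / CARD('n))"
  have c: "0 < ?c" using C by (simp add: small_ball_constants_iff)
  \<comment> \<open>Countably many constants increasing to the limit, so that a single null set
    suffices.\<close>
  let ?x = "\<lambda>n. ?c * (1 - 1 / (real n + 2))"
  have x: "0 < ?x n" "?x n < ?c" for n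
  proof -
    have "0 < 1 - 1 / (real n + 2)" "1 - 1 / (real n + 2) < 1" by auto
    then show "0 < ?x n" "?x n < ?c"
      using c mult_strict_left_mono[of "1 - 1 / (real n + 2)" 1 ?c] by (auto intro: mult_pos_pos)
  qed
  have "AE \<omega> in M. \<forall>n. \<forall>\<^sub>F r in at_right 0. ?x n \<le> sup_abs B r \<omega> / (r powr (CARD('n) * h) * Psi_l CARD('n) h r)"
    unfolding AE_all_countable using liminf_lower_aux[OF C x] by blast
  then show ?thesis
  proof eventually_elim
    case (elim \<omega>)
    let ?l = "Liminf (at_right 0) (\<lambda>r. ereal (sup_abs B r \<omega> / (r powr (CARD('n) * h) * Psi_l CARD('n) h r)))"
    have le: "ereal (?x n) \<le> ?l" for n
      by (rule Liminf_bounded) (use elim in simp)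
    have lim: "(\<lambda>n. ereal (?x n)) \<longlonglongrightarrow> ereal ?c"
    proof (rule tendsto_ereal)
      have "(\<lambda>n. 1 - 1 / (real n + 2)) \<longlonglongrightarrow> 1" by real_asymp
      then show "?x \<longlonglongrightarrow> ?c" using tendsto_mult_left[of _ 1 _ ?c] by fastforce
    qed
    show ?case by (rule LIMSEQ_le_const2[OF lim]) (use le in blast)
  qed
qed

section \<open>Upper bound of the liminf\<close>

lemma rescaled_correlation_le:
  fixes s t :: "real^'n"
  assumes r: "0 < r" "0 < r'" and st: "s \<in> {0..vec 1}" "t \<in> {0..vec 1}"
  shows "\<bar>mpfbm_cov h (r *\<^sub>R s) (r' *\<^sub>R t)\<bar> / (r powr (CARD('n) * h) * r' powr (CARD('n) * h)) \<le> (r' / r) powr (CARD('n) * h)"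
proof -
  have "0 \<le> r *\<^sub>R s" "0 \<le> r' *\<^sub>R t" using r st by (auto simp: less_eq_vec_def)
  then have "\<bar>mpfbm_cov h (r *\<^sub>R s) (r' *\<^sub>R t)\<bar> \<le> (\<Prod>i\<in>UNIV. (r' *\<^sub>R t) $ i) powr (2 * h)"
    by (rule abs_mpfbm_cov_le[OF h])
  also have "\<dots> \<le> (r' ^ CARD('n)) powr (2 * h)"
  proof (rule powr_mono2)
    have "(\<Prod>i\<in>UNIV. (r' *\<^sub>R t) $ i) \<le> (\<Prod>i\<in>(UNIV::'n set). r')"
      using r st by (intro prod_mono) (auto simp: less_eq_vec_def mult_left_le)
    then show "(\<Prod>i\<in>UNIV. (r' *\<^sub>R t) $ i) \<le> r' ^ CARD('n)" by simp
    show "0 \<le> (\<Prod>i\<in>UNIV. (r' *\<^sub>R t) $ i)" using r st by (intro prod_nonneg) (auto simp: less_eq_vec_def)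
  qed (use h in simp)
  also have "\<dots> = r' powr (CARD('n) * h) * r' powr (CARD('n) * h)"
    using r by (simp add: powr_realpow[symmetric] powr_powr powr_add[symmetric] mult_ac)
  finally have "\<bar>mpfbm_cov h (r *\<^sub>R s) (r' *\<^sub>R t)\<bar> / (r powr (CARD('n) * h) * r' powr (CARD('n) * h))
     \<le> r' powr (CARD('n) * h) * r' powr (CARD('n) * h) / (r powr (CARD('n) * h) * r' powr (CARD('n) * h))"
    using r by (intro divide_right_mono) auto
  also have "\<dots> = (r' / r) powr (CARD('n) * h)" using r by (simp add: powr_divide)
  finally show ?thesis .
qed

text \<open>With target y k = x * c * Psi_l (r k), a positive product of trapezoids only gives x * y
  k on the net, and chaining adds (x - 1) * y k; the total is (2 * x - 1) * x * c * Psi_l (r k). The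
  events for Z have divergent expectations and small correlations, while the failures of chaining
  are summable.\<close>

lemma frequently_small:
  assumes C: "small_ball_constants M h B \<kappa>1 \<kappa>2" and x: "1 < x"
  shows "AE \<omega> in M. \<exists>\<^sub>F r in at_right 0.
    sup_abs B r \<omega> / (r powr (CARD('n) * h) * Psi_l CARD('n) h r) \<le> (2 * x - 1) * x * \<kappa>2 powr (h / CARD('n))"
proof -
  define \<nu> where "\<nu> = CARD('n)"
  have \<nu>: "1 \<le> \<nu>" by (simp add: \<nu>_def Suc_le_eq)
  define \<beta> where "\<beta> = h / \<nu>"
  have \<beta>: "0 < \<beta>" using h \<nu> by (simp add: \<beta>_def)
  have inv\<beta>: "CARD('n) / h = 1 / \<beta>" by (simp add: \<beta>_def \<nu>_def)
  define c where "c = \<kappa>2 powr \<beta>"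
  have \<kappa>2: "0 < \<kappa>2" using C by (auto simp: small_ball_constants_iff)
  have c: "0 < c" using \<kappa>2 by (simp add: c_def)
  \<comment> \<open>As ln (ln (1 / r k)) = a * ln k, this a makes the factor x in y k compensate the
    growth exponent: \<kappa>2 / y k powr (1 / \<beta>) is exactly ln k, so the small-ball bound is
    1 / k.\<close>
  define a where "a = x powr (1 / \<beta>)"
  define \<delta> where "\<delta> = a - 1"
  have a: "1 < a" "0 < a" "0 < \<delta>" "a = 1 + \<delta>"
    using x \<beta> by (auto simp: a_def \<delta>_def intro: gr_one_powr less_trans[OF zero_less_one gr_one_powr])
  define r where "r k = exp (- (real k powr a))" for k
  have r: "0 < r k" for k by (simp add: r_def)
  define y where "y k = x * c * (a * ln (real k)) powr (- \<beta>)" for k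
  have y0: "0 \<le> y k" for k using x c by (simp add: y_def)
  have ypos: "0 < y k" if "2 \<le> k" for k using that x c a by (simp add: y_def)
  have y_mono: "y j \<le> y i" if "2 \<le> i" "i \<le> j" for i j
    using that x c a \<beta> by (auto simp: y_def intro!: mult_left_mono powr_mono2')
  have y_Psi: "y k = x * c * Psi_l CARD('n) h (r k)" if "2 \<le> k" for k
  proof -
    have "ln (1 / r k) = real k powr a" by (simp add: r_def ln_div)
    then show ?thesis using that by (simp add: y_def Psi_l_def ln_powr \<beta>_def \<nu>_def)
  qed
  have ylim: "filterlim y (at_right 0) sequentially"
    unfolding y_def using a x c \<beta> by real_asymp
  define Bk where "Bk k = (\<lambda>t \<omega>. B (r k *\<^sub>R t) \<omega> / r k powr (CARD('n) * h))" for k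
  have Bk: "mpfbm_process M h (Bk k)" for k unfolding Bk_def by (rule rescaled_mpfbm[OF r])
  \<comment> \<open>A mesh of k powr (- p) in \<nu> dimensions amounts to about k powr (\<delta> /
    4) points.\<close>
  define p where "p = \<delta> / (4 * \<nu>)"
  have p: "0 < p" using a \<nu> by (simp add: p_def)
  define m where "m k = nat \<lfloor>log 2 (real k powr p)\<rfloor>" for k
  have m_up: "2 ^ m k \<le> real k powr p" and m_low: "real k powr p / 2 \<le> 2 powr (m k)" if k: "1 \<le> k" for k
  proof -
    define w where "w = real k powr p"
    have w: "1 \<le> w" using k p by (simp add: w_def ge_one_powr_ge_zero)
    then have l0: "0 \<le> log 2 w" by simp
    then have fl: "real (m k) = of_int \<lfloor>log 2 w\<rfloor>" by (simp add: m_def w_def)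
    have "(2::real) ^ m k = 2 powr (real (m k))" by (simp add: powr_realpow)
    also have "\<dots> \<le> 2 powr (log 2 w)" unfolding fl by (intro powr_mono) auto
    also have "\<dots> = w" using w by simp
    finally show "2 ^ m k \<le> real k powr p" by (simp only: w_def)
    have "w / 2 = 2 powr (log 2 w - 1)" using w by (simp add: powr_diff)
    also have "\<dots> \<le> 2 powr (real (m k))" unfolding fl by (intro powr_mono) linarith+
    finally show "real k powr p / 2 \<le> 2 powr (m k)" by (simp only: w_def)
  qed
  let ?I = "\<lambda>k. dyadic_index (m k) :: ('n \<Rightarrow> nat) set"
  define N where "N k = 2 ^ \<nu> * real k powr (\<delta> / 4)" for k :: nat
  have card_le: "real (card (?I k)) \<le> N k" if k: "1 \<le> k" for k
  proof -
    have k1: "1 \<le> real k powr p" using k p by (simp add: ge_one_powr_ge_zero)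
    have "real (card (?I k)) = (2 ^ m k + 1) ^ \<nu>" by (simp add: card_dyadic_index \<nu>_def add.commute)
    also have "\<dots> \<le> (2 * real k powr p) ^ \<nu>" using m_up[OF k] k1 by (intro power_mono) auto
    also have "\<dots> = N k" using k \<nu> by (simp add: N_def power_mult_distrib powr_power p_def)
    finally show ?thesis .
  qed
  have N_mono: "N i \<le> N j" if "i \<le> j" for i j
    using that a by (simp add: N_def powr_mono2)
  obtain s \<Lambda> where "trapezoid_representation x s \<Lambda>" using trapezoid_representation_exists[OF x] .
  then interpret T: trapezoid_representation x s \<Lambda> .
  define X where "X k i \<omega> = Bk k (dyadic_point (m k) i) \<omega> / y k" for k i \<omega>
  define Z where "Z k \<omega> = (\<Prod>i\<in>?I k. trapezoid x (X k i \<omega>))" for k \<omega>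
  have X_meas: "i \<in> ?I k \<Longrightarrow> X k i \<in> borel_measurable M" for i k
  proof -
    assume i: "i \<in> ?I k"
    interpret R: mpfbm_process M h "Bk k" by (rule Bk)
    have [measurable]: "Bk k (dyadic_point (m k) i) \<in> borel_measurable M"
      using dyadic_point_in_cube[OF i] by (intro R.B_measurable) auto
    show ?thesis unfolding X_def[abs_def] by measurable
  qed
  have Z_meas: "Z k \<in> borel_measurable M" for k
    unfolding Z_def using X_meas by measurable
  have Z01: "0 \<le> Z k \<omega> \<and> Z k \<omega> \<le> 1" for k \<omega>
    unfolding Z_def using x by (auto intro!: prod_nonneg prod_le_1 trapezoid_nonneg trapezoid_le_1)
  have Z_int: "integrable M (Z k)" for k
    by (rule integrable_const_bound[where B=1]) (use Z01 Z_meas in auto)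
  have EZ: "\<forall>\<^sub>F k in sequentially. 1 / real k \<le> expectation (Z k)"
  proof -
    have "\<forall>\<^sub>F \<epsilon> in at_right 0. exp (- \<kappa>2 / \<epsilon> powr (1 / \<beta>)) \<le> measure M {\<omega>\<in>space M. sup_abs B 1 \<omega> \<le> \<epsilon>}"
      using C unfolding small_ball_constants_iff inv\<beta> by (auto elim: eventually_mono)
    from eventually_compose_filterlim[OF this ylim] eventually_ge_at_top[of "2::nat"]
    show ?thesis
    proof eventually_elim
      case (elim k)
      have lk: "0 < ln (real k)" using elim by simp
      interpret R: mpfbm_process M h "Bk k" by (rule Bk)
      have "y k powr (1 / \<beta>) = a * \<kappa>2 * (1 / (a * ln (real k)))"
      proof -
        have l: "0 < a * ln (real k)" using a lk by simp
        have "((a * ln (real k)) powr (- \<beta>)) powr (1 / \<beta>) = (a * ln (real k)) powr (- 1)" using \<beta> by (simp add: powr_powr)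
        also have "\<dots> = 1 / (a * ln (real k))" using l by (simp add: powr_minus_divide)
        finally have 1: "((a * ln (real k)) powr (- \<beta>)) powr (1 / \<beta>) = 1 / (a * ln (real k))" .
        have 2: "x powr (1 / \<beta>) = a" "c powr (1 / \<beta>) = \<kappa>2" using \<beta> \<kappa>2 by (simp_all add: a_def c_def powr_powr)
        have "y k powr (1 / \<beta>) = x powr (1 / \<beta>) * c powr (1 / \<beta>) * ((a * ln (real k)) powr (- \<beta>)) powr (1 / \<beta>)"
          using x c unfolding y_def by (subst powr_mult powr_mult; simp)+
        then show ?thesis unfolding 1 2 .
      qed
      then have "\<kappa>2 / y k powr (1 / \<beta>) = ln (real k)" using a \<kappa>2 lk by simp
      then have "1 / real k = exp (- \<kappa>2 / y k powr (1 / \<beta>))"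
        using elim by (simp add: exp_minus inverse_eq_divide)
      also have "\<dots> \<le> measure M {\<omega>\<in>space M. sup_abs B 1 \<omega> \<le> y k}" by (rule elim(1))
      also have "\<dots> = measure M {\<omega>\<in>space M. sup_abs (Bk k) 1 \<omega> \<le> y k}"
        by (rule sup_abs_1_prob_eq[OF mpfbm_process_axioms Bk ypos[OF elim(2)]])
      also have "\<dots> = expectation (indicator {\<omega>\<in>space M. sup_abs (Bk k) 1 \<omega> \<le> y k})" by simp
      also have "\<dots> \<le> expectation (Z k)"
      proof (rule integral_mono[OF _ Z_int])
        show "integrable M (indicator {\<omega>\<in>space M. sup_abs (Bk k) 1 \<omega> \<le> y k} :: _ \<Rightarrow> real)"
          by (rule integrable_const_bound[where B=1]) (auto simp: indicator_def)
        fix \<omega>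
        show "indicator {\<omega>\<in>space M. sup_abs (Bk k) 1 \<omega> \<le> y k} \<omega> \<le> Z k \<omega>"
        proof (cases "\<omega> \<in> {\<omega>\<in>space M. sup_abs (Bk k) 1 \<omega> \<le> y k}")
          case True
          then have "\<bar>Bk k (dyadic_point (m k) i) \<omega>\<bar> \<le> y k" if "i \<in> ?I k" for i
            using R.sup_abs_1_le_iff_dyadic[of \<omega> "y k"] that by auto
          then have "\<bar>X k i \<omega>\<bar> \<le> 1" if "i \<in> ?I k" for i
            using that ypos[OF elim(2)] by (simp add: X_def divide_le_eq)
          then show ?thesis using x by (simp add: Z_def trapezoid_eq_1 indicator_def)
        next
          case False
          then show ?thesis using Z01[of k \<omega>] by (auto simp: indicator_def)
        qed
      qed
      finally show ?case .
    qed
  qed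
  have div: "\<not> summable (\<lambda>k. expectation (Z k))"
  proof
    assume S: "summable (\<lambda>k. expectation (Z k))"
    have "summable (\<lambda>k. 1 / real k)"
      by (rule summable_comparison_test_ev[OF _ S]) (use EZ in simp)
    then show False using not_summable_harmonic[where 'a=real] by (simp add: inverse_eq_divide)
  qed
  define S where "S = (LINT u|cauchy_law. sqrt \<bar>u\<bar>)\<^sup>2"
  have S: "0 \<le> S" by (simp add: S_def)
  \<comment> \<open>The summand 1 keeps \<alpha> positive also if \<Lambda> = 1.\<close>
  define \<alpha> where "\<alpha> = ln \<Lambda> + 1"
  have \<alpha>: "0 < \<alpha>" using T.\<Lambda> by (simp add: \<alpha>_def add_nonneg_pos)
  \<comment> \<open>The bound of \<open>quasi_independence\<close> with both nets replaced by the
    larger one: growth exp (2 * \<alpha> * N j) with N j of order j powr (\<delta> / 4), against a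
    decay in j powr \<delta>.\<close>
  define e where "e j = exp (2 * \<alpha> * N j) * (S * (2 * (N j)\<^sup>2 * (exp (- (\<nu> * h / 2 * real j powr \<delta>)) / y j)))" for j
  have e0: "0 \<le> e j" for j using S y0[of j] by (simp add: e_def)
  have e_sum: "summable (\<lambda>j. real j * e j)"
  proof (rule summable_inverse_square_bigo)
    define a1 where "a1 = 2 * \<alpha> * 2 ^ \<nu>"
    define b1 where "b1 = \<nu> * h / 2"
    \<comment> \<open>S + 1 in place of S, to have a strictly positive constant.\<close>
    define C1 where "C1 = (S + 1) * 2 * (2 ^ \<nu>)\<^sup>2 / (x * c)"
    have pos: "0 < a1" "0 < b1" "0 < C1" using \<alpha> \<nu> h S x c by (auto simp: a1_def b1_def C1_def intro!: divide_pos_pos mult_pos_pos)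
    have "(\<lambda>j. real j * e j) \<in> O(\<lambda>j. real j * (exp (a1 * real j powr (\<delta> / 4)) * (C1 * (real j powr (\<delta> / 4))\<^sup>2 * (exp (- (b1 * real j powr \<delta>)) * (a * ln (real j)) powr \<beta>))))"
    proof (rule landau_o.big_mono, rule always_eventually, rule allI)
      fix j
      have inv: "1 / y j = 1 / (x * c) * (a * ln (real j)) powr \<beta>"
        by (simp add: y_def powr_minus_divide)
      have "real j * e j = real j * (exp (a1 * real j powr (\<delta> / 4)) * (S * 2 * (2 ^ \<nu>)\<^sup>2 / (x * c) * (real j powr (\<delta> / 4))\<^sup>2 * (exp (- (b1 * real j powr \<delta>)) * (a * ln (real j)) powr \<beta>)))"
      proof -
        have "e j = exp (2 * \<alpha> * N j) * (S * (2 * (N j)\<^sup>2 * (exp (- (\<nu> * h / 2 * real j powr \<delta>)) * (1 / y j))))"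
          by (simp add: e_def)
        then show ?thesis unfolding inv by (simp add: N_def a1_def b1_def power_mult_distrib mult_ac)
      qed
      also have "\<dots> \<le> real j * (exp (a1 * real j powr (\<delta> / 4)) * (C1 * (real j powr (\<delta> / 4))\<^sup>2 * (exp (- (b1 * real j powr \<delta>)) * (a * ln (real j)) powr \<beta>)))"
        unfolding C1_def using x c by (intro mult_left_mono mult_right_mono divide_right_mono) auto
      finally show "norm (real j * e j) \<le> norm (real j * (exp (a1 * real j powr (\<delta> / 4)) * (C1 * (real j powr (\<delta> / 4))\<^sup>2 * (exp (- (b1 * real j powr \<delta>)) * (a * ln (real j)) powr \<beta>))))"
        using e0[of j] by simp
    qed
    also have "(\<lambda>j. real j * (exp (a1 * real j powr (\<delta> / 4)) * (C1 * (real j powr (\<delta> / 4))\<^sup>2 * (exp (- (b1 * real j powr \<delta>)) * (a * ln (real j)) powr \<beta>)))) \<in> O(\<lambda>j. 1 / real j ^ 2)"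
      using pos a \<beta> by real_asymp
    finally show "(\<lambda>j. real j * e j) \<in> O(\<lambda>j. 1 / real j ^ 2)" .
  qed
  have cov: "\<bar>expectation (\<lambda>\<omega>. Z i \<omega> * Z j \<omega>) - expectation (Z i) * expectation (Z j)\<bar> \<le> e j"
    if ij: "2 \<le> i" "i < j" for i j
  proof -
    have j2: "2 \<le> j" using ij by simp
    let ?pt = "\<lambda>w. case w of Inl u \<Rightarrow> r i *\<^sub>R dyadic_point (m i) u | Inr u \<Rightarrow> r j *\<^sub>R (dyadic_point (m j) u :: real^'n)"
    let ?b = "\<lambda>w. case w of Inl u \<Rightarrow> 1 / (r i powr (\<nu> * h) * y i) | Inr u \<Rightarrow> 1 / (r j powr (\<nu> * h) * y j)"
    let ?c = "\<lambda>w w'. ?b w * ?b w' * mpfbm_cov h (?pt w) (?pt w')"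
    let ?W = "\<lambda>w \<omega>. ?b w * B (?pt w) \<omega>"
    have pos: "0 \<le> r l *\<^sub>R (dyadic_point (m l) u :: real^'n)" if "u \<in> ?I l" for l u
      using dyadic_point_in_cube[OF that] r[of l] by (auto simp: less_eq_vec_def)
    have W_Inl: "?W (Inl u) \<omega> = X i u \<omega>" and W_Inr: "?W (Inr u) \<omega> = X j u \<omega>" for u \<omega>
      by (auto simp: X_def Bk_def \<nu>_def)
    have fam: "gaussian_family M (?I i <+> ?I j) ?W ?c"
      by (rule gaussian_family_scale[OF B_family(1)]) (use pos in auto)
    have fam1: "gaussian_family M (?I i) (\<lambda>u. ?W (Inl u)) (\<lambda>u v. ?c (Inl u) (Inl v))"
      by (rule gaussian_family_scale[OF B_family(1)[where K="?I i" and p="\<lambda>u. ?pt (Inl u)"], where b="\<lambda>u. ?b (Inl u)"])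
        (use pos in auto)
    have fam2: "gaussian_family M (?I j) (\<lambda>u. ?W (Inr u)) (\<lambda>u v. ?c (Inr u) (Inr v))"
      by (rule gaussian_family_scale[OF B_family(1)[where K="?I j" and p="\<lambda>u. ?pt (Inr u)"], where b="\<lambda>u. ?b (Inr u)"])
        (use pos in auto)
    \<comment> \<open>Written as a square because only its root enters the error term.\<close>
    define \<eta> where "\<eta> = (exp (- (\<nu> * h / 2 * real j powr \<delta>)) / y j)\<^sup>2"
    have y2: "0 < y i" "0 < y j" "y j \<le> y i" using ypos y_mono ij by auto
    have corr: "\<bar>mpfbm_cov h (r i *\<^sub>R dyadic_point (m i) u) (r j *\<^sub>R (dyadic_point (m j) v :: real^'n))\<bar>
        / (r i powr (\<nu> * h) * y i * (r j powr (\<nu> * h) * y j)) \<le> \<eta>"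
      if u: "u \<in> ?I i" and v: "v \<in> ?I j" for u v
    proof -
      have "\<bar>mpfbm_cov h (r i *\<^sub>R dyadic_point (m i) u) (r j *\<^sub>R (dyadic_point (m j) v :: real^'n))\<bar>
          / (r i powr (\<nu> * h) * r j powr (\<nu> * h)) \<le> (r j / r i) powr (\<nu> * h)"
        unfolding \<nu>_def by (rule rescaled_correlation_le[OF r r dyadic_point_in_cube[OF u] dyadic_point_in_cube[OF v]])
      also have "\<dots> \<le> exp (- (\<nu> * h * real j powr \<delta>))"
      proof -
        have pw: "real k powr a = real k * real k powr \<delta>" if "1 \<le> k" for k :: nat
          using that a(4) by (simp add: powr_add)
        \<comment> \<open>As i is at most j - 1, the exponents of the two radii differ by at least j
          powr \<delta>.\<close>
        have "real i * real i powr \<delta> \<le> (real j - 1) * real j powr \<delta>"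
          using ij a by (intro mult_mono powr_mono2) auto
        then have "real j powr \<delta> \<le> real j powr a - real i powr a"
          using ij by (simp add: pw left_diff_distrib)
        then have "real j powr \<delta> * (\<nu> * h) \<le> (real j powr a - real i powr a) * (\<nu> * h)"
          using h by (intro mult_right_mono) auto
        moreover have "(r j / r i) powr (\<nu> * h) = exp (- ((real j powr a - real i powr a) * (\<nu> * h)))"
          by (simp add: r_def exp_diff[symmetric] powr_def algebra_simps)
        ultimately show ?thesis by (simp add: mult_ac)
      qed
      finally have 1: "\<bar>mpfbm_cov h (r i *\<^sub>R dyadic_point (m i) u) (r j *\<^sub>R (dyadic_point (m j) v :: real^'n))\<bar>
          / (r i powr (\<nu> * h) * r j powr (\<nu> * h)) \<le> exp (- (\<nu> * h * real j powr \<delta>))" .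
      have "\<bar>mpfbm_cov h (r i *\<^sub>R dyadic_point (m i) u) (r j *\<^sub>R (dyadic_point (m j) v :: real^'n))\<bar>
          / (r i powr (\<nu> * h) * y i * (r j powr (\<nu> * h) * y j))
          = \<bar>mpfbm_cov h (r i *\<^sub>R dyadic_point (m i) u) (r j *\<^sub>R (dyadic_point (m j) v :: real^'n))\<bar>
          / (r i powr (\<nu> * h) * r j powr (\<nu> * h)) / (y i * y j)" by (simp add: mult_ac)
      also have "\<dots> \<le> exp (- (\<nu> * h * real j powr \<delta>)) / (y i * y j)"
        using 1 y2 by (intro divide_right_mono) auto
      \<comment> \<open>y decreases, so that the bound can be made to depend on the larger index
        only.\<close>
      also have "\<dots> \<le> exp (- (\<nu> * h * real j powr \<delta>)) / (y j * y j)"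
        using y2 by (intro divide_left_mono mult_right_mono) auto
      also have "\<dots> = \<eta>"
        by (simp add: \<eta>_def power_divide power2_eq_square exp_add[symmetric])
      finally show ?thesis .
    qed
    have "\<bar>(LINT \<omega>|M. (\<Prod>u\<in>?I i. trapezoid x (?W (Inl u) \<omega>)) * (\<Prod>v\<in>?I j. trapezoid x (?W (Inr v) \<omega>)))
      - (LINT \<omega>|M. (\<Prod>u\<in>?I i. trapezoid x (?W (Inl u) \<omega>))) * (LINT \<omega>|M. (\<Prod>v\<in>?I j. trapezoid x (?W (Inr v) \<omega>)))\<bar>
      \<le> \<Lambda> ^ (card (?I i) + card (?I j)) * ((LINT u|cauchy_law. sqrt \<bar>u\<bar>)\<^sup>2 * (2 * real (card (?I i)) * real (card (?I j)) * sqrt \<eta>))"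
    proof (rule T.quasi_independence[OF fam fam1 fam2])
      fix u v assume u: "u \<in> ?I i" and v: "v \<in> ?I j"
      have "mpfbm_cov h (r j *\<^sub>R dyadic_point (m j) v) (r i *\<^sub>R (dyadic_point (m i) u :: real^'n))
          = mpfbm_cov h (r i *\<^sub>R dyadic_point (m i) u) (r j *\<^sub>R (dyadic_point (m j) v :: real^'n))"
        by (rule mpfbm_cov_commute[OF pos[OF v] pos[OF u]])
      then show "\<bar>?c (Inl u) (Inr v)\<bar> \<le> \<eta> \<and> \<bar>?c (Inr v) (Inl u)\<bar> \<le> \<eta>"
        using corr[OF u v] y2 by (simp add: abs_mult mult_ac)
    qed
    then have "\<bar>expectation (\<lambda>\<omega>. Z i \<omega> * Z j \<omega>) - expectation (Z i) * expectation (Z j)\<bar>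
      \<le> \<Lambda> ^ (card (?I i) + card (?I j)) * (S * (2 * real (card (?I i)) * real (card (?I j)) * sqrt \<eta>))"
      unfolding W_Inl W_Inr Z_def S_def .
    also have "\<dots> \<le> exp (2 * \<alpha> * N j) * (S * (2 * N j * N j * sqrt \<eta>))"
    proof (intro mult_mono)
      have ci: "real (card (?I i)) \<le> N j" "real (card (?I j)) \<le> N j"
        using card_le[of i] card_le[of j] N_mono[of i j] ij by auto
      then show "real (card (?I i)) \<le> N j" "real (card (?I j)) \<le> N j" by auto
      have "\<Lambda> ^ (card (?I i) + card (?I j)) = exp (real (card (?I i) + card (?I j)) * ln \<Lambda>)"
        using T.\<Lambda> by (simp only: exp_of_nat_mult) simp
      also have "\<dots> \<le> exp (2 * \<alpha> * N j)"
      proof -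
        have "real (card (?I i) + card (?I j)) * ln \<Lambda> \<le> (2 * N j) * \<alpha>"
          using ci T.\<Lambda> by (intro mult_mono) (auto simp: \<alpha>_def N_def)
        then show ?thesis by (simp add: mult_ac)
      qed
      finally show "\<Lambda> ^ (card (?I i) + card (?I j)) \<le> exp (2 * \<alpha> * N j)" .
    qed (use S in \<open>auto simp: N_def \<eta>_def\<close>)
    also have "\<dots> = e j"
    proof -
      have "sqrt \<eta> = exp (- (\<nu> * h / 2 * real j powr \<delta>)) / y j"
        unfolding \<eta>_def using y2(2) by (simp only: real_sqrt_abs) simp
      then show ?thesis by (simp only: e_def power2_eq_square mult.assoc)
    qed
    finally show ?thesis .
  qed
  have freq: "AE \<omega> in M. \<exists>\<^sub>F k in sequentially. 0 < Z k \<omega>"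
    by (rule AE_frequently_pos_second_moment[OF Z_meas Z01 div e0 e_sum cov])
  \<comment> \<open>The first entry is what \<open>chaining_tail\<close> requires; the second turns
    the mesh into a factor k powr (- 3), which beats the powers of ln k.\<close>
  define q where "q = nat \<lceil>max ((\<nu> + 1) / h) (3 / (p * h))\<rceil>"
  have q: "real (\<nu> + 1) \<le> q * h" "3 \<le> p * h * q"
  proof -
    have "max ((\<nu> + 1) / h) (3 / (p * h)) \<le> q" unfolding q_def by linarith
    then have "(\<nu> + 1) / h \<le> q" "3 / (p * h) \<le> q" by auto
    then show "real (\<nu> + 1) \<le> q * h" "3 \<le> p * h * q" using h p by (auto simp: divide_le_eq mult_ac)
  qed
  obtain K where K: "0 \<le> K"
    "\<And>(M :: 'a measure) (B :: real^'n \<Rightarrow> 'a \<Rightarrow> real) m a. mpfbm_process M h B \<Longrightarrow> 0 < a \<Longrightarrow>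
      \<exists>E\<in>sets M. measure M E \<le> K * 2 powr (- (m * h * q)) / a ^ (2 * q) \<and>
        (\<forall>\<omega>\<in>space M - E. \<forall>x. (\<forall>k\<in>dyadic_index m. \<bar>B (dyadic_point m k) \<omega>\<bar> \<le> x) \<longrightarrow> sup_abs B 1 \<omega> \<le> x + a)"
    by (rule chaining_tail[OF h(1) q(1)[unfolded \<nu>_def], where 'a='a], rule that)
  \<comment> \<open>For k = 1 the tolerance y k is 0, so the claim starts at 2 and smaller indices
    get the empty set.\<close>
  have "\<exists>E. E \<in> sets M \<and> (2 \<le> k \<longrightarrow> measure M E \<le> K * 2 powr (- (m k * h * q)) / ((x - 1) * y k) ^ (2 * q) \<and>
        (\<forall>\<omega>\<in>space M - E. \<forall>u. (\<forall>i\<in>?I k. \<bar>Bk k (dyadic_point (m k) i) \<omega>\<bar> \<le> u) \<longrightarrow> sup_abs (Bk k) 1 \<omega> \<le> u + (x - 1) * y k))" for k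
  proof (cases "2 \<le> k")
    case True
    then have "0 < (x - 1) * y k" using x ypos by simp
    from K(2)[OF Bk[of k] this, of "m k"]
    show ?thesis by (elim bexE conjE, intro exI conjI impI) assumption+
  next
    case False
    then show ?thesis by (intro exI[of _ "{}"]) simp
  qed
  then obtain E where E: "\<And>k. E k \<in> sets M"
    "\<And>k. 2 \<le> k \<Longrightarrow> measure M (E k) \<le> K * 2 powr (- (m k * h * q)) / ((x - 1) * y k) ^ (2 * q)"
    "\<And>k \<omega> u. 2 \<le> k \<Longrightarrow> \<omega> \<in> space M - E k \<Longrightarrow> (\<And>i. i \<in> ?I k \<Longrightarrow> \<bar>Bk k (dyadic_point (m k) i) \<omega>\<bar> \<le> u) \<Longrightarrow>
        sup_abs (Bk k) 1 \<omega> \<le> u + (x - 1) * y k"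
    by metis
  have E_sum: "summable (\<lambda>k. measure M (E k))"
  proof (rule summable_inverse_square_bigo)
    define C2 where "C2 = K * 2 powr (h * q) / ((x - 1) * (x * c)) ^ (2 * q)"
    \<comment> \<open>The summand 1 makes the exponent strictly positive whatever the value of
      q.\<close>
    define g where "g = \<beta> * (2 * q) + 1"
    have g: "0 < g" using \<beta> by (simp add: g_def add_nonneg_pos)
    have "(\<lambda>k. measure M (E k)) \<in> O(\<lambda>k. C2 * real k powr (- 3) * (a * ln (real k)) powr g)"
    proof (rule landau_o.big_mono)
      have "\<forall>\<^sub>F k in sequentially. 1 \<le> a * ln (real k)" using a by real_asymp
      then show "\<forall>\<^sub>F k in sequentially. norm (measure M (E k)) \<le> norm (C2 * real k powr (- 3) * (a * ln (real k)) powr g)"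
        using eventually_ge_at_top[of "2::nat"]
      proof eventually_elim
        case (elim k)
        have k: "1 \<le> k" using elim by simp
        have "2 powr (- (m k * h * q)) = (2 powr m k) powr (- (h * q))" by (simp add: powr_powr mult_ac)
        also have "\<dots> \<le> (real k powr p / 2) powr (- (h * q))"
          using m_low[OF k] k h by (intro powr_mono2') auto
        also have "\<dots> = 2 powr (h * q) * real k powr (- (p * h * q))"
          using k by (simp add: powr_divide powr_powr powr_minus_divide mult_ac)
        also have "\<dots> \<le> 2 powr (h * q) * real k powr (- 3)"
          using k q by (intro mult_left_mono powr_mono) auto
        finally have 1: "2 powr (- (m k * h * q)) \<le> 2 powr (h * q) * real k powr (- 3)" .
        have yq: "((x - 1) * y k) ^ (2 * q) = ((x - 1) * (x * c)) ^ (2 * q) / (a * ln (real k)) powr (\<beta> * (2 * q))"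
        proof -
          have l0: "a * ln (real k) \<noteq> 0" using elim(1) by linarith
          have "(x - 1) * y k = ((x - 1) * (x * c)) / (a * ln (real k)) powr \<beta>"
            by (simp add: y_def powr_minus_divide)
          moreover have "((a * ln (real k)) powr \<beta>) ^ (2 * q) = (a * ln (real k)) powr (\<beta> * (2 * q))"
            using l0 by (subst powr_power) (auto simp: mult.commute)
          ultimately show ?thesis by (simp only: power_divide)
        qed
        have "measure M (E k) \<le> K * 2 powr (- (m k * h * q)) / ((x - 1) * y k) ^ (2 * q)"
          using E(2) elim by simp
        also have "\<dots> \<le> K * (2 powr (h * q) * real k powr (- 3)) / ((x - 1) * y k) ^ (2 * q)"
          using 1 K(1) x ypos[OF elim(2)] by (intro divide_right_mono mult_left_mono) auto
        also have "\<dots> = C2 * real k powr (- 3) * (a * ln (real k)) powr (\<beta> * (2 * q))"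
          unfolding yq by (simp add: C2_def)
        also have "\<dots> \<le> C2 * real k powr (- 3) * (a * ln (real k)) powr g"
          using elim K(1) x c by (intro mult_left_mono powr_mono) (auto simp: g_def C2_def)
        finally show ?case by (simp add: order_trans[OF _ abs_ge_self])
      qed
    qed
    also have "(\<lambda>k. C2 * real k powr (- 3) * (a * ln (real k)) powr g) \<in> O(\<lambda>k. 1 / real k ^ 2)"
      using a g by real_asymp
    finally show "(\<lambda>k. measure M (E k)) \<in> O(\<lambda>k. 1 / real k ^ 2)" .
  qed
  have "emeasure M (E k) < \<infinity>" for k unfolding emeasure_eq_measure by simp
  from borel_cantelli_AE1[OF E(1) this E_sum]
  have BC: "AE \<omega> in M. \<forall>\<^sub>F k in sequentially. \<omega> \<in> space M - E k" .
  have rlim: "filterlim r (at_right 0) sequentially"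
    unfolding r_def using a by real_asymp
  let ?f = "\<lambda>\<omega> r. sup_abs B r \<omega> / (r powr (CARD('n) * h) * Psi_l CARD('n) h r)"
  let ?C = "(2 * x - 1) * x * \<kappa>2 powr (h / CARD('n))"
  from freq BC show ?thesis
  proof eventually_elim
    case (elim \<omega>)
    have good: "?f \<omega> (r k) \<le> ?C" if k: "2 \<le> k" and Z: "0 < Z k \<omega>" and \<omega>: "\<omega> \<in> space M - E k" for k
    proof -
      \<comment> \<open>A positive product has no zero factor, so each normalised variable lies in
        the support of the trapezoid.\<close>
      have "\<bar>Bk k (dyadic_point (m k) i) \<omega>\<bar> \<le> x * y k" if i: "i \<in> ?I k" for i
      proof (rule ccontr)
        assume "\<not> ?thesis"
        then have "x \<le> \<bar>X k i \<omega>\<bar>" using ypos[OF k] by (simp add: X_def le_divide_eq)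
        then have "trapezoid x (X k i \<omega>) = 0" using x by (intro trapezoid_eq_0)
        then have "Z k \<omega> = 0" unfolding Z_def using i by (intro prod_zero) auto
        then show False using Z by simp
      qed
      then have "sup_abs (Bk k) 1 \<omega> \<le> x * y k + (x - 1) * y k" by (rule E(3)[OF k \<omega>])
      also have "\<dots> = (2 * x - 1) * y k" by (simp add: algebra_simps)
      finally have "sup_abs (Bk k) 1 \<omega> \<le> ?C * Psi_l CARD('n) h (r k)"
        by (simp add: y_Psi[OF k] c_def \<beta>_def \<nu>_def mult_ac)
      moreover have "0 < Psi_l CARD('n) h (r k)"
      proof -
        have "0 < x * c" using x c by simp
        then show ?thesis using ypos[OF k] unfolding y_Psi[OF k] by (rule zero_less_mult_pos[rotated])
      qed
      ultimately show ?thesis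
        using sup_abs_rescale[OF r[of k], of \<omega>] \<omega> r[of k] unfolding Bk_def by (simp add: divide_le_eq)
    qed
    show ?case
    proof (rule ccontr)
      assume "\<not> (\<exists>\<^sub>F r in at_right 0. ?f \<omega> r \<le> ?C)"
      then have "\<forall>\<^sub>F r in at_right 0. \<not> ?f \<omega> r \<le> ?C" by (simp add: not_frequently)
      from eventually_compose_filterlim[OF this rlim] elim(2) eventually_ge_at_top[of "2::nat"]
      have "\<forall>\<^sub>F k in sequentially. \<not> 0 < Z k \<omega>"
        by eventually_elim (use good in blast)
      then show False using elim(1) by (simp add: frequently_def)
    qed
  qed
qed

lemma liminf_upper:
  assumes C: "small_ball_constants M h B \<kappa>1 \<kappa>2"
  shows "AE \<omega> in M. Liminf (at_right 0) (\<lambda>r. ereal (sup_abs B r \<omega> / (r powr (CARD('n) * h) * Psi_l CARD('n) h r)))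
    \<le> ereal (\<kappa>2 powr (h / CARD('n)))"
proof -
  let ?c = "\<kappa>2 powr (h / CARD('n))"
  \<comment> \<open>Decreasing to 1, so that the constants \<open>?C n\<close> tend to the one
    claimed, off a single null set.\<close>
  let ?x = "\<lambda>n. 1 + 1 / (real n + 1)"
  let ?C = "\<lambda>n. (2 * ?x n - 1) * ?x n * ?c"
  have x: "1 < ?x n" for n by simp
  have "AE \<omega> in M. \<forall>n. \<exists>\<^sub>F r in at_right 0. sup_abs B r \<omega> / (r powr (CARD('n) * h) * Psi_l CARD('n) h r) \<le> ?C n"
    unfolding AE_all_countable using frequently_small[OF C x] by blast
  then show ?thesis
  proof eventually_elim
    case (elim \<omega>)
    let ?l = "Liminf (at_right 0) (\<lambda>r. ereal (sup_abs B r \<omega> / (r powr (CARD('n) * h) * Psi_l CARD('n) h r)))"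
    have le: "?l \<le> ereal (?C n)" for n
    proof (rule ccontr)
      assume "\<not> ?l \<le> ereal (?C n)"
      then have "\<forall>\<^sub>F r in at_right 0. ereal (?C n) < ereal (sup_abs B r \<omega> / (r powr (CARD('n) * h) * Psi_l CARD('n) h r))"
        by (intro less_LiminfD) simp
      then have "\<forall>\<^sub>F r in at_right 0. \<not> sup_abs B r \<omega> / (r powr (CARD('n) * h) * Psi_l CARD('n) h r) \<le> ?C n"
        by eventually_elim simp
      then show False using elim by (simp add: frequently_def)
    qed
    have lim: "(\<lambda>n. ereal (?C n)) \<longlonglongrightarrow> ereal ?c"
    proof (rule tendsto_ereal)
      have "(\<lambda>n. (2 * ?x n - 1) * ?x n) \<longlonglongrightarrow> 1" by real_asymp
      then show "?C \<longlonglongrightarrow> ?c" using tendsto_mult_right[of _ 1 _ ?c] by fastforce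
    qed
    show ?case by (rule LIMSEQ_le_const[OF lim]) (use le in blast)
  qed
qed

end

theorem theorem3:
  fixes h :: real
    and M :: "'a measure" and B :: "real^'n \<Rightarrow> 'a \<Rightarrow> real"
    and J :: "(real^'n \<Rightarrow> real) \<Rightarrow> 'e::{real_inner, polish_space}"
    and \<mu> P \<Delta> :: "'e measure"
  assumes "0 < h" and "h < 1 / 2"
    and "mpfbm M h B"
    and "abstract_wiener_space J \<mu>"
    and "wiener_stable_law J \<mu> h P"
    and "levy_measure_of P \<Delta>"
  shows "(\<exists>\<kappa>1 \<kappa>2. small_ball_constants M h B \<kappa>1 \<kappa>2) \<and>
    (\<exists>\<eta>0>0. \<forall>\<eta> k0 \<Psi>u \<kappa>1 \<kappa>2.
       0 < \<eta> \<and> \<eta> < \<eta>0 \<and>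
       admissible_start (F_fun J \<mu> \<Delta>) CARD('n) h \<eta> k0 \<and>
       upper_rate (F_fun J \<mu> \<Delta>) CARD('n) h \<eta> k0 \<Psi>u \<and>
       small_ball_constants M h B \<kappa>1 \<kappa>2 \<longrightarrow>
       (AE \<omega> in M.
          ereal (\<kappa>1 powr (h / CARD('n)))
            \<le> Liminf (at_right 0)
                (\<lambda>r. ereal (sup_abs B r \<omega> / (r powr (CARD('n) * h) * Psi_l CARD('n) h r))) \<and>
          Liminf (at_right 0)
              (\<lambda>r. ereal (sup_abs B r \<omega> / (r powr (CARD('n) * h) * \<Psi>u r)))
            \<le> ereal (\<kappa>2 powr (h / CARD('n)))))"
proof -
  interpret mpfbm_process M h B by unfold_locales (use assms in auto)
  have "AE \<omega> in M.
          ereal (\<kappa>1 powr (h / CARD('n)))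
            \<le> Liminf (at_right 0)
                (\<lambda>r. ereal (sup_abs B r \<omega> / (r powr (CARD('n) * h) * Psi_l CARD('n) h r))) \<and>
          Liminf (at_right 0)
              (\<lambda>r. ereal (sup_abs B r \<omega> / (r powr (CARD('n) * h) * \<Psi>u r)))
            \<le> ereal (\<kappa>2 powr (h / CARD('n)))"
    if "upper_rate (F_fun J \<mu> \<Delta>) CARD('n) h \<eta> k0 \<Psi>u" and C: "small_ball_constants M h B \<kappa>1 \<kappa>2"
    for \<eta> k0 \<Psi>u \<kappa>1 \<kappa>2
  proof -
    have \<Psi>: "\<forall>\<^sub>F r in at_right 0. Psi_l CARD('n) h r \<le> \<Psi>u r" using that(1) by (simp add: upper_rate_def)
    have small: "\<forall>\<^sub>F r in at_right (0::real). r < exp (- 1)" by (rule eventually_at_rightI[of 0 "exp (- 1)"]) auto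
    from liminf_lower[OF C] liminf_upper[OF C] AE_space show ?thesis
    proof eventually_elim
      case (elim \<omega>)
      \<comment> \<open>The numerator is nonnegative and \<open>Psi_l\<close> is positive near 0, so
        the larger rate gives the smaller quotient.\<close>
      have "\<forall>\<^sub>F r in at_right 0. ereal (sup_abs B r \<omega> / (r powr (CARD('n) * h) * \<Psi>u r))
          \<le> ereal (sup_abs B r \<omega> / (r powr (CARD('n) * h) * Psi_l CARD('n) h r))"
        using \<Psi> small eventually_at_right_less[of "0::real"]
      proof eventually_elim
        case (elim r)
        have "0 < Psi_l CARD('n) h r" using elim by (intro Psi_l_pos)
        then show ?case
          using elim sup_abs_nonneg[OF \<open>\<omega> \<in> space M\<close>, of r]
          by (simp, intro divide_left_mono mult_left_mono mult_pos_pos) auto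
      qed
      then have "Liminf (at_right 0) (\<lambda>r. ereal (sup_abs B r \<omega> / (r powr (CARD('n) * h) * \<Psi>u r)))
          \<le> Liminf (at_right 0) (\<lambda>r. ereal (sup_abs B r \<omega> / (r powr (CARD('n) * h) * Psi_l CARD('n) h r)))"
        by (rule Liminf_mono)
      then show ?case using elim by (auto intro: order_trans)
    qed
  qed
  then have main: "\<exists>\<eta>0>0. \<forall>\<eta> k0 \<Psi>u \<kappa>1 \<kappa>2.
       0 < \<eta> \<and> \<eta> < \<eta>0 \<and>
       admissible_start (F_fun J \<mu> \<Delta>) CARD('n) h \<eta> k0 \<and>
       upper_rate (F_fun J \<mu> \<Delta>) CARD('n) h \<eta> k0 \<Psi>u \<and>
       small_ball_constants M h B \<kappa>1 \<kappa>2 \<longrightarrow>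
       (AE \<omega> in M.
          ereal (\<kappa>1 powr (h / CARD('n)))
            \<le> Liminf (at_right 0)
                (\<lambda>r. ereal (sup_abs B r \<omega> / (r powr (CARD('n) * h) * Psi_l CARD('n) h r))) \<and>
          Liminf (at_right 0)
              (\<lambda>r. ereal (sup_abs B r \<omega> / (r powr (CARD('n) * h) * \<Psi>u r)))
            \<le> ereal (\<kappa>2 powr (h / CARD('n))))"
    by (intro exI[of _ "1::real"] conjI zero_less_one allI impI) (elim conjE)
  show ?thesis by (rule conjI[OF small_ball_constants_exist main])
qed

end
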